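(* Let $\Bbbk$ be an algebraically closed field of characteristic $0$ and let $H=\Bbbk\mathrm{Q}^a/I$ be a finite-dimensional gentle algebra over $\Bbbk$, where $(\mathrm{Q},I)$ is a gentle quiver. Then the algebra $H$ admits a Hopf algebra structure if and only if $\mathrm{Q}$ is a disjoint union of basic cycles of length $n$ and $I=J^2$, where $n$ is an even number and $J$ is the ideal of $\Bbbk\mathrm{Q}^a$ generated by the arrows.
   Context: $\Bbbk\mathrm{Q}^a$ is the path algebra of a finite quiver $\mathrm{Q}$ (paths read from right to left). A basic cycle of length $n$ is the quiver with $n$ vertices $e_0,\dots,e_{n-1}$ and $n$ arrows $a_0,\dots,a_{n-1}$, where $a_i$ goes from $e_i$ to $e_{i+1}$ (indices mod $n$). A gentle quiver $(\mathrm{Q},I)$ consists of a quiver $\mathrm{Q}$ and an ideal $I$ of $\Bbbk\mathrm{Q}^a$ such that: (a) at every vertex of $\mathrm{Q}$ at most two arrows stop and at most two arrows start; (b) $I$ is generated by paths of length two; (c) for every arrow $\beta$ there is at most one arrow $\alpha$ such that $\beta\alpha$ is a path not in $I$, and at most one arrow $\gamma$ such that $\gamma\beta$ is a path not in $I$; (d) for every arrow $\beta$ there is at most one arrow $\alpha'$ such that $\beta\alpha'$ is a path in $I$, and at most one arrow $\gamma'$ such that $\gamma'\beta$ is a path in $I$. A $\Bbbk$-algebra is gentle if it is isomorphic to $\Bbbk\mathrm{Q}^a/I$ for a gentle quiver $(\mathrm{Q},I)$.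
   Formalization: The quiver Q is assumed to have at least one arrow; otherwise the claim fails: for m ≥ 1 isolated vertices and I = 0, H = k^m is a Hopf algebra (functions on Z/m), but Q is not a disjoint union of basic cycles. *)

theory Defs
  imports
    "HOL-Algebra.Algebraic_Closure_Type"
    "HOL-Algebra.QuotRing"
    "HOL-Algebra.Ideal_Product"
    "Graph_Theory.Arc_Walk"
    "Graph_Theory.Digraph_Isomorphism"
begin

section \<open>Algebras over a field\<close>

text \<open>
  The ground field is a type of class \<open>field\<close>; algebras are records with a carrier set.
  The library locale \<open>algebra\<close> is not applicable, since it demands that the algebra be commutative.
\<close>

locale assoc_algebra = module "ring_of_type_algebra :: 'k::field ring" A + ring A
  for A :: "('k::field, 'h) module" (structure) +
  assumes smult_mult_left:
      "x \<in> carrier A \<Longrightarrow> y \<in> carrier A \<Longrightarrow> (c \<odot> x) \<otimes> y = c \<odot> (x \<otimes> y)"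
    and smult_mult_right:
      "x \<in> carrier A \<Longrightarrow> y \<in> carrier A \<Longrightarrow> x \<otimes> (c \<odot> y) = c \<odot> (x \<otimes> y)"

definition field_algebra :: "('k::field, 'k) module" where
  "field_algebra = ring.extend ring_of_type_algebra (module.fields (*))"

definition lin_map :: "('k, 'a) module \<Rightarrow> ('k, 'b) module \<Rightarrow> ('a \<Rightarrow> 'b) set" where
  "lin_map A B = {f. f \<in> carrier A \<rightarrow> carrier B \<and>
     (\<forall>x\<in>carrier A. \<forall>y\<in>carrier A. f (x \<oplus>\<^bsub>A\<^esub> y) = f x \<oplus>\<^bsub>B\<^esub> f y) \<and>
     (\<forall>c. \<forall>x\<in>carrier A. f (c \<odot>\<^bsub>A\<^esub> x) = c \<odot>\<^bsub>B\<^esub> f x)}"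

definition alg_hom :: "('k, 'a) module \<Rightarrow> ('k, 'b) module \<Rightarrow> ('a \<Rightarrow> 'b) set" where
  "alg_hom A B = ring_hom A B \<inter> lin_map A B"

definition finite_dimensional :: "('k, 'a) module \<Rightarrow> bool" where
  "finite_dimensional A \<longleftrightarrow> (\<exists>B. finite B \<and> B \<subseteq> carrier A \<and>
     (\<forall>x\<in>carrier A. \<exists>c. x = (\<Oplus>\<^bsub>A\<^esub>b\<in>B. c b \<odot>\<^bsub>A\<^esub> b)))"

definition quot_algebra :: "('k, 'a) module \<Rightarrow> 'a set \<Rightarrow> ('k, 'a set) module" where
  "quot_algebra A I =
     ring.extend (A Quot I) (module.fields (\<lambda>c T. \<Union>x\<in>T. I +>\<^bsub>A\<^esub> (c \<odot>\<^bsub>A\<^esub> x)))"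


section \<open>Free vector spaces and tensor products\<close>

definition finsupp :: "'s set \<Rightarrow> ('s \<Rightarrow> 'k::zero) set" where
  "finsupp S = {f. finite {s. f s \<noteq> 0} \<and> {s. f s \<noteq> 0} \<subseteq> S}"

definition delta :: "'s \<Rightarrow> 's \<Rightarrow> 'k::zero_neq_one" where
  "delta s = (\<lambda>t. if t = s then 1 else 0)"

definition monoid_algebra :: "('s, 'm) monoid_scheme \<Rightarrow> ('k::field, 's \<Rightarrow> 'k) module" where
  "monoid_algebra M =
     \<lparr>carrier = finsupp (carrier M),
      monoid.mult = (\<lambda>f g z. \<Sum>(x, y) \<in> {(x, y). f x \<noteq> 0 \<and> g y \<noteq> 0 \<and> x \<otimes>\<^bsub>M\<^esub> y = z}. f x * g y),
      one = delta \<one>\<^bsub>M\<^esub>,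
      ring.zero = (\<lambda>_. 0),
      add = (\<lambda>f g z. f z + g z),
      module.smult = (\<lambda>c f z. c * f z)\<rparr>"

text \<open>
  \<open>A \<otimes> B\<close> is the free vector space on the set \<open>A \<times> B\<close> modulo the bilinearity relations.
  Taking the free vector space as the monoid algebra of the multiplicative monoid \<open>A \<times> B\<close>
  equips the quotient with the product \<open>(a \<otimes> b)(a' \<otimes> b') = aa' \<otimes> bb'\<close>; multiplying a relation
  by a pair gives a relation, so the ideal generated by the relations is just their linear span.
\<close>

definition tensor_rels :: "('k::field, 'a) module \<Rightarrow> ('k, 'b) module \<Rightarrow> ('a \<times> 'b \<Rightarrow> 'k) set" where
  "tensor_rels A B =
     {\<lambda>z. delta (a \<oplus>\<^bsub>A\<^esub> a', b) z - delta (a, b) z - delta (a', b) z | a a' b.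
        a \<in> carrier A \<and> a' \<in> carrier A \<and> b \<in> carrier B} \<union>
     {\<lambda>z. delta (a, b \<oplus>\<^bsub>B\<^esub> b') z - delta (a, b) z - delta (a, b') z | a b b'.
        a \<in> carrier A \<and> b \<in> carrier B \<and> b' \<in> carrier B} \<union>
     {\<lambda>z. delta (c \<odot>\<^bsub>A\<^esub> a, b) z - c * delta (a, b) z | c a b.
        a \<in> carrier A \<and> b \<in> carrier B} \<union>
     {\<lambda>z. delta (a, c \<odot>\<^bsub>B\<^esub> b) z - c * delta (a, b) z | c a b.
        a \<in> carrier A \<and> b \<in> carrier B}"

definition tensor_ideal :: "('k::field, 'a) module \<Rightarrow> ('k, 'b) module \<Rightarrow> ('a \<times> 'b \<Rightarrow> 'k) set" where
  "tensor_ideal A B = Idl\<^bsub>monoid_algebra (A \<times>\<times> B)\<^esub> (tensor_rels A B)"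

definition tensor_algebra ::
    "('k::field, 'a) module \<Rightarrow> ('k, 'b) module \<Rightarrow> ('k, ('a \<times> 'b \<Rightarrow> 'k) set) module" where
  "tensor_algebra A B = quot_algebra (monoid_algebra (A \<times>\<times> B)) (tensor_ideal A B)"

definition pure_tensor ::
    "('k::field, 'a) module \<Rightarrow> ('k, 'b) module \<Rightarrow> 'a \<Rightarrow> 'b \<Rightarrow> ('a \<times> 'b \<Rightarrow> 'k) set" where
  "pure_tensor A B a b = tensor_ideal A B +>\<^bsub>monoid_algebra (A \<times>\<times> B)\<^esub> delta (a, b)"

text \<open>
  The linear map \<open>A \<otimes> B \<rightarrow> C\<close> induced by a map \<open>\<beta>\<close> that is bilinear on \<open>A \<times> B\<close>: evaluate
  \<open>\<beta>\<close> on any representative \<open>\<phi>\<close> of the given tensor. It is used with bilinear \<open>\<beta>\<close> only,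
  for which the result does not depend on \<open>\<phi>\<close>.
\<close>

definition tensor_lift ::
    "('k::field, 'c) module \<Rightarrow> ('a \<Rightarrow> 'b \<Rightarrow> 'c) \<Rightarrow> ('a \<times> 'b \<Rightarrow> 'k) set \<Rightarrow> 'c" where
  "tensor_lift C \<beta> t =
     (THE y. \<exists>\<phi>\<in>t. y = (\<Oplus>\<^bsub>C\<^esub>p\<in>{p. \<phi> p \<noteq> 0}. \<phi> p \<odot>\<^bsub>C\<^esub> \<beta> (fst p) (snd p)))"

definition tensor_map ::
    "('k::field, 'c) module \<Rightarrow> ('k, 'd) module \<Rightarrow> ('a \<Rightarrow> 'c) \<Rightarrow> ('b \<Rightarrow> 'd) \<Rightarrow>
     ('a \<times> 'b \<Rightarrow> 'k) set \<Rightarrow> ('c \<times> 'd \<Rightarrow> 'k) set" where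
  "tensor_map C D f g =
     tensor_lift (tensor_algebra C D) (\<lambda>a b. pure_tensor C D (f a) (g b))"

definition tensor_assoc ::
    "('k::field, 'a) module \<Rightarrow> ('k, 'b) module \<Rightarrow> ('k, 'c) module \<Rightarrow>
     (('a \<times> 'b \<Rightarrow> 'k) set \<times> 'c \<Rightarrow> 'k) set \<Rightarrow> ('a \<times> ('b \<times> 'c \<Rightarrow> 'k) set \<Rightarrow> 'k) set" where
  "tensor_assoc A B C =
     (let T = tensor_algebra A (tensor_algebra B C) in
      tensor_lift T (\<lambda>t c. tensor_lift T
        (\<lambda>a b. pure_tensor A (tensor_algebra B C) a (pure_tensor B C b c)) t))"


section \<open>Hopf algebras\<close>

locale hopf_algebra = assoc_algebra H
  for H :: "('k::field, 'h) module" (structure) +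
  fixes \<Delta> :: "'h \<Rightarrow> ('h \<times> 'h \<Rightarrow> 'k) set"
    and \<epsilon> :: "'h \<Rightarrow> 'k"
    and S :: "'h \<Rightarrow> 'h"
  assumes comult_hom: "\<Delta> \<in> alg_hom H (tensor_algebra H H)"
    and counit_hom: "\<epsilon> \<in> alg_hom H field_algebra"
    and antipode_linear: "S \<in> lin_map H H"
    and coassoc: "x \<in> carrier H \<Longrightarrow>
      tensor_assoc H H H (tensor_map (tensor_algebra H H) H \<Delta> id (\<Delta> x)) =
      tensor_map H (tensor_algebra H H) id \<Delta> (\<Delta> x)"
    and counit_left: "x \<in> carrier H \<Longrightarrow> tensor_lift H (\<lambda>a b. \<epsilon> a \<odot> b) (\<Delta> x) = x"
    and counit_right: "x \<in> carrier H \<Longrightarrow> tensor_lift H (\<lambda>a b. \<epsilon> b \<odot> a) (\<Delta> x) = x"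
    and antipode_left: "x \<in> carrier H \<Longrightarrow>
      tensor_lift H (\<lambda>a b. S a \<otimes> b) (\<Delta> x) = \<epsilon> x \<odot> \<one>"
    and antipode_right: "x \<in> carrier H \<Longrightarrow>
      tensor_lift H (\<lambda>a b. a \<otimes> S b) (\<Delta> x) = \<epsilon> x \<odot> \<one>"

definition admits_hopf_structure :: "('k::field, 'h) module \<Rightarrow> bool" where
  "admits_hopf_structure H \<longleftrightarrow> (\<exists>\<Delta> \<epsilon> S. hopf_algebra H \<Delta> \<epsilon> S)"


section \<open>Quivers and path algebras\<close>

text \<open>
  Quivers are the multigraphs of the graph library. A path is a pair \<open>(u, p)\<close> of its source and
  the list of its arrows in the order of traversal, so the right-to-left word \<open>\<beta>\<alpha>\<close>
  is encoded as the arrow list \<open>[\<alpha>, \<beta>]\<close>, and \<open>(u, [])\<close> is the trivial path at \<open>u\<close>.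
\<close>

definition quiver_paths :: "('v, 'a) pre_digraph \<Rightarrow> ('v \<times> 'a list) set" where
  "quiver_paths Q = {(u, p). \<exists>v. pre_digraph.awalk Q u p v}"

text \<open>
  In a product \<open>f \<otimes> g\<close> the path in \<open>g\<close> is traversed first: the coefficient of \<open>(u, p)\<close>
  sums over all ways to cut \<open>p\<close> into an initial part (from \<open>g\<close>) and a final part (from \<open>f\<close>).
\<close>

definition path_algebra :: "('v, 'a) pre_digraph \<Rightarrow> ('k::field, 'v \<times> 'a list \<Rightarrow> 'k) module" where
  "path_algebra Q =
     \<lparr>carrier = finsupp (quiver_paths Q),
      monoid.mult = (\<lambda>f g (u, p). \<Sum>i\<le>length p.
        f (pre_digraph.awlast Q u (take i p), drop i p) * g (u, take i p)),
      one = (\<lambda>(u, p). if u \<in> verts Q \<and> p = [] then 1 else 0),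
      ring.zero = (\<lambda>_. 0),
      add = (\<lambda>f g z. f z + g z),
      module.smult = (\<lambda>c f z. c * f z)\<rparr>"

definition arrow_elem :: "('v, 'a) pre_digraph \<Rightarrow> 'a \<Rightarrow> 'v \<times> 'a list \<Rightarrow> 'k::field" where
  "arrow_elem Q \<alpha> = delta (tail Q \<alpha>, [\<alpha>])"

text \<open>The basis element \<open>\<beta>\<alpha>\<close>; this is a path if \<open>\<alpha>\<close> ends where \<open>\<beta>\<close> starts.\<close>

definition path2_elem :: "('v, 'a) pre_digraph \<Rightarrow> 'a \<Rightarrow> 'a \<Rightarrow> 'v \<times> 'a list \<Rightarrow> 'k::field" where
  "path2_elem Q \<beta> \<alpha> = delta (tail Q \<alpha>, [\<alpha>, \<beta>])"

definition composable :: "('v, 'a) pre_digraph \<Rightarrow> 'a \<Rightarrow> 'a \<Rightarrow> bool" where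
  "composable Q \<beta> \<alpha> \<longleftrightarrow> \<alpha> \<in> arcs Q \<and> \<beta> \<in> arcs Q \<and> head Q \<alpha> = tail Q \<beta>"

definition arrow_ideal :: "('v, 'a) pre_digraph \<Rightarrow> ('v \<times> 'a list \<Rightarrow> 'k::field) set" where
  "arrow_ideal Q = Idl\<^bsub>path_algebra Q\<^esub> (arrow_elem Q ` arcs Q)"


section \<open>Gentle quivers\<close>

locale gentle_quiver = fin_digraph Q
  for Q :: "('v, 'a) pre_digraph" +
  fixes I :: "('v \<times> 'a list \<Rightarrow> 'k::field) set"
  assumes at_most_two_stop: "v \<in> verts Q \<Longrightarrow> card {\<alpha> \<in> arcs Q. head Q \<alpha> = v} \<le> 2"
    and at_most_two_start: "v \<in> verts Q \<Longrightarrow> card {\<alpha> \<in> arcs Q. tail Q \<alpha> = v} \<le> 2"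
    and generated_by_length_two:
      "\<exists>R \<subseteq> {(\<beta>, \<alpha>). composable Q \<beta> \<alpha>}.
         I = Idl\<^bsub>path_algebra Q\<^esub> ((\<lambda>(\<beta>, \<alpha>). path2_elem Q \<beta> \<alpha>) ` R)"
    and before_not_in:
      "\<beta> \<in> arcs Q \<Longrightarrow> card {\<alpha>. composable Q \<beta> \<alpha> \<and> path2_elem Q \<beta> \<alpha> \<notin> I} \<le> 1"
    and after_not_in:
      "\<beta> \<in> arcs Q \<Longrightarrow> card {\<gamma>. composable Q \<gamma> \<beta> \<and> path2_elem Q \<gamma> \<beta> \<notin> I} \<le> 1"
    and before_in:
      "\<beta> \<in> arcs Q \<Longrightarrow> card {\<alpha>. composable Q \<beta> \<alpha> \<and> path2_elem Q \<beta> \<alpha> \<in> I} \<le> 1"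
    and after_in:
      "\<beta> \<in> arcs Q \<Longrightarrow> card {\<gamma>. composable Q \<gamma> \<beta> \<and> path2_elem Q \<gamma> \<beta> \<in> I} \<le> 1"


section \<open>Basic cycles\<close>

definition basic_cycle :: "nat \<Rightarrow> (nat, nat) pre_digraph" where
  "basic_cycle n = \<lparr>verts = {..<n}, arcs = {..<n}, tail = (\<lambda>i. i), head = (\<lambda>i. Suc i mod n)\<rparr>"

definition disjoint_union ::
    "'i set \<Rightarrow> ('i \<Rightarrow> ('v, 'a) pre_digraph) \<Rightarrow> ('i \<times> 'v, 'i \<times> 'a) pre_digraph" where
  "disjoint_union S G =
     \<lparr>verts = (SIGMA i:S. verts (G i)), arcs = (SIGMA i:S. arcs (G i)),
      tail = (\<lambda>(i, e). (i, tail (G i) e)), head = (\<lambda>(i, e). (i, head (G i) e))\<rparr>"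

text \<open>All cycles of the union have the same length \<open>n \<ge> 1\<close>.\<close>

definition union_of_basic_cycles :: "nat \<Rightarrow> ('v, 'a) pre_digraph \<Rightarrow> bool" where
  "union_of_basic_cycles n Q \<longleftrightarrow> n \<ge> 1 \<and>
     (\<exists>S :: nat set. finite S \<and> S \<noteq> {} \<and> digraph_iso Q (disjoint_union S (\<lambda>_. basic_cycle n)))"

end

theory Submission
  imports Defs
begin

text \<open>
  Both directions are read in the dual of \<open>H\<close> with its convolution product. The coefficient functionals
  \<open>\<chi> v\<close> of the trivial paths are exactly the characters of \<open>H\<close>, so a Hopf structure turns the vertices
  into a group, and the coefficient \<open>\<phi> \<alpha>\<close> of an arrow \<open>\<alpha>\<close> is a skew derivation with respect to the
  characters at its ends. Translation by characters permutes these skew derivations, which makes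
  the quiver homogeneous. If two arrows left some vertex, then two arrows would leave every vertex, and
  gentleness would give nonzero paths of every length. Hence exactly one arrow leaves each vertex
  and it joins \<open>v\<close> to \<open>v g\<close> for a fixed \<open>g\<close>; some product of two arrows vanishes by finite dimension,
  and all do by homogeneity. With \<open>F = \<phi> \<alpha>\<close> for the arrow from \<open>1\<close> to \<open>g\<close>, evaluating \<open>F * F\<close>
  at a vanishing product of two arrows gives \<open>F * \<chi> g = - \<chi> g * F\<close> up to combinations of characters,
  so that \<open>\<chi> g ^ n = 1\<close> forces \<open>n\<close> to be even. Conversely, label the vertices of \<open>d\<close> cycles of even length
  \<open>n\<close> by \<open>\<int>/d \<times> \<int>/n\<close> and let \<open>\<sigma>\<close> be the sign character of the second factor; the products
  \<open>\<chi> u * \<chi> v = \<chi> (u v)\<close>, \<open>\<phi> u * \<chi> v = \<phi> (u v)\<close>, \<open>\<chi> u * \<phi> v = \<sigma> u \<phi> (u v)\<close>, \<open>\<phi> u * \<phi> v = 0\<close>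
  dualise to a Hopf structure.
\<close>


section \<open>Linear maps and algebras\<close>

text \<open>The coproduct of an unknown Hopf structure cannot be computed on paths. In the dual the
  roles are favourable: multiplication in \<open>H\<close> cuts paths, so coefficient functionals
  expand explicitly (\<open>path_coeff_mult\<close>), while the coproduct enters only through
  \<open>pairing\<close>, as an associative product for which \<open>factors_conv\<close> holds.
  Characters and skew derivations are the group-like and skew primitive elements of the dual. Both
  notions refer to the multiplication of \<open>H\<close> alone, so a translated arrow functional is
  again a skew derivation and can be compared with arrows. The comparison is only modulo inner
  derivations, the multiples of \<open>\<chi> s - \<chi> t\<close>; these vanish at arrows, which is
  why the arguments evaluate there. The sign in the converse is forced in the same way. For the
  arrow functional x at the identity, with coproduct x tensor 1 plus z tensor x, the mixed part of
  the coproduct of the square of x is (xz + zx) tensor x; if the square is to vanish, x and z must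
  anticommute. The dual so obtained is the bosonization, over the group algebra of
  \<open>\<int>/d \<times> \<int>/n\<close>, of the exterior algebra on one generator.\<close>

lemma ring_of_type_algebra_simps [simp]:
  "carrier ring_of_type_algebra = UNIV" "\<zero>\<^bsub>ring_of_type_algebra\<^esub> = 0" "\<one>\<^bsub>ring_of_type_algebra\<^esub> = 1"
  "x \<oplus>\<^bsub>ring_of_type_algebra\<^esub> y = x + y" "x \<otimes>\<^bsub>ring_of_type_algebra\<^esub> y = x * y"
  by (simp_all add: ring_of_type_algebra_def)

lemma assoc_algebraI:
  fixes A :: "('k::field, 'h) module" (structure)
  assumes "ring A"
    and "\<And>c x. x \<in> carrier A \<Longrightarrow> c \<odot> x \<in> carrier A"
    and "\<And>c d x. x \<in> carrier A \<Longrightarrow> (c + d) \<odot> x = c \<odot> x \<oplus> d \<odot> x"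
    and "\<And>c x y. x \<in> carrier A \<Longrightarrow> y \<in> carrier A \<Longrightarrow> c \<odot> (x \<oplus> y) = c \<odot> x \<oplus> c \<odot> y"
    and "\<And>c d x. x \<in> carrier A \<Longrightarrow> (c * d) \<odot> x = c \<odot> (d \<odot> x)"
    and "\<And>x. x \<in> carrier A \<Longrightarrow> 1 \<odot> x = x"
    and "\<And>c x y. x \<in> carrier A \<Longrightarrow> y \<in> carrier A \<Longrightarrow> (c \<odot> x) \<otimes> y = c \<odot> (x \<otimes> y)"
    and "\<And>c x y. x \<in> carrier A \<Longrightarrow> y \<in> carrier A \<Longrightarrow> x \<otimes> (c \<odot> y) = c \<odot> (x \<otimes> y)"
  shows "assoc_algebra A"
proof -
  interpret ring A by fact
  have "module (ring_of_type_algebra :: 'k ring) A"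
    by (rule moduleI) (use assms in \<open>auto intro: cring_from_type_algebra abelian_group_axioms\<close>)
  then show ?thesis
    by (simp add: assoc_algebra_def assoc_algebra_axioms_def assms)
qed

context assoc_algebra
begin

lemmas alg = assoc_algebra_axioms

lemma sm_closed [simp]: "x \<in> carrier A \<Longrightarrow> c \<odot> x \<in> carrier A"
  by (rule smult_closed) auto

lemma sm_add_left: "x \<in> carrier A \<Longrightarrow> (c + d) \<odot> x = c \<odot> x \<oplus> d \<odot> x"
  using smult_l_distr[of c d x] by simp

lemma sm_add_right: "x \<in> carrier A \<Longrightarrow> y \<in> carrier A \<Longrightarrow> c \<odot> (x \<oplus> y) = c \<odot> x \<oplus> c \<odot> y"
  using smult_r_distr[of c x y] by simp

lemma sm_sm: "x \<in> carrier A \<Longrightarrow> c \<odot> (d \<odot> x) = (c * d) \<odot> x"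
  using smult_assoc1[of c d x] by simp

lemma sm_one [simp]: "x \<in> carrier A \<Longrightarrow> 1 \<odot> x = x"
  using smult_one[of x] by simp

lemma sm_zero_left [simp]: "x \<in> carrier A \<Longrightarrow> 0 \<odot> x = \<zero>"
  using smult_l_null[of x] by simp

lemma sm_zero_right [simp]: "c \<odot> \<zero> = \<zero>"
  using smult_r_null[of c] by simp

lemma sm_minus_one: "x \<in> carrier A \<Longrightarrow> (- 1) \<odot> x = \<ominus> x"
  using sm_add_left[of x 1 "-1"] by (metis add.right_inverse minus_equality sm_add_left sm_closed sm_one sm_zero_left add.left_inverse)

lemma finsum_sm: "finite S \<Longrightarrow> f \<in> S \<rightarrow> carrier A \<Longrightarrow> c \<odot> (\<Oplus>i\<in>S. f i) = (\<Oplus>i\<in>S. c \<odot> f i)"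
  by (induction S rule: finite_induct) (auto simp: Pi_def sm_add_right)

end

lemma field_algebra_simps [simp]:
  "carrier field_algebra = UNIV" "\<zero>\<^bsub>field_algebra\<^esub> = 0" "\<one>\<^bsub>field_algebra\<^esub> = 1"
  "x \<oplus>\<^bsub>field_algebra\<^esub> y = x + y" "x \<otimes>\<^bsub>field_algebra\<^esub> y = x * y"
  "c \<odot>\<^bsub>field_algebra\<^esub> y = c * y"
  by (simp_all add: ring_of_type_algebra_def field_algebra_def ring.defs module.defs)

lemma assoc_algebra_field_algebra: "assoc_algebra (field_algebra :: ('k::field, 'k) module)"
proof (rule assoc_algebraI)
  have "\<exists>y. x + y = 0" for x :: 'k
    using add.right_inverse by blast
  then show "ring (field_algebra :: ('k, 'k) module)"
    by unfold_locales (auto simp: algebra_simps Units_def)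
qed (auto simp: algebra_simps)

lemma finsum_field_algebra [simp]:
  "finsum (field_algebra :: ('k::field, 'k) module) f S = sum f S"
proof -
  interpret assoc_algebra "field_algebra :: ('k, 'k) module" by (rule assoc_algebra_field_algebra)
  show ?thesis
    by (induction S rule: infinite_finite_induct) (auto simp: finsum_infinite)
qed

locale linear_map = A: assoc_algebra A + B: assoc_algebra B
  for A :: "('k::field, 'a) module" and B :: "('k, 'b) module" and f +
  assumes in_lin_map: "f \<in> lin_map A B"
begin

lemma closed [simp]: "x \<in> carrier A \<Longrightarrow> f x \<in> carrier B"
  and add: "x \<in> carrier A \<Longrightarrow> y \<in> carrier A \<Longrightarrow> f (x \<oplus>\<^bsub>A\<^esub> y) = f x \<oplus>\<^bsub>B\<^esub> f y"
  and scale: "x \<in> carrier A \<Longrightarrow> f (c \<odot>\<^bsub>A\<^esub> x) = c \<odot>\<^bsub>B\<^esub> f x"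
  using in_lin_map by (auto simp: lin_map_def)

lemma zero [simp]: "f \<zero>\<^bsub>A\<^esub> = \<zero>\<^bsub>B\<^esub>"
  using scale[of "\<zero>\<^bsub>A\<^esub>" 0] by simp

lemma sum: "finite S \<Longrightarrow> g \<in> S \<rightarrow> carrier A \<Longrightarrow> f (\<Oplus>\<^bsub>A\<^esub>i\<in>S. g i) = (\<Oplus>\<^bsub>B\<^esub>i\<in>S. f (g i))"
  by (induction S rule: finite_induct) (auto simp: Pi_def add)

end

lemma linear_mapI:
  assumes "assoc_algebra A" "assoc_algebra B"
    and "\<And>x. x \<in> carrier A \<Longrightarrow> f x \<in> carrier B"
    and "\<And>x y. x \<in> carrier A \<Longrightarrow> y \<in> carrier A \<Longrightarrow> f (x \<oplus>\<^bsub>A\<^esub> y) = f x \<oplus>\<^bsub>B\<^esub> f y"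
    and "\<And>c x. x \<in> carrier A \<Longrightarrow> f (c \<odot>\<^bsub>A\<^esub> x) = c \<odot>\<^bsub>B\<^esub> f x"
  shows "linear_map A B f"
  using assms by (auto simp: linear_map_def linear_map_axioms_def lin_map_def)

lemma linear_map_comp:
  assumes "linear_map A B f" "linear_map B C g"
  shows "linear_map A C (\<lambda>x. g (f x))"
proof -
  interpret f: linear_map A B f by fact
  interpret g: linear_map B C g by fact
  show ?thesis
    by (rule linear_mapI) (auto simp: f.add g.add f.scale g.scale f.A.alg g.B.alg)
qed

lemma (in assoc_algebra) linear_map_id: "linear_map A A (\<lambda>x. x)"
  by (rule linear_mapI) (auto simp: alg)

lemma linear_map_add:
  assumes "linear_map A B f" "linear_map A B g"
  shows "linear_map A B (\<lambda>x. f x \<oplus>\<^bsub>B\<^esub> g x)"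
proof -
  interpret f: linear_map A B f by fact
  interpret g: linear_map A B g by fact
  show ?thesis
    by (rule linear_mapI)
      (auto simp: f.add g.add f.scale g.scale f.A.alg f.B.alg
        f.B.sm_add_right f.B.a_ac)
qed

lemma linear_map_scale:
  assumes "linear_map A B f"
  shows "linear_map A B (\<lambda>x. c \<odot>\<^bsub>B\<^esub> f x)"
proof -
  interpret f: linear_map A B f by fact
  show ?thesis
    by (rule linear_mapI)
      (auto simp: f.add f.scale f.A.alg f.B.alg
        f.B.sm_add_right f.B.sm_sm mult.commute)
qed

lemma linear_map_finsum:
  assumes "assoc_algebra A" "assoc_algebra B" "finite S" "\<And>i. i \<in> S \<Longrightarrow> linear_map A B (f i)"
  shows "linear_map A B (\<lambda>x. \<Oplus>\<^bsub>B\<^esub>i\<in>S. f i x)"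
  using assms(3,4)
proof (induction S rule: finite_induct)
  case empty
  interpret A: assoc_algebra A by fact
  interpret B: assoc_algebra B by fact
  show ?case by (rule linear_mapI) (auto simp: assms)
next
  case (insert i S)
  interpret B: assoc_algebra B by fact
  have *: "f j x \<in> carrier B" if "j \<in> insert i S" "x \<in> carrier A" for j x
    using insert.prems[OF that(1)] that(2) by (rule linear_map.closed)
  have "linear_map A B (\<lambda>x. f i x \<oplus>\<^bsub>B\<^esub> (\<Oplus>\<^bsub>B\<^esub>i\<in>S. f i x))"
    by (rule linear_map_add) (use insert in auto)
  then interpret l: linear_map A B "\<lambda>x. f i x \<oplus>\<^bsub>B\<^esub> (\<Oplus>\<^bsub>B\<^esub>i\<in>S. f i x)" .
  have eq: "(\<Oplus>\<^bsub>B\<^esub>i\<in>insert i S. f i x) = f i x \<oplus>\<^bsub>B\<^esub> (\<Oplus>\<^bsub>B\<^esub>i\<in>S. f i x)" if "x \<in> carrier A" for x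
    using insert.hyps * that by (auto simp: Pi_def)
  show ?case
    by (rule linear_mapI) (auto simp: assms eq l.add l.scale l.A.sm_closed l.closed)
qed

lemma linear_map_cong:
  assumes "linear_map A B f" "\<And>x. x \<in> carrier A \<Longrightarrow> g x = f x"
  shows "linear_map A B g"
proof -
  interpret f: linear_map A B f by fact
  show ?thesis
    by (rule linear_mapI)
      (auto simp: f.add f.scale f.A.alg f.B.alg assms(2))
qed

lemma (in assoc_algebra) linear_map_mult_left: "y \<in> carrier A \<Longrightarrow> linear_map A A (\<lambda>x. x \<otimes> y)"
  by (rule linear_mapI) (auto simp: alg l_distr smult_mult_left)

lemma (in assoc_algebra) linear_map_mult_right: "y \<in> carrier A \<Longrightarrow> linear_map A A (\<lambda>x. y \<otimes> x)"
  by (rule linear_mapI) (auto simp: alg r_distr smult_mult_right)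

lemma (in assoc_algebra) linear_map_scalar:
  "y \<in> carrier A \<Longrightarrow> linear_map field_algebra A (\<lambda>c. c \<odot> y)"
  by (rule linear_mapI) (auto simp: alg sm_add_left sm_sm assoc_algebra_field_algebra)


section \<open>Free vector spaces\<close>

lemma finsupp_delta: "s \<in> S \<Longrightarrow> delta s \<in> finsupp S"
  by (auto simp: finsupp_def delta_def)

lemma finsupp_zero: "(\<lambda>_. 0) \<in> finsupp S"
  by (auto simp: finsupp_def)

lemma finsupp_add: "f \<in> finsupp S \<Longrightarrow> g \<in> finsupp S \<Longrightarrow> (\<lambda>z. f z + g z :: 'k::field) \<in> finsupp S"
proof -
  assume *: "f \<in> finsupp S" "g \<in> finsupp S"
  have "{s. f s + g s \<noteq> 0} \<subseteq> {s. f s \<noteq> 0} \<union> {s. g s \<noteq> 0}"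
    by auto
  with * show ?thesis
    by (auto simp: finsupp_def dest: finite_subset)
qed

lemma finsupp_scale: "f \<in> finsupp S \<Longrightarrow> (\<lambda>z. c * f z :: 'k::field) \<in> finsupp S"
  unfolding finsupp_def
  by (auto intro: finite_subset[where B = "{s. f s \<noteq> 0}"])

lemma finsupp_induct [consumes 1, case_names zero add]:
  fixes f :: "'s \<Rightarrow> 'k::field"
  assumes "f \<in> finsupp S" "P (\<lambda>_. 0)"
    and step: "\<And>f c s. f \<in> finsupp S \<Longrightarrow> s \<in> S \<Longrightarrow> P f \<Longrightarrow> P (\<lambda>z. f z + c * delta s z)"
  shows "P f"
proof -
  have "P f" if "finite D" "D \<subseteq> S" "{s. f s \<noteq> 0} \<subseteq> D" for f D
    using that
  proof (induction D arbitrary: f rule: finite_induct)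
    case empty
    then have "f = (\<lambda>_. 0)" by auto
    then show ?case using assms by simp
  next
    case (insert x D)
    let ?g = "f(x := 0)"
    have "P ?g" by (rule insert.IH) (use insert in auto)
    moreover have "?g \<in> finsupp S"
      using insert by (auto simp: finsupp_def intro: finite_subset[of _ D])
    moreover have "x \<in> S" using insert by auto
    ultimately have "P (\<lambda>z. ?g z + f x * delta x z)"
      by (intro step)
    moreover have "(\<lambda>z. ?g z + f x * delta x z) = f"
      by (auto simp: delta_def)
    ultimately show ?case by simp
  qed
  from this[of "{s. f s \<noteq> 0}" f] assms(1) show ?thesis by (auto simp: finsupp_def)
qed

text \<open>The sum runs over the support and has the shape of the one in
  \<open>tensor_lift\<close>, so that a tensor lift is this extension evaluated at a
  representative.\<close>

definition lin_ext :: "('k::field, 'c) module \<Rightarrow> ('s \<Rightarrow> 'c) \<Rightarrow> ('s \<Rightarrow> 'k) \<Rightarrow> 'c" where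
  "lin_ext C \<beta> f = (\<Oplus>\<^bsub>C\<^esub>p\<in>{p. f p \<noteq> 0}. f p \<odot>\<^bsub>C\<^esub> \<beta> p)"

context assoc_algebra
begin

text \<open>Different functions have different supports; their sums can be added only after
  extension to a common finite set, where the extra terms vanish.\<close>

lemma lin_ext_superset:
  assumes "\<beta> \<in> D \<rightarrow> carrier A" "finite D" "{p. f p \<noteq> 0} \<subseteq> D"
  shows "lin_ext A \<beta> f = (\<Oplus>p\<in>D. f p \<odot> \<beta> p)"
  unfolding lin_ext_def
  by (rule add.finprod_mono_neutral_cong_left) (use assms in \<open>auto simp: Pi_def\<close>)

lemma lin_ext_closed:
  assumes "\<beta> \<in> S \<rightarrow> carrier A" "f \<in> finsupp S"
  shows "lin_ext A \<beta> f \<in> carrier A"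
  unfolding lin_ext_def by (rule finsum_closed) (use assms in \<open>auto simp: Pi_def finsupp_def\<close>)

lemma lin_ext_delta: "\<beta> s \<in> carrier A \<Longrightarrow> lin_ext A \<beta> (delta s) = \<beta> s"
  using lin_ext_superset[of \<beta> "{s}" "delta s"] by (auto simp: delta_def)

lemma lin_ext_add:
  assumes "\<beta> \<in> S \<rightarrow> carrier A" "f \<in> finsupp S" "g \<in> finsupp S"
  shows "lin_ext A \<beta> (\<lambda>z. f z + g z) = lin_ext A \<beta> f \<oplus> lin_ext A \<beta> g"
proof -
  let ?D = "{p. f p \<noteq> 0} \<union> {p. g p \<noteq> 0}"
  have D: "\<beta> \<in> ?D \<rightarrow> carrier A" "finite ?D"
    using assms by (auto simp: Pi_def finsupp_def)
  have L: "lin_ext A \<beta> h = (\<Oplus>p\<in>?D. h p \<odot> \<beta> p)" if "{p. h p \<noteq> 0} \<subseteq> ?D" for h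
    by (rule lin_ext_superset[OF D that])
  have "lin_ext A \<beta> (\<lambda>z. f z + g z) = (\<Oplus>p\<in>?D. (f p + g p) \<odot> \<beta> p)"
    by (rule L) auto
  also have "\<dots> = (\<Oplus>p\<in>?D. f p \<odot> \<beta> p \<oplus> g p \<odot> \<beta> p)"
    by (rule finsum_cong') (use D in \<open>auto simp: Pi_def sm_add_left\<close>)
  also have "\<dots> = (\<Oplus>p\<in>?D. f p \<odot> \<beta> p) \<oplus> (\<Oplus>p\<in>?D. g p \<odot> \<beta> p)"
    by (rule finsum_addf) (use D in \<open>auto simp: Pi_def\<close>)
  also have "\<dots> = lin_ext A \<beta> f \<oplus> lin_ext A \<beta> g"
    by (simp add: L)
  finally show ?thesis .
qed

lemma lin_ext_scale:
  assumes "\<beta> \<in> S \<rightarrow> carrier A" "f \<in> finsupp S"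
  shows "lin_ext A \<beta> (\<lambda>z. c * f z) = c \<odot> lin_ext A \<beta> f"
proof -
  let ?D = "{p. f p \<noteq> 0}"
  have D: "\<beta> \<in> ?D \<rightarrow> carrier A" "finite ?D"
    using assms by (auto simp: Pi_def finsupp_def)
  have L: "lin_ext A \<beta> h = (\<Oplus>p\<in>?D. h p \<odot> \<beta> p)" if "{p. h p \<noteq> 0} \<subseteq> ?D" for h
    by (rule lin_ext_superset[OF D that])
  have "lin_ext A \<beta> (\<lambda>z. c * f z) = (\<Oplus>p\<in>?D. (c * f p) \<odot> \<beta> p)"
    by (rule L) auto
  also have "\<dots> = (\<Oplus>p\<in>?D. c \<odot> (f p \<odot> \<beta> p))"
    by (rule finsum_cong') (use D in \<open>auto simp: Pi_def sm_sm\<close>)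
  also have "\<dots> = c \<odot> lin_ext A \<beta> f"
    using D by (subst finsum_sm[symmetric]) (auto simp: Pi_def L)
  finally show ?thesis .
qed

end

text \<open>Monoid algebras and path algebras have this vector space in common and differ only in
  the product, which is therefore left open.\<close>

locale free_module =
  fixes A :: "('k::field, 's \<Rightarrow> 'k) module" (structure) and S :: "'s set"
  assumes carrier_eq: "carrier A = finsupp S"
    and zero_eq: "\<zero> = (\<lambda>_. 0)"
    and add_eq: "f \<oplus> g = (\<lambda>z. f z + g z)"
    and smult_eq: "c \<odot> f = (\<lambda>z. c * f z)"
begin

lemma abelian_group_free: "abelian_group A"
proof (rule abelian_groupI)
  show "\<exists>y\<in>carrier A. y \<oplus> x = \<zero>" if "x \<in> carrier A" for x
    by (rule bexI[of _ "\<lambda>z. - 1 * x z"])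
      (use that in \<open>auto simp: carrier_eq zero_eq add_eq intro: finsupp_scale[of _ _ "-1", simplified]\<close>)
qed (auto simp: carrier_eq zero_eq add_eq finsupp_add finsupp_zero algebra_simps)

lemma carrier_induct [consumes 1, case_names zero delta add smult]:
  assumes "f \<in> carrier A" "P \<zero>"
    and delta: "\<And>s. s \<in> S \<Longrightarrow> P (delta s)"
    and add: "\<And>f g. f \<in> carrier A \<Longrightarrow> g \<in> carrier A \<Longrightarrow> P f \<Longrightarrow> P g \<Longrightarrow> P (f \<oplus> g)"
    and smult: "\<And>f c. f \<in> carrier A \<Longrightarrow> P f \<Longrightarrow> P (c \<odot> f)"
  shows "P f"
  using assms(1) unfolding carrier_eq
proof (induction f rule: finsupp_induct)
  case zero
  then show ?case using assms(2) by (simp add: zero_eq)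
next
  case (add f c s)
  then have "P (f \<oplus> c \<odot> delta s)"
    by (intro assms(4) smult delta) (auto simp: carrier_eq smult_eq intro!: finsupp_scale finsupp_delta)
  then show ?case by (simp add: add_eq smult_eq)
qed

text \<open>By trilinearity, associativity need only be known on basis elements; it is extended to
  one argument at a time, and closure and the unit laws spread in the same way.\<close>

lemma assoc_algebraI_free:
  assumes mult_closed: "\<And>s t. s \<in> S \<Longrightarrow> t \<in> S \<Longrightarrow> delta s \<otimes> delta t \<in> carrier A"
    and one: "\<one> \<in> carrier A"
    and assoc: "\<And>s t u. s \<in> S \<Longrightarrow> t \<in> S \<Longrightarrow> u \<in> S \<Longrightarrow> (delta s \<otimes> delta t) \<otimes> delta u = delta s \<otimes> (delta t \<otimes> delta u)"
    and l_one: "\<And>s. s \<in> S \<Longrightarrow> \<one> \<otimes> delta s = delta s"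
    and r_one: "\<And>s. s \<in> S \<Longrightarrow> delta s \<otimes> \<one> = delta s"
    and l_distr: "\<And>f g h. f \<in> carrier A \<Longrightarrow> g \<in> carrier A \<Longrightarrow> h \<in> carrier A \<Longrightarrow> (f \<oplus> g) \<otimes> h = f \<otimes> h \<oplus> g \<otimes> h"
    and r_distr: "\<And>f g h. f \<in> carrier A \<Longrightarrow> g \<in> carrier A \<Longrightarrow> h \<in> carrier A \<Longrightarrow> h \<otimes> (f \<oplus> g) = h \<otimes> f \<oplus> h \<otimes> g"
    and l_scale: "\<And>c f h. f \<in> carrier A \<Longrightarrow> h \<in> carrier A \<Longrightarrow> (c \<odot> f) \<otimes> h = c \<odot> (f \<otimes> h)"
    and r_scale: "\<And>c f h. f \<in> carrier A \<Longrightarrow> h \<in> carrier A \<Longrightarrow> h \<otimes> (c \<odot> f) = c \<odot> (h \<otimes> f)"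
  shows "assoc_algebra A"
proof -
  interpret abelian_group A by (rule abelian_group_free)
  have sc [simp]: "c \<odot> f \<in> carrier A" if "f \<in> carrier A" for f c
    using that by (auto simp: carrier_eq smult_eq finsupp_scale)
  have d [simp]: "delta s \<in> carrier A" if "s \<in> S" for s
    using that by (auto simp: carrier_eq finsupp_delta)
  have sc0 [simp]: "c \<odot> \<zero> = \<zero>" for c by (simp add: smult_eq zero_eq)
  have z': "0 \<odot> f = \<zero>" for f by (simp add: smult_eq zero_eq)
  have sc_add: "c \<odot> (f \<oplus> g) = c \<odot> f \<oplus> c \<odot> g" for c f g
    by (simp add: smult_eq add_eq algebra_simps)
  \<comment> \<open>The ring laws are not yet available, so multiplication by zero is derived from
    scaling by 0.\<close>
  have l_null [simp]: "\<zero> \<otimes> f = \<zero>" and r_null [simp]: "f \<otimes> \<zero> = \<zero>" if "f \<in> carrier A" for f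
    using l_scale[of \<zero> f 0] r_scale[of \<zero> f 0] that by (simp_all add: z')
  have cl1: "f \<otimes> delta t \<in> carrier A" if "f \<in> carrier A" "t \<in> S" for f t
    using that(1) by (induction f rule: carrier_induct) (use that in \<open>auto simp: mult_closed l_distr l_scale\<close>)
  have cl [simp]: "f \<otimes> g \<in> carrier A" if "f \<in> carrier A" "g \<in> carrier A" for f g
    using that(2) by (induction g rule: carrier_induct) (use that cl1 in \<open>auto simp: r_distr r_scale\<close>)
  have as1: "(f \<otimes> delta t) \<otimes> delta u = f \<otimes> (delta t \<otimes> delta u)"
    if "f \<in> carrier A" "t \<in> S" "u \<in> S" for f t u
    using that(1) by (induction f rule: carrier_induct) (use that in \<open>auto simp: assoc l_distr l_scale\<close>)
  have as2: "(f \<otimes> g) \<otimes> delta u = f \<otimes> (g \<otimes> delta u)"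
    if "f \<in> carrier A" "g \<in> carrier A" "u \<in> S" for f g u
    using that(2) by (induction g rule: carrier_induct)
      (use that as1 in \<open>auto simp: l_distr l_scale r_distr r_scale\<close>)
  have as3: "(f \<otimes> g) \<otimes> h = f \<otimes> (g \<otimes> h)"
    if "f \<in> carrier A" "g \<in> carrier A" "h \<in> carrier A" for f g h
    using that(3) by (induction h rule: carrier_induct) (use that as2 in \<open>auto simp: r_distr r_scale\<close>)
  have "\<one> \<otimes> f = f" "f \<otimes> \<one> = f" if "f \<in> carrier A" for f
    using that by (induction f rule: carrier_induct)
      (use one l_one r_one in \<open>auto simp: l_distr l_scale r_distr r_scale\<close>)
  then have "ring A"
    by (intro ringI monoidI abelian_group_axioms one) (auto simp: as3 l_distr r_distr)
  then show ?thesis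
  proof (rule assoc_algebraI)
    fix c d and f g assume "f \<in> carrier A"
    show "(c + d) \<odot> f = c \<odot> f \<oplus> d \<odot> f" "(c * d) \<odot> f = c \<odot> (d \<odot> f)" "1 \<odot> f = f"
      by (simp_all add: smult_eq add_eq algebra_simps)
  qed (simp_all add: sc_add l_scale r_scale)
qed

end


lemma free_module_lin_ext:
  assumes "free_module M S" "assoc_algebra M" "assoc_algebra C" "\<beta> \<in> S \<rightarrow> carrier C"
  shows "linear_map M C (lin_ext C \<beta>)"
proof -
  interpret free_module M S by fact
  interpret C: assoc_algebra C by fact
  show ?thesis
    by (rule linear_mapI)
      (use assms in \<open>auto simp: carrier_eq add_eq smult_eq C.lin_ext_add[of _ S] C.lin_ext_scale[of _ S]
        intro: C.lin_ext_closed[of _ S]\<close>)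
qed

lemma free_module_linear_eqI:
  assumes "free_module M S" "linear_map M C f" "linear_map M C g"
    and "\<And>s. s \<in> S \<Longrightarrow> f (delta s) = g (delta s)" and "x \<in> carrier M"
  shows "f x = g x"
proof -
  interpret free_module M S by fact
  interpret f: linear_map M C f by fact
  interpret g: linear_map M C g by fact
  show ?thesis using assms(5)
    by (induction x rule: carrier_induct) (auto simp: f.add g.add f.scale g.scale assms(4))
qed


section \<open>Monoid algebras\<close>

lemma free_module_monoid_algebra: "free_module (monoid_algebra M) (carrier M)"
  by (simp add: free_module_def monoid_algebra_def)

text \<open>The index set of the defining sum depends on the factors; a fixed rectangle containing
  the supports makes the product visibly bilinear.\<close>

lemma monoid_algebra_mult:
  assumes "finite D" "{x. f x \<noteq> 0} \<subseteq> D" "finite Y" "{y. g y \<noteq> 0} \<subseteq> Y"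
  shows "(f \<otimes>\<^bsub>monoid_algebra M\<^esub> g) z = (\<Sum>x\<in>D. \<Sum>y\<in>Y. if x \<otimes>\<^bsub>M\<^esub> y = z then f x * g y else 0)"
proof -
  have "(f \<otimes>\<^bsub>monoid_algebra M\<^esub> g) z =
      (\<Sum>(x, y) \<in> {(x, y). f x \<noteq> 0 \<and> g y \<noteq> 0 \<and> x \<otimes>\<^bsub>M\<^esub> y = z}. f x * g y)"
    by (simp add: monoid_algebra_def)
  also have "\<dots> = (\<Sum>(x, y) \<in> D \<times> Y. if x \<otimes>\<^bsub>M\<^esub> y = z then f x * g y else 0)"
    by (rule sum.mono_neutral_cong_left) (use assms in \<open>auto split: if_splits\<close>)
  also have "\<dots> = (\<Sum>x\<in>D. \<Sum>y\<in>Y. if x \<otimes>\<^bsub>M\<^esub> y = z then f x * g y else 0)"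
    by (simp add: sum.cartesian_product)
  finally show ?thesis .
qed

lemma monoid_algebra_delta_mult [simp]:
  "delta x \<otimes>\<^bsub>monoid_algebra M\<^esub> delta y = delta (x \<otimes>\<^bsub>M\<^esub> y)"
  by (rule ext, subst monoid_algebra_mult[of "{x}" _ "{y}"]) (auto simp: delta_def)

lemma monoid_algebra_one: "\<one>\<^bsub>monoid_algebra M\<^esub> = delta \<one>\<^bsub>M\<^esub>"
  by (simp add: monoid_algebra_def)

lemma assoc_algebra_monoid_algebra:
  assumes "Group.monoid M"
  shows "assoc_algebra (monoid_algebra M :: ('k::field, 's \<Rightarrow> 'k) module)"
proof -
  interpret M: Group.monoid M by fact
  let ?A = "monoid_algebra M :: ('k, 's \<Rightarrow> 'k) module"
  interpret free_module ?A "carrier M" by (rule free_module_monoid_algebra)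
  show ?thesis
  proof (rule assoc_algebraI_free)
    fix f g h :: "'s \<Rightarrow> 'k" and c
    assume "f \<in> carrier ?A" "g \<in> carrier ?A" "h \<in> carrier ?A"
    define D where "D = {s. f s \<noteq> 0} \<union> {s. g s \<noteq> 0} \<union> {s. h s \<noteq> 0}"
    have "finite D"
      using \<open>f \<in> _\<close> \<open>g \<in> _\<close> \<open>h \<in> _\<close> by (auto simp: D_def carrier_eq finsupp_def)
    note m = monoid_algebra_mult[OF this _ this, where M = M]
    have *: "{s. f s \<noteq> 0} \<subseteq> D" "{s. g s \<noteq> 0} \<subseteq> D" "{s. h s \<noteq> 0} \<subseteq> D"
        "{s. f s + g s \<noteq> 0} \<subseteq> D" "{s. c * f s \<noteq> 0} \<subseteq> D"
      by (auto simp: D_def)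
    show "(f \<oplus>\<^bsub>?A\<^esub> g) \<otimes>\<^bsub>?A\<^esub> h = f \<otimes>\<^bsub>?A\<^esub> h \<oplus>\<^bsub>?A\<^esub> g \<otimes>\<^bsub>?A\<^esub> h"
      unfolding add_eq by (rule ext) (auto simp: m * algebra_simps sum.distrib[symmetric] intro!: sum.cong)
    show "h \<otimes>\<^bsub>?A\<^esub> (f \<oplus>\<^bsub>?A\<^esub> g) = h \<otimes>\<^bsub>?A\<^esub> f \<oplus>\<^bsub>?A\<^esub> h \<otimes>\<^bsub>?A\<^esub> g"
      unfolding add_eq by (rule ext) (auto simp: m * algebra_simps sum.distrib[symmetric] intro!: sum.cong)
  next
    fix f h :: "'s \<Rightarrow> 'k" and c
    assume "f \<in> carrier ?A" "h \<in> carrier ?A"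
    define D where "D = {s. f s \<noteq> 0} \<union> {s. h s \<noteq> 0}"
    have "finite D"
      using \<open>f \<in> _\<close> \<open>h \<in> _\<close> by (auto simp: D_def carrier_eq finsupp_def)
    note m = monoid_algebra_mult[OF this _ this, where M = M]
    have sub: "{s. f s \<noteq> 0} \<subseteq> D" "{s. h s \<noteq> 0} \<subseteq> D" "{s. c * f s \<noteq> 0} \<subseteq> D"
      by (auto simp: D_def)
    show "(c \<odot>\<^bsub>?A\<^esub> f) \<otimes>\<^bsub>?A\<^esub> h = c \<odot>\<^bsub>?A\<^esub> (f \<otimes>\<^bsub>?A\<^esub> h)"
      unfolding smult_eq by (rule ext, unfold m[OF sub(3,2)] m[OF sub(1,2)])
        (auto simp: sum_distrib_left intro!: sum.cong)
    show "h \<otimes>\<^bsub>?A\<^esub> (c \<odot>\<^bsub>?A\<^esub> f) = c \<odot>\<^bsub>?A\<^esub> (h \<otimes>\<^bsub>?A\<^esub> f)"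
      unfolding smult_eq by (rule ext, unfold m[OF sub(2,3)] m[OF sub(2,1)])
        (auto simp: sum_distrib_left intro!: sum.cong)
  qed (auto simp: carrier_eq monoid_algebra_one finsupp_delta M.m_assoc)
qed


section \<open>Quotient algebras\<close>

locale algebra_ideal = assoc_algebra A + ideal I A
  for A :: "('k::field, 'a) module" (structure) and I
begin

abbreviation "AI \<equiv> quot_algebra A I"

lemma quot_carrier: "carrier AI = (\<lambda>x. I +> x) ` carrier A"
  by (auto simp: quot_algebra_def ring.defs module.defs FactRing_def A_RCOSETS_def' a_r_coset_def)

lemma quot_closed [simp]: "x \<in> carrier A \<Longrightarrow> I +> x \<in> carrier AI"
  by (auto simp: quot_carrier)

lemma quot_add: "x \<in> carrier A \<Longrightarrow> y \<in> carrier A \<Longrightarrow> (I +> x) \<oplus>\<^bsub>AI\<^esub> (I +> y) = I +> (x \<oplus> y)"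
  by (simp add: quot_algebra_def ring.defs module.defs FactRing_def a_rcos_sum)

lemma quot_mult: "x \<in> carrier A \<Longrightarrow> y \<in> carrier A \<Longrightarrow> (I +> x) \<otimes>\<^bsub>AI\<^esub> (I +> y) = I +> (x \<otimes> y)"
  by (simp add: quot_algebra_def ring.defs module.defs FactRing_def rcoset_mult_add)

lemma quot_one: "\<one>\<^bsub>AI\<^esub> = I +> \<one>"
  by (simp add: quot_algebra_def ring.defs module.defs FactRing_def)

lemma quot_zero: "\<zero>\<^bsub>AI\<^esub> = I"
  by (simp add: quot_algebra_def ring.defs module.defs FactRing_def)

lemma quot_eq_iff: "x \<in> carrier A \<Longrightarrow> y \<in> carrier A \<Longrightarrow> I +> x = I +> y \<longleftrightarrow> x \<ominus> y \<in> I"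
  using quotient_eq_iff_same_a_r_cos[OF is_ideal, of x y] by simp

lemma quot_rep:
  assumes "x \<in> carrier A" "y \<in> I +> x"
  shows "y \<in> carrier A" "I +> y = I +> x"
proof -
  from assms show y: "y \<in> carrier A"
    by (meson a_elemrcos_carrier)
  show "I +> y = I +> x"
    using a_repr_independence[OF assms(2,1)] a_subgroup by simp
qed

text \<open>Scaling by \<open>c\<close> is multiplication by \<open>c\<close> times the unit, so an
  ideal of the ring is automatically a subspace.\<close>

lemma ideal_smult: "x \<in> I \<Longrightarrow> c \<odot> x \<in> I"
  using I_l_closed[of x "c \<odot> \<one>"] Icarr[of x] by (simp add: smult_mult_left)

text \<open>The scalar action is defined as a union over all representatives of a coset; the union
  collapses because all of them yield the same coset.\<close>

lemma quot_smult:
  assumes "x \<in> carrier A"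
  shows "c \<odot>\<^bsub>AI\<^esub> (I +> x) = I +> (c \<odot> x)"
proof -
  have "I +> (c \<odot> y) = I +> (c \<odot> x)" if "y \<in> I +> x" for y
  proof -
    note y = quot_rep[OF assms that]
    have "y \<ominus> x \<in> I" using y assms quot_eq_iff by blast
    then have "c \<odot> (y \<oplus> (- 1) \<odot> x) \<in> I"
      using ideal_smult[of "y \<ominus> x" c] y assms by (simp add: sm_minus_one a_minus_def)
    then have "c \<odot> y \<oplus> (- 1) \<odot> (c \<odot> x) \<in> I"
      using y assms by (simp add: sm_add_right sm_sm)
    then show ?thesis
      using y assms by (simp add: quot_eq_iff a_minus_def sm_minus_one)
  qed
  moreover have "x \<in> I +> x" using assms by (rule a_rcos_self)
  ultimately have "(\<Union>y\<in>I +> x. I +> (c \<odot> y)) = I +> (c \<odot> x)" by blast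
  then show ?thesis
    by (simp add: quot_algebra_def ring.defs module.defs)
qed

lemma assoc_algebra_quot: "assoc_algebra AI"
proof (rule assoc_algebraI)
  have "ring (A Quot I)" by (rule quotient_is_ring)
  then interpret Q: ring "A Quot I" .
  have *: "carrier AI = carrier (A Quot I)" "monoid.mult AI = monoid.mult (A Quot I)"
    "add AI = add (A Quot I)" "\<one>\<^bsub>AI\<^esub> = \<one>\<^bsub>A Quot I\<^esub>" "\<zero>\<^bsub>AI\<^esub> = \<zero>\<^bsub>A Quot I\<^esub>"
    by (simp_all add: quot_algebra_def ring.defs module.defs)
  show "ring AI"
  proof (intro ringI abelian_groupI monoidI)
    show "\<exists>y\<in>carrier AI. y \<oplus>\<^bsub>AI\<^esub> x = \<zero>\<^bsub>AI\<^esub>" if "x \<in> carrier AI" for x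
      using that unfolding * by (metis Q.a_inv_closed Q.l_neg)
  qed (auto simp: * Q.a_ac Q.m_assoc Q.l_distr Q.r_distr)
qed (auto simp: quot_carrier quot_add quot_smult quot_mult sm_add_left sm_add_right sm_sm
       smult_mult_left smult_mult_right)

lemma linear_map_quot: "linear_map A AI (\<lambda>x. I +> x)"
  by (rule linear_mapI) (auto simp: alg assoc_algebra_quot quot_add quot_smult)

text \<open>The choice of the representative matters for maps that do not vanish on \<open>I\<close> only.\<close>

definition induced :: "('a \<Rightarrow> 'b) \<Rightarrow> 'a set \<Rightarrow> 'b" where
  "induced f T = f (SOME x. x \<in> T)"

lemma induced_coset:
  assumes "linear_map A B f" "\<And>x. x \<in> I \<Longrightarrow> f x = \<zero>\<^bsub>B\<^esub>" "x \<in> carrier A"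
  shows "induced f (I +> x) = f x"
proof -
  interpret f: linear_map A B f by fact
  have "(SOME y. y \<in> I +> x) \<in> I +> x"
    using a_rcos_self[OF assms(3)] by (rule someI)
  then obtain y where y: "y \<in> I +> x" "induced f (I +> x) = f y"
    by (auto simp: induced_def)
  note y' = quot_rep[OF assms(3) y(1)]
  have "y \<ominus> x \<in> I" using y' assms quot_eq_iff by blast
  then have "f (y \<ominus> x) = \<zero>\<^bsub>B\<^esub>" by (rule assms)
  moreover have "y = (y \<ominus> x) \<oplus> x"
    using y' assms by (simp add: a_minus_def a_assoc l_neg)
  ultimately have "f y = f x"
    using y' assms(3) f.add[of "y \<ominus> x" x] by simp
  then show ?thesis by (simp add: y)
qed

lemma linear_map_induced:
  assumes "linear_map A B f" "\<And>x. x \<in> I \<Longrightarrow> f x = \<zero>\<^bsub>B\<^esub>"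
  shows "linear_map AI B (induced f)"
proof -
  interpret f: linear_map A B f by fact
  show ?thesis
    by (rule linear_mapI)
      (auto simp: assoc_algebra_quot f.B.alg quot_carrier quot_add quot_smult
        induced_coset[OF assms] f.add f.scale)
qed

end


section \<open>Tensor products\<close>

definition bilinear_map ::
    "('k::field, 'a) module \<Rightarrow> ('k, 'b) module \<Rightarrow> ('k, 'c) module \<Rightarrow> ('a \<Rightarrow> 'b \<Rightarrow> 'c) \<Rightarrow> bool" where
  "bilinear_map A B C \<beta> \<longleftrightarrow> (\<forall>a\<in>carrier A. linear_map B C (\<beta> a)) \<and> (\<forall>b\<in>carrier B. linear_map A C (\<lambda>a. \<beta> a b))"

lemma bilinear_mapI:
  assumes "\<And>a. a \<in> carrier A \<Longrightarrow> linear_map B C (\<beta> a)" "\<And>b. b \<in> carrier B \<Longrightarrow> linear_map A C (\<lambda>a. \<beta> a b)"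
  shows "bilinear_map A B C \<beta>"
  using assms by (auto simp: bilinear_map_def)

lemma bilinear_map_left: "bilinear_map A B C \<beta> \<Longrightarrow> b \<in> carrier B \<Longrightarrow> linear_map A C (\<lambda>a. \<beta> a b)"
  and bilinear_map_right: "bilinear_map A B C \<beta> \<Longrightarrow> a \<in> carrier A \<Longrightarrow> linear_map B C (\<beta> a)"
  by (auto simp: bilinear_map_def)

lemma bilinear_map_comp:
  assumes "bilinear_map A' B' C \<beta>" "linear_map A A' f" "linear_map B B' g"
  shows "bilinear_map A B C (\<lambda>a b. \<beta> (f a) (g b))"
  using assms linear_map.closed[OF assms(2)] linear_map.closed[OF assms(3)]
  by (auto simp: bilinear_map_def intro: linear_map_comp[OF assms(2)] linear_map_comp[OF assms(3)])

lemma bilinear_map_scalar: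
  assumes "linear_map A field_algebra f" "assoc_algebra B"
  shows "bilinear_map A B B (\<lambda>a b. f a \<odot>\<^bsub>B\<^esub> b)" "bilinear_map B A B (\<lambda>b a. f a \<odot>\<^bsub>B\<^esub> b)"
proof -
  interpret B: assoc_algebra B by fact
  have l: "linear_map B B (\<lambda>b. f a \<odot>\<^bsub>B\<^esub> b)" for a
    by (rule linear_map_scale[OF B.linear_map_id])
  have r: "linear_map A B (\<lambda>a. f a \<odot>\<^bsub>B\<^esub> b)" if "b \<in> carrier B" for b
    by (rule linear_map_comp[OF assms(1) B.linear_map_scalar[OF that]])
  show "bilinear_map A B B (\<lambda>a b. f a \<odot>\<^bsub>B\<^esub> b)" "bilinear_map B A B (\<lambda>b a. f a \<odot>\<^bsub>B\<^esub> b)"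
    by (rule bilinear_mapI; rule l r; assumption)+
qed

lemma (in assoc_algebra) bilinear_map_mult: "bilinear_map A A A (\<otimes>)"
  by (rule bilinear_mapI) (simp_all add: linear_map_mult_left linear_map_mult_right)

locale tensor = A: assoc_algebra A + B: assoc_algebra B
  for A :: "('k::field, 'a) module" and B :: "('k, 'b) module"
begin

abbreviation "MA \<equiv> monoid_algebra (A \<times>\<times> B) :: ('k, 'a \<times> 'b \<Rightarrow> 'k) module"

sublocale M: assoc_algebra MA
  by (rule assoc_algebra_monoid_algebra) (simp add: A.monoid_axioms B.monoid_axioms DirProd_monoid)

sublocale F: free_module MA "carrier A \<times> carrier B"
  using free_module_monoid_algebra[of "A \<times>\<times> B"] by simp

lemma delta_closed [simp]: "a \<in> carrier A \<Longrightarrow> b \<in> carrier B \<Longrightarrow> delta (a, b) \<in> carrier MA"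
  by (simp add: F.carrier_eq finsupp_delta)

lemma tensor_rels_subset: "tensor_rels A B \<subseteq> carrier MA"
proof -
  have eq: "(\<lambda>z. f z - g z - h z) = f \<oplus>\<^bsub>MA\<^esub> ((- 1) \<odot>\<^bsub>MA\<^esub> g \<oplus>\<^bsub>MA\<^esub> (- 1) \<odot>\<^bsub>MA\<^esub> h)" for f g h :: "'a \<times> 'b \<Rightarrow> 'k"
    by (auto simp: F.add_eq F.smult_eq)
  have eq': "(\<lambda>z. f z - c * g z) = f \<oplus>\<^bsub>MA\<^esub> (- c) \<odot>\<^bsub>MA\<^esub> g" for c and f g :: "'a \<times> 'b \<Rightarrow> 'k"
    by (auto simp: F.add_eq F.smult_eq)
  show ?thesis
    unfolding tensor_rels_def eq eq'
    by (intro Un_least; clarify; intro M.a_closed M.sm_closed delta_closed A.a_closed B.a_closed A.sm_closed B.sm_closed)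
qed

sublocale T: algebra_ideal MA "tensor_ideal A B"
  unfolding algebra_ideal_def tensor_ideal_def
  by (intro conjI M.alg M.genideal_ideal tensor_rels_subset)

abbreviation "TC f \<equiv> tensor_ideal A B +>\<^bsub>MA\<^esub> f"

lemma tensor_algebra_eq: "tensor_algebra A B = T.AI"
  by (simp add: tensor_algebra_def)

lemma assoc_algebra_tensor: "assoc_algebra (tensor_algebra A B)"
  unfolding tensor_algebra_eq by (rule T.assoc_algebra_quot)

lemma pure_closed: "a \<in> carrier A \<Longrightarrow> b \<in> carrier B \<Longrightarrow> pure_tensor A B a b \<in> carrier (tensor_algebra A B)"
  by (simp add: tensor_algebra_eq pure_tensor_def)

lemma pure_mult:
  assumes "a \<in> carrier A" "b \<in> carrier B" "a' \<in> carrier A" "b' \<in> carrier B"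
  shows "pure_tensor A B a b \<otimes>\<^bsub>tensor_algebra A B\<^esub> pure_tensor A B a' b' =
    pure_tensor A B (a \<otimes>\<^bsub>A\<^esub> a') (b \<otimes>\<^bsub>B\<^esub> b')"
  using assms by (simp add: tensor_algebra_eq pure_tensor_def T.quot_mult)

lemma pure_one: "\<one>\<^bsub>tensor_algebra A B\<^esub> = pure_tensor A B \<one>\<^bsub>A\<^esub> \<one>\<^bsub>B\<^esub>"
  by (simp add: tensor_algebra_eq pure_tensor_def T.quot_one monoid_algebra_one)

lemma rel_in_ideal: "r \<in> tensor_rels A B \<Longrightarrow> r \<in> tensor_ideal A B"
  unfolding tensor_ideal_def using M.genideal_self[OF tensor_rels_subset] by blast

lemma coset_eqI:
  assumes "f \<in> carrier MA" "g \<in> carrier MA" "(\<lambda>z. f z - g z) \<in> tensor_ideal A B"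
  shows "TC f = TC g"
proof -
  have "f \<ominus>\<^bsub>MA\<^esub> g = (\<lambda>z. f z - g z)"
    using assms(2) by (simp add: a_minus_def M.sm_minus_one[symmetric] F.add_eq F.smult_eq)
  then show ?thesis using assms by (simp add: T.quot_eq_iff)
qed

lemma coset_rel_add:
  assumes "p \<in> carrier A \<times> carrier B" "q \<in> carrier A \<times> carrier B" "r \<in> carrier A \<times> carrier B"
    and "(\<lambda>z. delta p z - delta q z - delta r z) \<in> tensor_rels A B"
  shows "TC (delta p) =
    (TC (delta q)) \<oplus>\<^bsub>tensor_algebra A B\<^esub> (TC (delta r))"
proof -
  have d: "delta x \<in> carrier MA" if "x \<in> carrier A \<times> carrier B" for x
    using that by (simp add: F.carrier_eq finsupp_delta)
  have "TC (delta p) = TC (delta q \<oplus>\<^bsub>MA\<^esub> delta r)"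
    using rel_in_ideal[OF assms(4)]
    by (intro coset_eqI M.a_closed d assms) (simp add: F.add_eq diff_diff_eq)
  then show ?thesis
    by (simp add: tensor_algebra_eq T.quot_add d assms)
qed

lemma coset_rel_scale:
  assumes "p \<in> carrier A \<times> carrier B" "q \<in> carrier A \<times> carrier B"
    and "(\<lambda>z. delta p z - c * delta q z) \<in> tensor_rels A B"
  shows "TC (delta p) = c \<odot>\<^bsub>tensor_algebra A B\<^esub> (TC (delta q))"
proof -
  have d: "delta x \<in> carrier MA" if "x \<in> carrier A \<times> carrier B" for x
    using that by (simp add: F.carrier_eq finsupp_delta)
  have "TC (delta p) = TC (c \<odot>\<^bsub>MA\<^esub> delta q)"
    using rel_in_ideal[OF assms(3)]
    by (intro coset_eqI M.sm_closed d assms) (simp add: F.smult_eq)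
  then show ?thesis
    by (simp add: tensor_algebra_eq T.quot_smult d assms)
qed

lemma bilinear_pure: "bilinear_map A B (tensor_algebra A B) (pure_tensor A B)"
proof (rule bilinear_mapI)
  fix a assume a: "a \<in> carrier A"
  show "linear_map B (tensor_algebra A B) (pure_tensor A B a)"
  proof (rule linear_mapI)
    fix x y assume "x \<in> carrier B" "y \<in> carrier B"
    with a show "pure_tensor A B a (x \<oplus>\<^bsub>B\<^esub> y) = pure_tensor A B a x \<oplus>\<^bsub>tensor_algebra A B\<^esub> pure_tensor A B a y"
      unfolding pure_tensor_def by (intro coset_rel_add) (simp_all, unfold tensor_rels_def, blast)
  next
    fix c x assume "x \<in> carrier B"
    with a show "pure_tensor A B a (c \<odot>\<^bsub>B\<^esub> x) = c \<odot>\<^bsub>tensor_algebra A B\<^esub> pure_tensor A B a x"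
      unfolding pure_tensor_def by (intro coset_rel_scale) (simp_all, unfold tensor_rels_def, blast)
  qed (auto simp: B.alg assoc_algebra_tensor pure_closed a)
next
  fix b assume b: "b \<in> carrier B"
  show "linear_map A (tensor_algebra A B) (\<lambda>a. pure_tensor A B a b)"
  proof (rule linear_mapI)
    fix x y assume "x \<in> carrier A" "y \<in> carrier A"
    with b show "pure_tensor A B (x \<oplus>\<^bsub>A\<^esub> y) b = pure_tensor A B x b \<oplus>\<^bsub>tensor_algebra A B\<^esub> pure_tensor A B y b"
      unfolding pure_tensor_def by (intro coset_rel_add) (simp_all, unfold tensor_rels_def, blast)
  next
    fix c x assume "x \<in> carrier A"
    with b show "pure_tensor A B (c \<odot>\<^bsub>A\<^esub> x) b = c \<odot>\<^bsub>tensor_algebra A B\<^esub> pure_tensor A B x b"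
      unfolding pure_tensor_def by (intro coset_rel_scale) (simp_all, unfold tensor_rels_def, blast)
  qed (auto simp: A.alg assoc_algebra_tensor pure_closed b)
qed

text \<open>Pure tensors are the classes of the basis elements \<open>delta (a, b)\<close> of the
  free space, so they span the quotient.\<close>

lemma tensor_linear_eqI:
  assumes "linear_map (tensor_algebra A B) C f" "linear_map (tensor_algebra A B) C g"
    and "\<And>a b. a \<in> carrier A \<Longrightarrow> b \<in> carrier B \<Longrightarrow> f (pure_tensor A B a b) = g (pure_tensor A B a b)"
    and "t \<in> carrier (tensor_algebra A B)"
  shows "f t = g t"
proof -
  note q = T.linear_map_quot[folded tensor_algebra_eq]
  obtain x where x: "x \<in> carrier MA" "t = TC x"
    using assms(4) by (auto simp: tensor_algebra_eq T.quot_carrier)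
  have "f (TC x) = g (TC x)"
    by (rule free_module_linear_eqI[OF F.free_module_axioms linear_map_comp[OF q assms(1)]
          linear_map_comp[OF q assms(2)]]) (use assms(3) x in \<open>auto simp: pure_tensor_def\<close>)
  then show ?thesis by (simp add: x)
qed

text \<open>
  The elements annihilated by all bilinear maps into \<open>C\<close> form an ideal,
  since right and left multiplication by a pure tensor preserve bilinearity.
\<close>

lemma lin_ext_tensor_ideal:
  fixes C :: "('k, 'c) module"
  assumes "bilinear_map A B C \<beta>" "assoc_algebra C" "x \<in> tensor_ideal A B"
  shows "lin_ext C (\<lambda>p. \<beta> (fst p) (snd p)) x = \<zero>\<^bsub>C\<^esub>"
proof -
  interpret C: assoc_algebra C by fact
  define L where "L \<beta> = lin_ext C (\<lambda>p. \<beta> (fst p) (snd p))" for \<beta> :: "'a \<Rightarrow> 'b \<Rightarrow> 'c"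
  have L_lin: "linear_map MA C (L \<beta>)" if "bilinear_map A B C \<beta>" for \<beta>
    unfolding L_def
    by (rule free_module_lin_ext[OF F.free_module_axioms M.alg assms(2)])
      (use that linear_map.closed[OF bilinear_map_left[OF that]] in auto)
  have L_delta: "L \<beta> (delta (a, b)) = \<beta> a b"
    if "bilinear_map A B C \<beta>" "a \<in> carrier A" "b \<in> carrier B" for \<beta> a b
    using that linear_map.closed[OF bilinear_map_left[OF that(1)]] by (simp add: L_def C.lin_ext_delta)
  define N where "N = {\<phi> \<in> carrier MA. \<forall>\<beta>. bilinear_map A B C \<beta> \<longrightarrow> L \<beta> \<phi> = \<zero>\<^bsub>C\<^esub>}"
  have left_delta: "delta (a, b) \<otimes>\<^bsub>MA\<^esub> \<phi> \<in> N"
    and right_delta: "\<phi> \<otimes>\<^bsub>MA\<^esub> delta (a, b) \<in> N" if "\<phi> \<in> N" "a \<in> carrier A" "b \<in> carrier B" for \<phi> a b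
  proof -
    have \<phi>: "\<phi> \<in> carrier MA" and \<phi>0: "\<And>\<beta>. bilinear_map A B C \<beta> \<Longrightarrow> L \<beta> \<phi> = \<zero>\<^bsub>C\<^esub>"
      using that by (auto simp: N_def)
    have "L \<beta> (delta (a, b) \<otimes>\<^bsub>MA\<^esub> \<phi>) = \<zero>\<^bsub>C\<^esub>" if \<beta>: "bilinear_map A B C \<beta>" for \<beta>
    proof -
      have \<beta>': "bilinear_map A B C (\<lambda>a' b'. \<beta> (a \<otimes>\<^bsub>A\<^esub> a') (b \<otimes>\<^bsub>B\<^esub> b'))"
        by (rule bilinear_map_comp[OF \<beta> A.linear_map_mult_right B.linear_map_mult_right]) fact+
      have "L \<beta> (delta (a, b) \<otimes>\<^bsub>MA\<^esub> \<phi>) = L (\<lambda>a' b'. \<beta> (a \<otimes>\<^bsub>A\<^esub> a') (b \<otimes>\<^bsub>B\<^esub> b')) \<phi>"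
        by (rule free_module_linear_eqI[OF F.free_module_axioms
              linear_map_comp[OF M.linear_map_mult_right L_lin[OF \<beta>]] L_lin[OF \<beta>'] _ \<phi>])
          (use \<open>a \<in> _\<close> \<open>b \<in> _\<close> in \<open>auto simp: L_delta[OF \<beta>] L_delta[OF \<beta>']\<close>)
      then show ?thesis using \<phi>0[OF \<beta>'] by simp
    qed
    then show "delta (a, b) \<otimes>\<^bsub>MA\<^esub> \<phi> \<in> N"
      using that \<phi> by (auto simp: N_def)
    have "L \<beta> (\<phi> \<otimes>\<^bsub>MA\<^esub> delta (a, b)) = \<zero>\<^bsub>C\<^esub>" if \<beta>: "bilinear_map A B C \<beta>" for \<beta>
    proof -
      have \<beta>': "bilinear_map A B C (\<lambda>a' b'. \<beta> (a' \<otimes>\<^bsub>A\<^esub> a) (b' \<otimes>\<^bsub>B\<^esub> b))"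
        by (rule bilinear_map_comp[OF \<beta> A.linear_map_mult_left B.linear_map_mult_left]) fact+
      have "L \<beta> (\<phi> \<otimes>\<^bsub>MA\<^esub> delta (a, b)) = L (\<lambda>a' b'. \<beta> (a' \<otimes>\<^bsub>A\<^esub> a) (b' \<otimes>\<^bsub>B\<^esub> b)) \<phi>"
        by (rule free_module_linear_eqI[OF F.free_module_axioms
              linear_map_comp[OF M.linear_map_mult_left L_lin[OF \<beta>]] L_lin[OF \<beta>'] _ \<phi>])
          (use \<open>a \<in> _\<close> \<open>b \<in> _\<close> in \<open>auto simp: L_delta[OF \<beta>] L_delta[OF \<beta>']\<close>)
      then show ?thesis using \<phi>0[OF \<beta>'] by simp
    qed
    then show "\<phi> \<otimes>\<^bsub>MA\<^esub> delta (a, b) \<in> N"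
      using that \<phi> by (auto simp: N_def)
  qed
  have N_add: "\<phi> \<oplus>\<^bsub>MA\<^esub> \<psi> \<in> N" if "\<phi> \<in> N" "\<psi> \<in> N" for \<phi> \<psi>
    using that by (auto simp: N_def linear_map.add[OF L_lin])
  have N_scale: "c \<odot>\<^bsub>MA\<^esub> \<phi> \<in> N" if "\<phi> \<in> N" for \<phi> c
    using that by (auto simp: N_def linear_map.scale[OF L_lin])
  have N_zero: "\<zero>\<^bsub>MA\<^esub> \<in> N"
    by (auto simp: N_def linear_map.zero[OF L_lin])
  have Nc: "\<phi> \<in> carrier MA" if "\<phi> \<in> N" for \<phi> using that by (simp add: N_def)
  have "ideal N MA"
  proof (rule idealI)
    show "subgroup N (add_monoid MA)"
      using N_add N_zero N_scale[of _ "-1"] Nc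
      by (auto simp: subgroup_def M.sm_minus_one a_inv_def[symmetric])
    show "x \<otimes>\<^bsub>MA\<^esub> \<phi> \<in> N" if "\<phi> \<in> N" "x \<in> carrier MA" for x \<phi>
      using that(2) by (induction x rule: F.carrier_induct)
        (use that Nc left_delta N_add N_scale N_zero in \<open>auto simp: M.l_distr M.smult_mult_left\<close>)
    show "\<phi> \<otimes>\<^bsub>MA\<^esub> x \<in> N" if "\<phi> \<in> N" "x \<in> carrier MA" for x \<phi>
      using that(2) by (induction x rule: F.carrier_induct)
        (use that Nc right_delta N_add N_scale N_zero in \<open>auto simp: M.r_distr M.smult_mult_right\<close>)
  qed (rule M.ring_axioms)
  moreover have "tensor_rels A B \<subseteq> N"
  proof
    fix r assume r: "r \<in> tensor_rels A B"
    then have rc: "r \<in> carrier MA" using tensor_rels_subset by blast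
    have eq: "(\<lambda>z. f z - g z - h z) = f \<oplus>\<^bsub>MA\<^esub> ((- 1) \<odot>\<^bsub>MA\<^esub> g \<oplus>\<^bsub>MA\<^esub> (- 1) \<odot>\<^bsub>MA\<^esub> h)" for f g h :: "'a \<times> 'b \<Rightarrow> 'k"
      by (auto simp: F.add_eq F.smult_eq)
    have eq': "(\<lambda>z. f z - c * g z) = f \<oplus>\<^bsub>MA\<^esub> (- 1) \<odot>\<^bsub>MA\<^esub> (c \<odot>\<^bsub>MA\<^esub> g)" for c and f g :: "'a \<times> 'b \<Rightarrow> 'k"
      by (auto simp: F.add_eq F.smult_eq)
    have "L \<beta> r = \<zero>\<^bsub>C\<^esub>" if \<beta>: "bilinear_map A B C \<beta>" for \<beta>
    proof -
      note simps = linear_map.add[OF L_lin[OF \<beta>]] linear_map.scale[OF L_lin[OF \<beta>]] L_delta[OF \<beta>]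
        linear_map.add[OF bilinear_map_left[OF \<beta>]] linear_map.add[OF bilinear_map_right[OF \<beta>]]
        linear_map.scale[OF bilinear_map_left[OF \<beta>]] linear_map.scale[OF bilinear_map_right[OF \<beta>]]
        linear_map.closed[OF bilinear_map_right[OF \<beta>]] C.sm_minus_one C.a_ac C.r_neg C.r_neg1 C.r_neg2
      show ?thesis
        using r unfolding tensor_rels_def eq eq'
        by (elim UnE CollectE exE conjE) (simp_all add: simps)
    qed
    then show "r \<in> N" using rc by (simp add: N_def)
  qed
  ultimately have "tensor_ideal A B \<subseteq> N"
    unfolding tensor_ideal_def by (rule M.genideal_minimal)
  then show ?thesis
    using assms by (auto simp: N_def L_def)
qed

text \<open>The extension of \<open>\<beta>\<close> vanishes on the tensor ideal and thus takes a
  single value on a whole coset, which makes the description in \<open>tensor_lift\<close>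
  definite.\<close>

lemma tensor_lift_coset:
  assumes "bilinear_map A B C \<beta>" "assoc_algebra C" "x \<in> carrier MA"
  shows "tensor_lift C \<beta> (TC x) = lin_ext C (\<lambda>p. \<beta> (fst p) (snd p)) x"
proof -
  let ?L = "lin_ext C (\<lambda>p. \<beta> (fst p) (snd p))"
  have L: "linear_map MA C ?L"
    by (rule free_module_lin_ext[OF F.free_module_axioms M.alg assms(2)])
      (use linear_map.closed[OF bilinear_map_left[OF assms(1)]] in auto)
  have "?L y = ?L x" if "y \<in> TC x" for y
  proof -
    note ind = T.induced_coset[OF L lin_ext_tensor_ideal[OF assms(1,2)]]
    note y = T.quot_rep[OF assms(3) that]
    show ?thesis
      using ind[OF _ y(1)] ind[OF _ assms(3)] y(2) by simp
  qed
  moreover have "x \<in> TC x"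
    using assms(3) by (rule T.a_rcos_self)
  ultimately have "(THE y. \<exists>\<phi>\<in>TC x. y = ?L \<phi>) = ?L x"
    by (intro the_equality) blast+
  then show ?thesis
    by (simp add: tensor_lift_def lin_ext_def)
qed

lemma linear_tensor_lift:
  assumes "bilinear_map A B C \<beta>" "assoc_algebra C"
  shows "linear_map (tensor_algebra A B) C (tensor_lift C \<beta>)"
proof -
  let ?L = "lin_ext C (\<lambda>p. \<beta> (fst p) (snd p))"
  have L: "linear_map MA C ?L"
    by (rule free_module_lin_ext[OF F.free_module_axioms M.alg assms(2)])
      (use linear_map.closed[OF bilinear_map_left[OF assms(1)]] in auto)
  have "linear_map (tensor_algebra A B) C (T.induced ?L)"
    unfolding tensor_algebra_eq by (rule T.linear_map_induced[OF L lin_ext_tensor_ideal[OF assms]])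
  then show ?thesis
    by (rule linear_map_cong)
      (auto simp: tensor_algebra_eq T.quot_carrier tensor_lift_coset[OF assms]
        T.induced_coset[OF L lin_ext_tensor_ideal[OF assms]])
qed

lemma tensor_lift_pure:
  assumes "bilinear_map A B C \<beta>" "assoc_algebra C" "a \<in> carrier A" "b \<in> carrier B"
  shows "tensor_lift C \<beta> (pure_tensor A B a b) = \<beta> a b"
proof -
  interpret C: assoc_algebra C by fact
  show ?thesis
    using assms linear_map.closed[OF bilinear_map_left[OF assms(1)]]
    by (simp add: pure_tensor_def tensor_lift_coset C.lin_ext_delta)
qed

end


section \<open>Path algebras\<close>

lemma free_module_path_algebra: "free_module (path_algebra Q) (quiver_paths Q)"
  by (simp add: free_module_def path_algebra_def)

lemma path_algebra_mult:
  "(f \<otimes>\<^bsub>path_algebra Q\<^esub> g) (u, p) = (\<Sum>i\<le>length p.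
     f (pre_digraph.awlast Q u (take i p), drop i p) * g (u, take i p))"
  by (simp add: path_algebra_def)

lemma path_algebra_one:
  "\<one>\<^bsub>path_algebra Q\<^esub> = (\<lambda>(u, p). if u \<in> verts Q \<and> p = [] then 1 else 0)"
  by (simp add: path_algebra_def)

context fin_digraph
begin

abbreviation "PA \<equiv> path_algebra G :: ('k::field, 'a \<times> 'b list \<Rightarrow> 'k) module"

lemma quiver_paths_append:
  "(u, p @ q) \<in> quiver_paths G \<longleftrightarrow> (u, p) \<in> quiver_paths G \<and> (awlast u p, q) \<in> quiver_paths G"
  by (auto simp: quiver_paths_def)

lemma quiver_paths_split:
  assumes "(u, p) \<in> quiver_paths G"
  shows "(u, take i p) \<in> quiver_paths G" "(awlast u (take i p), drop i p) \<in> quiver_paths G"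
  using assms quiver_paths_append[of u "take i p" "drop i p"] by simp_all

lemma quiver_paths_Nil [simp]: "(u, []) \<in> quiver_paths G \<longleftrightarrow> u \<in> verts G"
  by (auto simp: quiver_paths_def awalk_Nil_iff)

lemma quiver_paths_Cons [simp]:
  "(u, \<alpha> # p) \<in> quiver_paths G \<longleftrightarrow> \<alpha> \<in> arcs G \<and> tail G \<alpha> = u \<and> (head G \<alpha>, p) \<in> quiver_paths G"
  by (auto simp: quiver_paths_def awalk_Cons_iff)

lemma quiver_paths_last: "(u, p) \<in> quiver_paths G \<Longrightarrow> awlast u p \<in> verts G"
  using quiver_paths_append[of u p "[]"] by simp

text \<open>Only the cut after \<open>length p\<close> arrows can have \<open>p\<close> as its
  initial part, so at most one summand of the product survives.\<close>

lemma path_algebra_delta_mult: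
  "delta (w, q) \<otimes>\<^bsub>PA\<^esub> delta (u, p) = (if w = awlast u p then delta (u, p @ q) else (\<lambda>_. 0 :: 'k::field))"
proof (rule ext, clarify)
  fix u' r
  have "(delta (w, q) \<otimes>\<^bsub>PA\<^esub> delta (u, p)) (u', r) =
    (\<Sum>i\<le>length r. if i = length p then
       (if u' = u \<and> w = awlast u p \<and> r = p @ q then 1 else 0 :: 'k) else 0)"
    unfolding path_algebra_mult
  proof (rule sum.cong[OF refl])
    fix i assume "i \<in> {..length r}"
    then have len: "length (take i r) = i" by simp
    have split: "take (length p) r = p \<and> drop (length p) r = q \<longleftrightarrow> r = p @ q"
      by (metis append_eq_conv_conj)
    show "delta (w, q) (awlast u' (take i r), drop i r) * delta (u, p) (u', take i r) =
      (if i = length p then (if u' = u \<and> w = awlast u p \<and> r = p @ q then 1 else 0 :: 'k) else 0)"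
    proof (cases "i = length p")
      case True
      show ?thesis
      proof (cases "r = p @ q")
        case False
        with split True show ?thesis by (auto simp: delta_def)
      qed (auto simp: delta_def True)
    next
      case False
      with len have "take i r \<noteq> p" by auto
      with False show ?thesis by (simp add: delta_def)
    qed
  qed
  also have "\<dots> = (if u' = u \<and> w = awlast u p \<and> r = p @ q then 1 else 0)"
    by (cases "r = p @ q") simp_all
  also have "\<dots> = (if w = awlast u p then delta (u, p @ q) else (\<lambda>_. 0)) (u', r)"
    by (auto simp: delta_def)
  finally show "(delta (w, q) \<otimes>\<^bsub>PA\<^esub> delta (u, p)) (u', r) =
      (if w = awlast u p then delta (u, p @ q) else (\<lambda>_. 0 :: 'k)) (u', r)" .
qed

lemma path_algebra_one_mult:
  assumes "(u, p) \<in> quiver_paths G"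
  shows "\<one>\<^bsub>PA\<^esub> \<otimes>\<^bsub>PA\<^esub> delta (u, p) = delta (u, p)" "delta (u, p) \<otimes>\<^bsub>PA\<^esub> \<one>\<^bsub>PA\<^esub> = delta (u, p)"
proof -
  have u: "u \<in> verts G" "awlast u p \<in> verts G"
    using quiver_paths_append[of u "[]" p] quiver_paths_last assms by auto
  show "\<one>\<^bsub>PA\<^esub> \<otimes>\<^bsub>PA\<^esub> delta (u, p) = delta (u, p)"
  proof (rule ext, clarify)
    fix u' r
    have "(\<one>\<^bsub>PA\<^esub> \<otimes>\<^bsub>PA\<^esub> delta (u, p)) (u', r) =
      (\<Sum>i\<le>length r. if i = length r then delta (u, p) (u', r) else 0)"
      unfolding path_algebra_mult path_algebra_one
      by (rule sum.cong[OF refl]) (use u in \<open>auto simp: delta_def\<close>)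
    then show "(\<one>\<^bsub>PA\<^esub> \<otimes>\<^bsub>PA\<^esub> delta (u, p)) (u', r) = delta (u, p) (u', r)"
      by simp
  qed
  show "delta (u, p) \<otimes>\<^bsub>PA\<^esub> \<one>\<^bsub>PA\<^esub> = delta (u, p)"
  proof (rule ext, clarify)
    fix u' r
    have "(delta (u, p) \<otimes>\<^bsub>PA\<^esub> \<one>\<^bsub>PA\<^esub>) (u', r) =
      (\<Sum>i\<le>length r. if i = 0 then delta (u, p) (u', r) else 0)"
      unfolding path_algebra_mult path_algebra_one
      by (rule sum.cong[OF refl]) (use u in \<open>auto simp: delta_def\<close>)
    then show "(delta (u, p) \<otimes>\<^bsub>PA\<^esub> \<one>\<^bsub>PA\<^esub>) (u', r) = delta (u, p) (u', r)"
      by simp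
  qed
qed

lemma assoc_algebra_path_algebra: "assoc_algebra (path_algebra G :: ('k::field, 'a \<times> 'b list \<Rightarrow> 'k) module)"
proof -
  let ?A = "path_algebra G :: ('k, 'a \<times> 'b list \<Rightarrow> 'k) module"
  interpret free_module ?A "quiver_paths G" by (rule free_module_path_algebra)
  show ?thesis
  proof (rule assoc_algebraI_free)
    have "{x. \<one>\<^bsub>?A\<^esub> x \<noteq> 0} = (\<lambda>u. (u, [])) ` verts G"
      by (auto simp: path_algebra_one split: if_splits)
    then show "\<one>\<^bsub>?A\<^esub> \<in> carrier ?A"
      by (auto simp: carrier_eq finsupp_def)
    fix s t u :: "'a \<times> 'b list"
    assume "s \<in> quiver_paths G"
    then show "\<one>\<^bsub>?A\<^esub> \<otimes>\<^bsub>?A\<^esub> delta s = delta s" "delta s \<otimes>\<^bsub>?A\<^esub> \<one>\<^bsub>?A\<^esub> = delta s"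
      using path_algebra_one_mult[of "fst s" "snd s"] by simp_all
    assume t: "t \<in> quiver_paths G"
    with \<open>s \<in> _\<close> show "delta s \<otimes>\<^bsub>?A\<^esub> delta t \<in> carrier ?A"
      by (cases s; cases t) (auto simp: path_algebra_delta_mult carrier_eq finsupp_zero quiver_paths_append intro!: finsupp_delta)
    have z: "(\<lambda>_. 0) \<otimes>\<^bsub>?A\<^esub> f = (\<lambda>_. 0)" "f \<otimes>\<^bsub>?A\<^esub> (\<lambda>_. 0) = (\<lambda>_. 0)" for f
      by (auto simp: path_algebra_def)
    show "(delta s \<otimes>\<^bsub>?A\<^esub> delta t) \<otimes>\<^bsub>?A\<^esub> delta u = delta s \<otimes>\<^bsub>?A\<^esub> (delta t \<otimes>\<^bsub>?A\<^esub> delta u)"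
      by (cases s; cases t; cases u) (simp add: path_algebra_delta_mult z awlast_append)
  qed (auto simp: path_algebra_def fun_eq_iff algebra_simps sum.distrib sum_distrib_left)
qed

end


section \<open>Quotients by quadratic monomial relations\<close>

context gentle_quiver
begin

abbreviation PQ :: "('k, 'v \<times> 'a list \<Rightarrow> 'k) module" where
  "PQ \<equiv> path_algebra Q"

sublocale P: assoc_algebra "path_algebra Q :: ('k, 'v \<times> 'a list \<Rightarrow> 'k) module"
  by (rule assoc_algebra_path_algebra)

sublocale FP: free_module "path_algebra Q :: ('k, 'v \<times> 'a list \<Rightarrow> 'k) module" "quiver_paths Q"
  by (rule free_module_path_algebra)

lemma delta_closed [simp]: "x \<in> quiver_paths Q \<Longrightarrow> delta x \<in> carrier PQ"
  by (simp add: FP.carrier_eq finsupp_delta)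

lemma composable_path [simp]: "composable Q \<beta> \<alpha> \<Longrightarrow> (tail Q \<alpha>, [\<alpha>, \<beta>]) \<in> quiver_paths Q"
  by (simp add: composable_def)

lemma path2_closed [simp]: "composable Q \<beta> \<alpha> \<Longrightarrow> path2_elem Q \<beta> \<alpha> \<in> carrier PQ"
  by (simp add: path2_elem_def composable_def)

definition relations :: "('a \<times> 'a) set" where
  "relations = (SOME R. R \<subseteq> {(\<beta>, \<alpha>). composable Q \<beta> \<alpha>} \<and>
         I = Idl\<^bsub>PQ\<^esub> ((\<lambda>(\<beta>, \<alpha>). path2_elem Q \<beta> \<alpha>) ` R))"

lemma relations:
  "relations \<subseteq> {(\<beta>, \<alpha>). composable Q \<beta> \<alpha>}"
  "I = Idl\<^bsub>PQ\<^esub> ((\<lambda>(\<beta>, \<alpha>). path2_elem Q \<beta> \<alpha>) ` relations)"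
  using someI_ex[OF generated_by_length_two[unfolded Bex_def subset_eq[symmetric]]]
  unfolding relations_def[symmetric] by auto

lemma relations_carrier: "(\<lambda>(\<beta>, \<alpha>). path2_elem Q \<beta> \<alpha>) ` relations \<subseteq> carrier PQ"
  using relations(1) by auto

sublocale H: algebra_ideal PQ I
  unfolding algebra_ideal_def
  by (subst relations(2)) (intro conjI P.alg P.genideal_ideal relations_carrier)

text \<open>The paths that survive in the quotient. Their closure under subpaths is what allows
  their coefficients to be computed by cutting. Arrow lists follow the traversal, so neighbouring
  entries \<open>\<alpha>\<close>, \<open>\<beta>\<close> stand for the word
  \<open>\<beta>\<alpha>\<close>.\<close>

definition good_paths :: "('v \<times> 'a list) set" where
  "good_paths = {(u, p) \<in> quiver_paths Q. successively (\<lambda>\<alpha> \<beta>. path2_elem Q \<beta> \<alpha> \<notin> I) p}"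

lemma good_path: "x \<in> good_paths \<Longrightarrow> x \<in> quiver_paths Q"
  by (auto simp: good_paths_def)

lemma good_path_split:
  assumes "(u, p) \<in> good_paths"
  shows "(u, take i p) \<in> good_paths" "(awlast u (take i p), drop i p) \<in> good_paths"
  using assms quiver_paths_split[of u p i] successively_append_iff[of _ "take i p" "drop i p"]
  by (auto simp: good_paths_def)

lemma good_path_Nil [simp]: "(u, []) \<in> good_paths \<longleftrightarrow> u \<in> verts Q"
  by (simp add: good_paths_def)

lemma good_path_arc [simp]: "(u, [\<alpha>]) \<in> good_paths \<longleftrightarrow> \<alpha> \<in> arcs Q \<and> u = tail Q \<alpha>"
  by (auto simp: good_paths_def)

lemma good_path_two:
  "composable Q \<beta> \<alpha> \<Longrightarrow> path2_elem Q \<beta> \<alpha> \<notin> I \<Longrightarrow> (tail Q \<alpha>, [\<alpha>, \<beta>]) \<in> good_paths"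
  by (auto simp: good_paths_def composable_def)

text \<open>Every summand of the coefficient of a product at a member of \<open>V\<close> contains
  the coefficient of the given factor at an initial or final part, which lies in \<open>V\<close>
  again. The set \<open>V\<close> will consist of the good paths or of the trivial paths.\<close>

lemma ideal_vanishing:
  assumes "\<And>u p i. (u, p) \<in> V \<Longrightarrow> (u, take i p) \<in> V \<and> (awlast u (take i p), drop i p) \<in> V"
  shows "ideal {f \<in> carrier PQ. \<forall>x\<in>V. f x = 0} PQ" (is "ideal ?N PQ")
proof (rule idealI)
  have "\<ominus>\<^bsub>PQ\<^esub> f \<in> ?N" if "f \<in> ?N" for f
  proof -
    have "\<ominus>\<^bsub>PQ\<^esub> f = (\<lambda>z. - 1 * f z)"
      using that P.sm_minus_one[of f] by (simp add: FP.smult_eq)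
    with that show ?thesis using P.a_inv_closed[of f] by auto
  qed
  then have "inv\<^bsub>add_monoid PQ\<^esub> f \<in> ?N" if "f \<in> ?N" for f
    using that by (simp add: a_inv_def)
  then show "subgroup ?N (add_monoid PQ)"
    using P.zero_closed P.a_closed
    by (intro subgroup.intro) (auto simp: FP.add_eq FP.zero_eq)
  show "g \<otimes>\<^bsub>PQ\<^esub> f \<in> ?N" "f \<otimes>\<^bsub>PQ\<^esub> g \<in> ?N" if "f \<in> ?N" "g \<in> carrier PQ" for f g
    using that assms by (auto simp: path_algebra_mult)
qed (rule P.ring_axioms)

text \<open>Each generator is supported at a single path of length two that is not good, and
  vanishing at all good paths defines an ideal.\<close>

lemma coefficient_ideal:
  assumes "f \<in> I" "x \<in> good_paths"
  shows "f x = 0"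
proof -
  define N :: "('v \<times> 'a list \<Rightarrow> 'k) set" where "N = {f \<in> carrier PQ. \<forall>x\<in>good_paths. f x = 0}"
  have "ideal N PQ"
    unfolding N_def by (rule ideal_vanishing) (simp add: good_path_split)
  moreover have "(\<lambda>(\<beta>, \<alpha>). path2_elem Q \<beta> \<alpha>) ` relations \<subseteq> N"
  proof clarify
    fix \<beta> \<alpha> assume r: "(\<beta>, \<alpha>) \<in> relations"
    then have "path2_elem Q \<beta> \<alpha> \<in> I"
      using P.genideal_self[OF relations_carrier] relations(2) by (metis (mono_tags, lifting) case_prod_conv image_subset_iff)
    then have "(tail Q \<alpha>, [\<alpha>, \<beta>]) \<notin> good_paths" by (simp add: good_paths_def)
    then show "path2_elem Q \<beta> \<alpha> \<in> N"
      using r relations(1) by (auto simp: N_def path2_elem_def delta_def path2_closed[unfolded path2_elem_def delta_def])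
  qed
  ultimately have "Idl\<^bsub>PQ\<^esub> ((\<lambda>(\<beta>, \<alpha>). path2_elem Q \<beta> \<alpha>) ` relations) \<subseteq> N"
    by (rule P.genideal_minimal)
  then have "I \<subseteq> N"
    by (subst relations(2))
  with assms show ?thesis by (auto simp: N_def)
qed

text \<open>By \<open>coefficient_ideal\<close>, the coefficients at good paths descend to the quotient by \<open>I\<close>.\<close>

definition path_class :: "'v \<times> 'a list \<Rightarrow> ('v \<times> 'a list \<Rightarrow> 'k) set" where
  "path_class x = I +>\<^bsub>PQ\<^esub> delta x"

definition path_coeff :: "'v \<times> 'a list \<Rightarrow> ('v \<times> 'a list \<Rightarrow> 'k) set \<Rightarrow> 'k" where
  "path_coeff x = H.induced (\<lambda>f. f x)"

lemma linear_map_eval: "linear_map PQ field_algebra (\<lambda>f. f x)"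
  by (rule linear_mapI) (auto simp: assoc_algebra_field_algebra P.alg FP.add_eq FP.smult_eq)

lemma path_coeff_coset: "x \<in> good_paths \<Longrightarrow> f \<in> carrier PQ \<Longrightarrow> path_coeff x (I +>\<^bsub>PQ\<^esub> f) = f x"
  unfolding path_coeff_def by (rule H.induced_coset[OF linear_map_eval]) (simp_all add: coefficient_ideal)

lemma linear_map_path_coeff: "x \<in> good_paths \<Longrightarrow> linear_map H.AI field_algebra (path_coeff x)"
  unfolding path_coeff_def by (rule H.linear_map_induced[OF linear_map_eval]) (simp add: coefficient_ideal)

lemma path_class_closed [simp]: "x \<in> quiver_paths Q \<Longrightarrow> path_class x \<in> carrier H.AI"
  by (simp add: path_class_def)

lemma path_coeff_class:
  "x \<in> good_paths \<Longrightarrow> y \<in> quiver_paths Q \<Longrightarrow> path_coeff x (path_class y) = (if x = y then 1 else 0)"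
  by (simp add: path_class_def path_coeff_coset) (simp add: delta_def)

text \<open>Cutting a path in all ways is the coproduct of the path coalgebra. Its cases of length
  zero, one and two are the \<open>factors\<close> statements for vertices, arrows and nonzero
  products of two arrows.\<close>

lemma path_coeff_mult:
  assumes "(u, p) \<in> good_paths" "a \<in> carrier H.AI" "b \<in> carrier H.AI"
  shows "path_coeff (u, p) (a \<otimes>\<^bsub>H.AI\<^esub> b) =
    (\<Sum>i\<le>length p. path_coeff (awlast u (take i p), drop i p) a * path_coeff (u, take i p) b)"
  using assms by (auto simp: H.quot_carrier H.quot_mult path_coeff_coset path_algebra_mult good_path_split)

lemma path_coeff_one:
  assumes "(u, p) \<in> good_paths"
  shows "path_coeff (u, p) \<one>\<^bsub>H.AI\<^esub> = (if p = [] then 1 else 0)"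
  using assms good_path[OF assms] good_path_split(1)[OF assms, of 0]
  by (simp add: H.quot_one path_coeff_coset) (simp add: path_algebra_one)

lemma path_class_mult:
  assumes "(w, q) \<in> quiver_paths Q" "(u, p) \<in> quiver_paths Q"
  shows "path_class (w, q) \<otimes>\<^bsub>H.AI\<^esub> path_class (u, p) =
    (if w = awlast u p then path_class (u, p @ q) else \<zero>\<^bsub>H.AI\<^esub>)"
  using assms H.linear_map_quot[THEN linear_map.zero]
  by (simp add: path_class_def H.quot_mult path_algebra_delta_mult FP.zero_eq)

lemma linear_eqI:
  assumes "linear_map H.AI B f" "linear_map H.AI B g"
    and "\<And>x. x \<in> quiver_paths Q \<Longrightarrow> f (path_class x) = g (path_class x)"
    and "a \<in> carrier H.AI"
  shows "f a = g a"
proof -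
  obtain x where x: "x \<in> carrier PQ" "a = I +>\<^bsub>PQ\<^esub> x"
    using assms(4) by (auto simp: H.quot_carrier)
  have "f (I +>\<^bsub>PQ\<^esub> x) = g (I +>\<^bsub>PQ\<^esub> x)"
    by (rule free_module_linear_eqI[OF FP.free_module_axioms linear_map_comp[OF H.linear_map_quot assms(1)]
          linear_map_comp[OF H.linear_map_quot assms(2)]]) (use assms(3) x in \<open>auto simp: path_class_def\<close>)
  then show ?thesis by (simp add: x)
qed

lemma path_class_zero:
  assumes "composable Q \<beta> \<alpha>" "path2_elem Q \<beta> \<alpha> \<in> I"
  shows "path_class (tail Q \<alpha>, [\<alpha>, \<beta>]) = \<zero>\<^bsub>H.AI\<^esub>"
  using assms H.a_rcos_const[OF assms(2)]
  by (simp add: path_class_def path2_elem_def H.quot_zero)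

end


section \<open>Functionals on tensor squares\<close>

locale algebra_dual = assoc_algebra H for H :: "('k::field, 'h) module" (structure)
begin

sublocale HH: tensor H H
  by unfold_locales

abbreviation "H2 \<equiv> tensor_algebra H H"

sublocale H2: assoc_algebra H2
  by (rule HH.assoc_algebra_tensor)

sublocale L3: tensor H2 H
  by unfold_locales

sublocale R3: tensor H H2
  by unfold_locales

text \<open>
  Functionals are normalised to vanish outside the carrier, so that
  equality in the dual space is equality of functions.
\<close>

definition dual :: "('h \<Rightarrow> 'k) set" where
  "dual = {f. linear_map H field_algebra f \<and> (\<forall>x. x \<notin> carrier H \<longrightarrow> f x = 0)}"

definition clip :: "('h \<Rightarrow> 'k) \<Rightarrow> 'h \<Rightarrow> 'k" where
  "clip f x = (if x \<in> carrier H then f x else 0)"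

lemma clip_dual: "linear_map H field_algebra f \<Longrightarrow> clip f \<in> dual"
  unfolding dual_def by (auto simp: clip_def intro: linear_map_cong)

lemma clip_eq [simp]: "x \<in> carrier H \<Longrightarrow> clip f x = f x"
  by (simp add: clip_def)

lemma dual_linear: "f \<in> dual \<Longrightarrow> linear_map H field_algebra f"
  by (simp add: dual_def)

lemma dual_eqI: "f \<in> dual \<Longrightarrow> g \<in> dual \<Longrightarrow> (\<And>x. x \<in> carrier H \<Longrightarrow> f x = g x) \<Longrightarrow> f = g"
  by (rule ext, rename_tac x, case_tac "x \<in> carrier H") (simp_all add: dual_def)

lemma dual_zero_outside: "f \<in> dual \<Longrightarrow> x \<notin> carrier H \<Longrightarrow> f x = 0"
  by (simp add: dual_def)

lemma dual_add: "f \<in> dual \<Longrightarrow> g \<in> dual \<Longrightarrow> (\<lambda>x. f x + g x) \<in> dual"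
  using linear_map_add[of H field_algebra f g] by (simp add: dual_def)

lemma dual_scale: "f \<in> dual \<Longrightarrow> (\<lambda>x. c * f x) \<in> dual"
  using linear_map_scale[of H field_algebra f c] by (simp add: dual_def)

lemma dual_diff: "f \<in> dual \<Longrightarrow> g \<in> dual \<Longrightarrow> (\<lambda>x. f x - g x) \<in> dual"
  using dual_add[OF _ dual_scale[of g "-1"], of f] by simp

lemma dual_zero: "f \<in> dual \<Longrightarrow> f \<zero> = 0"
  using linear_map.zero[OF dual_linear] by simp

definition pairing :: "('h \<Rightarrow> 'k) \<Rightarrow> ('h \<Rightarrow> 'k) \<Rightarrow> ('h \<times> 'h \<Rightarrow> 'k) set \<Rightarrow> 'k" where
  "pairing f g = tensor_lift field_algebra (\<lambda>a b. f a * g b)"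

lemma bilinear_prod:
  assumes "linear_map A field_algebra f" "linear_map B field_algebra g"
  shows "bilinear_map A B field_algebra (\<lambda>a b. f a * g b)"
proof (rule bilinear_mapI)
  show "linear_map B field_algebra (\<lambda>b. f a * g b)" for a
    using linear_map_scale[OF assms(2), of "f a"] by simp
  show "linear_map A field_algebra (\<lambda>a. f a * g b)" for b
    using linear_map_scale[OF assms(1), of "g b"] by (simp add: mult.commute)
qed

lemma linear_pairing: "f \<in> dual \<Longrightarrow> g \<in> dual \<Longrightarrow> linear_map H2 field_algebra (pairing f g)"
  unfolding pairing_def
  by (rule HH.linear_tensor_lift[OF bilinear_prod assoc_algebra_field_algebra]) (auto dest: dual_linear)

lemma pairing_pure:
  "f \<in> dual \<Longrightarrow> g \<in> dual \<Longrightarrow> a \<in> carrier H \<Longrightarrow> b \<in> carrier H \<Longrightarrow> pairing f g (pure_tensor H H a b) = f a * g b"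
  unfolding pairing_def
  by (rule HH.tensor_lift_pure[OF bilinear_prod assoc_algebra_field_algebra]) (auto dest: dual_linear)

lemma pairing_eqI:
  assumes "f \<in> dual" "g \<in> dual" "linear_map H2 field_algebra L" "t \<in> carrier H2"
    and "\<And>a b. a \<in> carrier H \<Longrightarrow> b \<in> carrier H \<Longrightarrow> L (pure_tensor H H a b) = f a * g b"
  shows "L t = pairing f g t"
  by (rule HH.tensor_linear_eqI[OF assms(3) linear_pairing[OF assms(1,2)] _ assms(4)])
    (simp add: assms pairing_pure)

text \<open>The list represents the coproduct of \<open>f\<close> dual to the multiplication of
  \<open>H\<close>. It is a list because products of such expansions may repeat a pair, which then
  has to count twice.\<close>

definition factors :: "('h \<Rightarrow> 'k) \<Rightarrow> (('h \<Rightarrow> 'k) \<times> ('h \<Rightarrow> 'k)) list \<Rightarrow> bool" where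
  "factors f fs \<longleftrightarrow> f \<in> dual \<and> (\<forall>(p, q)\<in>set fs. p \<in> dual \<and> q \<in> dual) \<and>
     (\<forall>x\<in>carrier H. \<forall>y\<in>carrier H. f (x \<otimes> y) = (\<Sum>(p, q)\<leftarrow>fs. p x * q y))"

lemma factorsD:
  "factors f fs \<Longrightarrow> f \<in> dual"
  "factors f fs \<Longrightarrow> x \<in> carrier H \<Longrightarrow> y \<in> carrier H \<Longrightarrow> f (x \<otimes> y) = (\<Sum>(p, q)\<leftarrow>fs. p x * q y)"
  by (auto simp: factors_def)

lemma linear_map_sum_list:
  assumes "assoc_algebra B" "\<And>i. i \<in> set is \<Longrightarrow> linear_map B field_algebra (F i)"
  shows "linear_map B field_algebra (\<lambda>x. \<Sum>i\<leftarrow>is. F i x)"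
  using assms(2)
proof (induction "is")
  case Nil
  show ?case by (rule linear_mapI) (simp_all add: assms assoc_algebra_field_algebra)
next
  case (Cons i "is")
  then show ?case
    using linear_map_add[of B field_algebra "F i" "\<lambda>x. \<Sum>i\<leftarrow>is. F i x"] by simp
qed

text \<open>Both sides are bilinear in \<open>s\<close> and \<open>t\<close>, and on pure tensors
  the componentwise product turns the left side into a product of two expansions. First
  \<open>t\<close>, then \<open>s\<close> is released from pure to arbitrary tensors.\<close>

lemma pairing_mult:
  assumes f: "factors f fs" and g: "factors g gs" and t: "s \<in> carrier H2" "t \<in> carrier H2"
  shows "pairing f g (s \<otimes>\<^bsub>H2\<^esub> t) =
    (\<Sum>((p, q), (p', q'))\<leftarrow>List.product fs gs. pairing p p' s * pairing q q' t)"
proof -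
  let ?ps = "List.product fs gs"
  have fd: "f \<in> dual" "g \<in> dual" using f g by (auto simp: factors_def)
  have ps: "fst (fst i) \<in> dual \<and> snd (fst i) \<in> dual \<and> fst (snd i) \<in> dual \<and> snd (snd i) \<in> dual"
    if "i \<in> set ?ps" for i
    using that f g by (auto simp: factors_def)
  have lin1: "linear_map H2 field_algebra (\<lambda>s. \<Sum>i\<leftarrow>?ps. pairing (fst (fst i)) (fst (snd i)) s * c i)" for c
  proof (rule linear_map_sum_list[OF H2.alg])
    fix i assume "i \<in> set ?ps"
    then show "linear_map H2 field_algebra (\<lambda>s. pairing (fst (fst i)) (fst (snd i)) s * c i)"
      using linear_map_scale[OF linear_pairing, of "fst (fst i)" "fst (snd i)" "c i"] ps by (simp add: mult.commute)
  qed
  have lin2: "linear_map H2 field_algebra (\<lambda>t. \<Sum>i\<leftarrow>?ps. c i * pairing (snd (fst i)) (snd (snd i)) t)" for c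
  proof (rule linear_map_sum_list[OF H2.alg])
    fix i assume "i \<in> set ?ps"
    then show "linear_map H2 field_algebra (\<lambda>t. c i * pairing (snd (fst i)) (snd (snd i)) t)"
      using linear_map_scale[OF linear_pairing, of "snd (fst i)" "snd (snd i)" "c i"] ps by simp
  qed
  have pure: "pairing f g (pure_tensor H H a b \<otimes>\<^bsub>H2\<^esub> pure_tensor H H a' b') =
    (\<Sum>i\<leftarrow>?ps. pairing (fst (fst i)) (fst (snd i)) (pure_tensor H H a b) *
       pairing (snd (fst i)) (snd (snd i)) (pure_tensor H H a' b'))"
    if ab: "a \<in> carrier H" "b \<in> carrier H" "a' \<in> carrier H" "b' \<in> carrier H" for a b a' b'
  proof -
    have prod: "(\<Sum>i\<leftarrow>is. u i) * (\<Sum>j\<leftarrow>js. v j) = (\<Sum>(i, j)\<leftarrow>List.product is js. u i * v j)"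
      for u v :: "('h \<Rightarrow> 'k) \<times> ('h \<Rightarrow> 'k) \<Rightarrow> 'k" and "is" js
      by (induction "is") (auto simp: distrib_right sum_list_const_mult o_def)
    have "pairing f g (pure_tensor H H a b \<otimes>\<^bsub>H2\<^esub> pure_tensor H H a' b') = f (a \<otimes> a') * g (b \<otimes> b')"
      using ab fd by (simp add: HH.pure_mult pairing_pure)
    also have "\<dots> = (\<Sum>(i, j)\<leftarrow>?ps. (fst i a * snd i a') * (fst j b * snd j b'))"
      using ab f g by (simp add: factorsD(2) prod case_prod_unfold)
    also have "\<dots> = (\<Sum>i\<leftarrow>?ps. pairing (fst (fst i)) (fst (snd i)) (pure_tensor H H a b) *
       pairing (snd (fst i)) (snd (snd i)) (pure_tensor H H a' b'))"
      by (intro arg_cong[of _ _ sum_list] map_cong refl) (use ab ps in \<open>auto simp: pairing_pure\<close>)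
    finally show ?thesis .
  qed
  have "pairing f g (pure_tensor H H a b \<otimes>\<^bsub>H2\<^esub> t) =
    (\<Sum>i\<leftarrow>?ps. pairing (fst (fst i)) (fst (snd i)) (pure_tensor H H a b) * pairing (snd (fst i)) (snd (snd i)) t)"
    if "a \<in> carrier H" "b \<in> carrier H" for a b
    by (rule HH.tensor_linear_eqI[OF linear_map_comp[OF H2.linear_map_mult_right linear_pairing] lin2 _ t(2)])
      (use that pure fd in \<open>auto simp: HH.pure_closed\<close>)
  then have "pairing f g (s \<otimes>\<^bsub>H2\<^esub> t) =
    (\<Sum>i\<leftarrow>?ps. pairing (fst (fst i)) (fst (snd i)) s * pairing (snd (fst i)) (snd (snd i)) t)"
    by (intro HH.tensor_linear_eqI[OF linear_map_comp[OF H2.linear_map_mult_left linear_pairing] lin1 _ t(1)])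
      (use t fd in auto)
  then show ?thesis by (simp add: case_prod_unfold)
qed

lemma pairing_add:
  assumes "f \<in> dual" "f' \<in> dual" "g \<in> dual" "t \<in> carrier H2"
  shows "pairing (\<lambda>x. f x + f' x) g t = pairing f g t + pairing f' g t"
    "pairing g (\<lambda>x. f x + f' x) t = pairing g f t + pairing g f' t"
  by (rule pairing_eqI[OF _ _ linear_map_add[where B = field_algebra, simplified, OF linear_pairing linear_pairing] assms(4), symmetric];
      use assms in \<open>auto simp: dual_add pairing_pure algebra_simps\<close>)+

lemma pairing_scale:
  assumes "f \<in> dual" "g \<in> dual" "t \<in> carrier H2"
  shows "pairing (\<lambda>x. c * f x) g t = c * pairing f g t" "pairing f (\<lambda>x. c * g x) t = c * pairing f g t"
proof -
  note lin = linear_map_scale[where B = field_algebra, simplified, OF linear_pairing[OF assms(1,2)], of c]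
  show "pairing (\<lambda>x. c * f x) g t = c * pairing f g t" "pairing f (\<lambda>x. c * g x) t = c * pairing f g t"
    by (rule pairing_eqI[OF _ _ lin assms(3), symmetric];
        use assms in \<open>auto simp: dual_scale pairing_pure algebra_simps\<close>)+
qed

text \<open>The functional \<open>f\<close> tensor \<open>g\<close> tensor \<open>h\<close>, placed
  on the right-nested triple product because both sides of coassociativity end there.\<close>

definition triple :: "('h \<Rightarrow> 'k) \<Rightarrow> ('h \<Rightarrow> 'k) \<Rightarrow> ('h \<Rightarrow> 'k) \<Rightarrow> ('h \<times> ('h \<times> 'h \<Rightarrow> 'k) set \<Rightarrow> 'k) set \<Rightarrow> 'k" where
  "triple f g h = tensor_lift field_algebra (\<lambda>a t. f a * pairing g h t)"

lemma
  assumes "f \<in> dual" "g \<in> dual" "h \<in> dual"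
  shows linear_triple: "linear_map (tensor_algebra H H2) field_algebra (triple f g h)"
    and triple_pure: "a \<in> carrier H \<Longrightarrow> t \<in> carrier H2 \<Longrightarrow> triple f g h (pure_tensor H H2 a t) = f a * pairing g h t"
proof -
  note bil = bilinear_prod[OF dual_linear[OF assms(1)] linear_pairing[OF assms(2,3)]]
  show "linear_map (tensor_algebra H H2) field_algebra (triple f g h)"
    unfolding triple_def by (rule R3.linear_tensor_lift[OF bil assoc_algebra_field_algebra])
  show "a \<in> carrier H \<Longrightarrow> t \<in> carrier H2 \<Longrightarrow> triple f g h (pure_tensor H H2 a t) = f a * pairing g h t"
    unfolding triple_def by (rule R3.tensor_lift_pure[OF bil assoc_algebra_field_algebra])
qed

lemma
  assumes "linear_map H H2 D"
  shows linear_tensor_map_right: "linear_map H2 (tensor_algebra H H2) (tensor_map H H2 id D)"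
    and tensor_map_right_pure: "a \<in> carrier H \<Longrightarrow> b \<in> carrier H \<Longrightarrow>
      tensor_map H H2 id D (pure_tensor H H a b) = pure_tensor H H2 a (D b)"
proof -
  have bil: "bilinear_map H H (tensor_algebra H H2) (\<lambda>a b. pure_tensor H H2 a (D b))"
    by (rule bilinear_map_comp[OF R3.bilinear_pure linear_map_id assms])
  show "linear_map H2 (tensor_algebra H H2) (tensor_map H H2 id D)"
    unfolding tensor_map_def id_apply by (rule HH.linear_tensor_lift[OF bil R3.assoc_algebra_tensor])
  show "a \<in> carrier H \<Longrightarrow> b \<in> carrier H \<Longrightarrow>
      tensor_map H H2 id D (pure_tensor H H a b) = pure_tensor H H2 a (D b)"
    unfolding tensor_map_def id_apply by (rule HH.tensor_lift_pure[OF bil R3.assoc_algebra_tensor])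
qed

lemma
  assumes "linear_map H H2 D"
  shows linear_tensor_map_left: "linear_map H2 (tensor_algebra H2 H) (tensor_map H2 H D id)"
    and tensor_map_left_pure: "a \<in> carrier H \<Longrightarrow> b \<in> carrier H \<Longrightarrow>
      tensor_map H2 H D id (pure_tensor H H a b) = pure_tensor H2 H (D a) b"
proof -
  have bil: "bilinear_map H H (tensor_algebra H2 H) (\<lambda>a b. pure_tensor H2 H (D a) b)"
    by (rule bilinear_map_comp[OF L3.bilinear_pure assms linear_map_id])
  show "linear_map H2 (tensor_algebra H2 H) (tensor_map H2 H D id)"
    unfolding tensor_map_def id_apply by (rule HH.linear_tensor_lift[OF bil L3.assoc_algebra_tensor])
  show "a \<in> carrier H \<Longrightarrow> b \<in> carrier H \<Longrightarrow>
      tensor_map H2 H D id (pure_tensor H H a b) = pure_tensor H2 H (D a) b"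
    unfolding tensor_map_def id_apply by (rule HH.tensor_lift_pure[OF bil L3.assoc_algebra_tensor])
qed

text \<open>The rebracketing map is a lift of a lift. The inner lift must be shown linear in its
  parameter \<open>c\<close> before the outer one is meaningful, and this is checked on pure
  tensors.\<close>

lemma
  shows linear_tensor_assoc: "linear_map (tensor_algebra H2 H) (tensor_algebra H H2) (tensor_assoc H H H)"
    and triple_tensor_assoc: "f \<in> dual \<Longrightarrow> g \<in> dual \<Longrightarrow> h \<in> dual \<Longrightarrow> t \<in> carrier H2 \<Longrightarrow> c \<in> carrier H \<Longrightarrow>
      triple f g h (tensor_assoc H H H (pure_tensor H2 H t c)) = pairing f g t * h c"
proof -
  let ?RT = "tensor_algebra H H2" and ?LT = "tensor_algebra H2 H"
  define \<gamma> where "\<gamma> c = (\<lambda>a b. pure_tensor H H2 a (pure_tensor H H b c))" for c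
  have b\<gamma>: "bilinear_map H H ?RT (\<gamma> c)" if "c \<in> carrier H" for c
    unfolding \<gamma>_def by (rule bilinear_map_comp[OF R3.bilinear_pure linear_map_id bilinear_map_left[OF HH.bilinear_pure that]])
  note l\<gamma> = HH.linear_tensor_lift[OF b\<gamma> R3.assoc_algebra_tensor]
  note p\<gamma> = HH.tensor_lift_pure[OF b\<gamma> R3.assoc_algebra_tensor]
  interpret RT: assoc_algebra ?RT by (rule R3.assoc_algebra_tensor)
  have \<gamma>_add: "tensor_lift ?RT (\<gamma> (c \<oplus> d)) t = tensor_lift ?RT (\<gamma> c) t \<oplus>\<^bsub>?RT\<^esub> tensor_lift ?RT (\<gamma> d) t"
    if "c \<in> carrier H" "d \<in> carrier H" "t \<in> carrier H2" for c d t
  proof (rule HH.tensor_linear_eqI[OF l\<gamma> linear_map_add[OF l\<gamma> l\<gamma>] _ that(3)])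
    fix a b assume ab: "a \<in> carrier H" "b \<in> carrier H"
    show "tensor_lift ?RT (\<gamma> (c \<oplus> d)) (pure_tensor H H a b) =
        tensor_lift ?RT (\<gamma> c) (pure_tensor H H a b) \<oplus>\<^bsub>?RT\<^esub> tensor_lift ?RT (\<gamma> d) (pure_tensor H H a b)"
      using that ab by (simp add: p\<gamma>)
        (simp add: \<gamma>_def linear_map.add[OF bilinear_map_right[OF HH.bilinear_pure]]
          linear_map.add[OF bilinear_map_right[OF R3.bilinear_pure]] HH.pure_closed)
  qed (use that in auto)
  have \<gamma>_scale: "tensor_lift ?RT (\<gamma> (r \<odot> c)) t = r \<odot>\<^bsub>?RT\<^esub> tensor_lift ?RT (\<gamma> c) t"
    if "c \<in> carrier H" "t \<in> carrier H2" for c r t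
  proof (rule HH.tensor_linear_eqI[OF l\<gamma> linear_map_scale[OF l\<gamma>] _ that(2)])
    fix a b assume ab: "a \<in> carrier H" "b \<in> carrier H"
    show "tensor_lift ?RT (\<gamma> (r \<odot> c)) (pure_tensor H H a b) = r \<odot>\<^bsub>?RT\<^esub> tensor_lift ?RT (\<gamma> c) (pure_tensor H H a b)"
      using that ab by (simp add: p\<gamma>)
        (simp add: \<gamma>_def linear_map.scale[OF bilinear_map_right[OF HH.bilinear_pure]]
          linear_map.scale[OF bilinear_map_right[OF R3.bilinear_pure]] HH.pure_closed)
  qed (use that in auto)
  have bA: "bilinear_map H2 H ?RT (\<lambda>t c. tensor_lift ?RT (\<gamma> c) t)"
  proof (rule bilinear_mapI)
    show "linear_map H ?RT (\<lambda>c. tensor_lift ?RT (\<gamma> c) t)" if "t \<in> carrier H2" for t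
      by (rule linear_mapI) (use that in \<open>auto simp: alg RT.alg \<gamma>_add \<gamma>_scale
          linear_map.closed[OF l\<gamma>]\<close>)
  qed (rule l\<gamma>)
  have A_eq: "tensor_assoc H H H = tensor_lift ?RT (\<lambda>t c. tensor_lift ?RT (\<gamma> c) t)"
    by (simp add: tensor_assoc_def \<gamma>_def Let_def)
  show "linear_map ?LT ?RT (tensor_assoc H H H)"
    unfolding A_eq by (rule L3.linear_tensor_lift[OF bA R3.assoc_algebra_tensor])
  assume fgh: "f \<in> dual" "g \<in> dual" "h \<in> dual" and tc: "t \<in> carrier H2" "c \<in> carrier H"
  have "triple f g h (tensor_lift ?RT (\<gamma> c) t) = h c * pairing f g t"
  proof (rule HH.tensor_linear_eqI[OF linear_map_comp[OF l\<gamma> linear_triple[OF fgh]]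
        linear_map_scale[where B = field_algebra, simplified, OF linear_pairing] _ tc(1)])
    fix a b assume "a \<in> carrier H" "b \<in> carrier H"
    then show "triple f g h (tensor_lift ?RT (\<gamma> c) (pure_tensor H H a b)) = h c * pairing f g (pure_tensor H H a b)"
      using tc fgh by (simp add: p\<gamma>) (simp add: \<gamma>_def triple_pure HH.pure_closed pairing_pure)
  qed (use tc fgh in auto)
  then show "triple f g h (tensor_assoc H H H (pure_tensor H2 H t c)) = pairing f g t * h c"
    unfolding A_eq using tc by (simp add: L3.tensor_lift_pure[OF bA R3.assoc_algebra_tensor] mult.commute)
qed

lemma clip_pairing_dual:
  assumes "f \<in> dual" "g \<in> dual" "linear_map H H2 D"
  shows "clip (\<lambda>x. pairing f g (D x)) \<in> dual"
  by (rule clip_dual[OF linear_map_comp[OF assms(3) linear_pairing[OF assms(1,2)]]])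

text \<open>Together with \<open>triple_left\<close> this translates coassociativity of
  \<open>D\<close> into associativity of the product that \<open>D\<close> induces on
  functionals.\<close>

lemma triple_right:
  assumes "f \<in> dual" "g \<in> dual" "h \<in> dual" "linear_map H H2 D" "t \<in> carrier H2"
  shows "triple f g h (tensor_map H H2 id D t) = pairing f (clip (\<lambda>x. pairing g h (D x))) t"
  by (rule pairing_eqI[OF assms(1) clip_pairing_dual[OF assms(2,3,4)]
        linear_map_comp[OF linear_tensor_map_right[OF assms(4)] linear_triple[OF assms(1,2,3)]] assms(5)])
    (simp add: tensor_map_right_pure[OF assms(4)] triple_pure[OF assms(1,2,3)] linear_map.closed[OF assms(4)])

lemma triple_left:
  assumes "f \<in> dual" "g \<in> dual" "h \<in> dual" "linear_map H H2 D" "t \<in> carrier H2"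
  shows "triple f g h (tensor_assoc H H H (tensor_map H2 H D id t)) = pairing (clip (\<lambda>x. pairing f g (D x))) h t"
  by (rule pairing_eqI[OF clip_pairing_dual[OF assms(1,2,4)] assms(3)
        linear_map_comp[OF linear_tensor_map_left[OF assms(4)]
          linear_map_comp[OF linear_tensor_assoc linear_triple[OF assms(1,2,3)]]] assms(5)])
    (simp add: tensor_map_left_pure[OF assms(4)] triple_tensor_assoc assms linear_map.closed[OF assms(4)])

end


section \<open>The dual algebra of a Hopf algebra\<close>

context hopf_algebra
begin

sublocale algebra_dual H
  by unfold_locales

lemma linear_comult: "linear_map H H2 \<Delta>"
  and comult_closed [simp]: "x \<in> carrier H \<Longrightarrow> \<Delta> x \<in> carrier H2"
  and comult_mult: "x \<in> carrier H \<Longrightarrow> y \<in> carrier H \<Longrightarrow> \<Delta> (x \<otimes> y) = \<Delta> x \<otimes>\<^bsub>H2\<^esub> \<Delta> y"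
  and comult_one: "\<Delta> \<one> = \<one>\<^bsub>H2\<^esub>"
proof -
  show "linear_map H H2 \<Delta>"
    using comult_hom by (auto simp: alg_hom_def linear_map_def linear_map_axioms_def alg H2.alg)
  then show "x \<in> carrier H \<Longrightarrow> \<Delta> x \<in> carrier H2" by (rule linear_map.closed)
  show "x \<in> carrier H \<Longrightarrow> y \<in> carrier H \<Longrightarrow> \<Delta> (x \<otimes> y) = \<Delta> x \<otimes>\<^bsub>H2\<^esub> \<Delta> y" "\<Delta> \<one> = \<one>\<^bsub>H2\<^esub>"
    using comult_hom by (auto simp: alg_hom_def ring_hom_def)
qed

lemma linear_counit: "linear_map H field_algebra \<epsilon>"
  using counit_hom by (auto simp: alg_hom_def linear_map_def linear_map_axioms_def alg assoc_algebra_field_algebra)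

lemma counit_mult: "x \<in> carrier H \<Longrightarrow> y \<in> carrier H \<Longrightarrow> \<epsilon> (x \<otimes> y) = \<epsilon> x * \<epsilon> y"
  and counit_one: "\<epsilon> \<one> = 1"
  using counit_hom by (auto simp: alg_hom_def ring_hom_def)

lemma linear_antipode: "linear_map H H S"
  using antipode_linear by (auto simp: linear_map_def linear_map_axioms_def alg)

definition conv :: "('h \<Rightarrow> 'k) \<Rightarrow> ('h \<Rightarrow> 'k) \<Rightarrow> 'h \<Rightarrow> 'k" (infixl \<open>\<star>\<close> 70) where
  "f \<star> g = clip (\<lambda>x. pairing f g (\<Delta> x))"

lemma conv_dual [simp]: "f \<in> dual \<Longrightarrow> g \<in> dual \<Longrightarrow> f \<star> g \<in> dual"
  unfolding conv_def by (intro clip_dual linear_map_comp[OF linear_comult] linear_pairing)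

lemma conv_add_left:
    "f \<in> dual \<Longrightarrow> f' \<in> dual \<Longrightarrow> g \<in> dual \<Longrightarrow> (\<lambda>x. f x + f' x) \<star> g = (\<lambda>x. (f \<star> g) x + (f' \<star> g) x)"
  and conv_add_right:
    "f \<in> dual \<Longrightarrow> f' \<in> dual \<Longrightarrow> g \<in> dual \<Longrightarrow> g \<star> (\<lambda>x. f x + f' x) = (\<lambda>x. (g \<star> f) x + (g \<star> f') x)"
  by (auto simp: conv_def clip_def fun_eq_iff pairing_add)

lemma conv_scale_left: "f \<in> dual \<Longrightarrow> g \<in> dual \<Longrightarrow> (\<lambda>x. c * f x) \<star> g = (\<lambda>x. c * (f \<star> g) x)"
  and conv_scale_right: "f \<in> dual \<Longrightarrow> g \<in> dual \<Longrightarrow> g \<star> (\<lambda>x. c * f x) = (\<lambda>x. c * (g \<star> f) x)"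
  by (auto simp: conv_def clip_def fun_eq_iff pairing_scale)

lemma conv_diff_left:
  "f \<in> dual \<Longrightarrow> f' \<in> dual \<Longrightarrow> g \<in> dual \<Longrightarrow> (\<lambda>x. f x - f' x) \<star> g = (\<lambda>x. (f \<star> g) x - (f' \<star> g) x)"
  using conv_add_left[OF _ dual_scale[of f' "-1"], of f g] conv_scale_left[of f' g "-1"] by simp

lemma conv_diff_right:
  "f \<in> dual \<Longrightarrow> f' \<in> dual \<Longrightarrow> g \<in> dual \<Longrightarrow> g \<star> (\<lambda>x. f x - f' x) = (\<lambda>x. (g \<star> f) x - (g \<star> f') x)"
  using conv_add_right[OF _ dual_scale[of f' "-1"], of f g] conv_scale_right[of f' g "-1"] by simp

definition unit :: "'h \<Rightarrow> 'k" where
  "unit = clip \<epsilon>"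

lemma unit_dual: "unit \<in> dual"
  unfolding unit_def by (rule clip_dual[OF linear_counit])

lemma unit_conv:
  assumes "f \<in> dual" shows "unit \<star> f = f"
proof (rule dual_eqI)
  fix x assume x: "x \<in> carrier H"
  interpret f: linear_map H field_algebra f by (rule dual_linear[OF assms])
  let ?L = "tensor_lift H (\<lambda>a b. \<epsilon> a \<odot> b)"
  have "f (?L (\<Delta> x)) = pairing unit f (\<Delta> x)"
    by (rule pairing_eqI[OF unit_dual assms linear_map_comp[OF HH.linear_tensor_lift[OF bilinear_map_scalar(1)[OF linear_counit alg] alg]
            dual_linear[OF assms]]])
      (simp_all add: x HH.tensor_lift_pure[OF bilinear_map_scalar(1)[OF linear_counit alg] alg] f.scale unit_def)
  then show "(unit \<star> f) x = f x"
    using x by (simp add: conv_def counit_left)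
qed (auto intro: conv_dual unit_dual assms)

lemma conv_unit:
  assumes "f \<in> dual" shows "f \<star> unit = f"
proof (rule dual_eqI)
  fix x assume x: "x \<in> carrier H"
  interpret f: linear_map H field_algebra f by (rule dual_linear[OF assms])
  let ?L = "tensor_lift H (\<lambda>a b. \<epsilon> b \<odot> a)"
  have "f (?L (\<Delta> x)) = pairing f unit (\<Delta> x)"
    by (rule pairing_eqI[OF assms unit_dual linear_map_comp[OF HH.linear_tensor_lift[OF bilinear_map_scalar(2)[OF linear_counit alg] alg]
            dual_linear[OF assms]]])
      (simp_all add: x HH.tensor_lift_pure[OF bilinear_map_scalar(2)[OF linear_counit alg] alg] f.scale unit_def)
  then show "(f \<star> unit) x = f x"
    using x by (simp add: conv_def counit_right)
qed (auto intro: conv_dual unit_dual assms)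

lemma conv_assoc:
  assumes "f \<in> dual" "g \<in> dual" "h \<in> dual"
  shows "(f \<star> g) \<star> h = f \<star> (g \<star> h)"
proof (rule dual_eqI)
  fix x assume x: "x \<in> carrier H"
  then show "(f \<star> g \<star> h) x = (f \<star> (g \<star> h)) x"
    using triple_left[OF assms linear_comult, of "\<Delta> x"] triple_right[OF assms linear_comult, of "\<Delta> x"]
    by (simp add: conv_def coassoc)
qed (auto intro: conv_dual assms)

text \<open>The bialgebra axiom seen from the dual: since the coproduct of \<open>H\<close> is
  multiplicative, the expansions of functionals multiply factorwise under convolution.\<close>

lemma factors_conv:
  assumes f: "factors f fs" and g: "factors g gs"
  shows "factors (f \<star> g) (map (\<lambda>((p, q), (p', q')). (p \<star> p', q \<star> q')) (List.product fs gs))"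
  unfolding factors_def
proof (intro conjI ballI)
  show "f \<star> g \<in> dual" using f g by (auto simp: factors_def intro: conv_dual)
  show "case i of (p, q) \<Rightarrow> p \<in> dual \<and> q \<in> dual"
    if "i \<in> set (map (\<lambda>((p, q), (p', q')). (p \<star> p', q \<star> q')) (List.product fs gs))" for i
    using that f g by (auto simp: factors_def intro!: conv_dual)
  show "(f \<star> g) (x \<otimes> y) =
      (\<Sum>(p, q)\<leftarrow>map (\<lambda>((p, q), (p', q')). (p \<star> p', q \<star> q')) (List.product fs gs). p x * q y)"
    if "x \<in> carrier H" "y \<in> carrier H" for x y
    using that by (simp add: conv_def comult_mult pairing_mult[OF f g] case_prod_unfold o_def)
qed

text \<open>These are the group-like elements of the dual.\<close>

definition character :: "('h \<Rightarrow> 'k) \<Rightarrow> bool" where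
  "character f \<longleftrightarrow> factors f [(f, f)] \<and> f \<one> = 1"

lemma character_unit: "character unit"
  by (simp add: character_def factors_def unit_dual) (simp add: unit_def counit_mult counit_one)

lemma character_conv:
  assumes "character f" "character g" shows "character (f \<star> g)"
  using assms factors_conv[of f "[(f, f)]" g "[(g, g)]"] factorsD(1)
  by (auto simp: character_def conv_def comult_one HH.pure_one pairing_pure)

text \<open>The inverse is \<open>f\<close> composed with the antipode: a multiplicative
  \<open>f\<close> carries the two antipode identities over to convolution.\<close>

lemma character_inverse:
  assumes "character f"
  obtains f' where "f' \<in> dual" "f' \<star> f = unit" "f \<star> f' = unit"
proof
  have f: "f \<in> dual" and f_mult: "\<And>x y. x \<in> carrier H \<Longrightarrow> y \<in> carrier H \<Longrightarrow> f (x \<otimes> y) = f x * f y" and f1: "f \<one> = 1"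
    using assms by (auto simp: character_def factors_def)
  interpret f: linear_map H field_algebra f by (rule dual_linear[OF f])
  interpret S: linear_map H H S by (rule linear_antipode)
  define f' where "f' = clip (\<lambda>x. f (S x))"
  show f': "f' \<in> dual"
    unfolding f'_def by (intro clip_dual linear_map_comp[OF linear_antipode dual_linear[OF f]])
  note bl = bilinear_map_comp[OF bilinear_map_mult linear_antipode linear_map_id]
    and br = bilinear_map_comp[OF bilinear_map_mult linear_map_id linear_antipode]
  note lin = HH.linear_tensor_lift[OF bl alg] HH.linear_tensor_lift[OF br alg]
  note pure = HH.tensor_lift_pure[OF bl alg] HH.tensor_lift_pure[OF br alg]
  show "f' \<star> f = unit"
  proof (rule dual_eqI)
    fix x assume x: "x \<in> carrier H"
    have "f (tensor_lift H (\<lambda>a b. S a \<otimes> b) (\<Delta> x)) = pairing f' f (\<Delta> x)"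
      by (rule pairing_eqI[OF f' f linear_map_comp[OF lin(1) dual_linear[OF f]]])
        (simp_all add: x pure f_mult f'_def)
    then show "(f' \<star> f) x = unit x"
      using x by (simp add: conv_def antipode_left f.scale f1 unit_def)
  qed (auto intro: conv_dual f f' unit_dual)
  show "f \<star> f' = unit"
  proof (rule dual_eqI)
    fix x assume x: "x \<in> carrier H"
    have "f (tensor_lift H (\<lambda>a b. a \<otimes> S b) (\<Delta> x)) = pairing f f' (\<Delta> x)"
      by (rule pairing_eqI[OF f f' linear_map_comp[OF lin(2) dual_linear[OF f]]])
        (simp_all add: x pure f_mult f'_def)
    then show "(f \<star> f') x = unit x"
      using x by (simp add: conv_def antipode_right f.scale f1 unit_def)
  qed (auto intro: conv_dual f f' unit_dual)
qed

end


section \<open>Hopf structures on gentle algebras\<close>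

text \<open>A finite spanning set has representatives whose supports contain finitely many paths
  altogether, while the initial parts of the infinite walk are good paths of every length. One of
  them is missed, and its coefficient functional kills the span but not its own class.\<close>

lemma (in gentle_quiver) no_infinite_good_path:
  assumes "finite_dimensional H.AI"
    and s: "\<And>i. composable Q (s (Suc i)) (s i)" "\<And>i. path2_elem Q (s (Suc i)) (s i) \<notin> I"
  shows False
proof -
  have arc: "s i \<in> arcs Q" and step: "head Q (s i) = tail Q (s (Suc i))" for i
    using s(1)[of i] by (auto simp: composable_def)
  define q where "q k m = map s [k..<k + m]" for k m
  have q: "q k 0 = []" "q k (Suc m) = s k # q (Suc k) m" for k m
    by (simp_all add: q_def upt_conv_Cons del: upt_Suc)
  have succ: "successively (\<lambda>\<alpha> \<beta>. path2_elem Q \<beta> \<alpha> \<notin> I) (q k m)" for k m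
  proof (induction m arbitrary: k)
    case (Suc m)
    then show ?case using s(2) by (cases m) (auto simp: q successively_Cons)
  qed (simp add: q)
  have path: "(tail Q (s k), q k m) \<in> quiver_paths Q" for k m
    by (induction m arbitrary: k) (auto simp: q arc step)
  define p where "p m = (tail Q (s 0), q 0 m)" for m
  have p: "p m \<in> good_paths" for m
    using succ path by (simp add: p_def good_paths_def)
  obtain B where B: "finite B" "B \<subseteq> carrier H.AI"
    and span: "\<And>x. x \<in> carrier H.AI \<Longrightarrow> \<exists>c. x = (\<Oplus>\<^bsub>H.AI\<^esub>b\<in>B. c b \<odot>\<^bsub>H.AI\<^esub> b)"
    using assms(1) unfolding finite_dimensional_def by blast
  have "\<exists>f. f \<in> carrier PQ \<and> b = I +>\<^bsub>PQ\<^esub> f" if "b \<in> B" for b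
    using that B(2) by (auto simp: H.quot_carrier)
  then obtain rep where rep: "\<And>b. b \<in> B \<Longrightarrow> rep b \<in> carrier PQ" "\<And>b. b \<in> B \<Longrightarrow> b = I +>\<^bsub>PQ\<^esub> rep b"
    by metis
  have "finite (\<Union>b\<in>B. {y. rep b y \<noteq> 0})"
    using B(1) rep(1) by (auto simp: FP.carrier_eq finsupp_def)
  \<comment> \<open>Arrows may repeat along the walk, but the lengths tell its initial parts
    apart.\<close>
  moreover have "inj p"
    by (rule injI) (auto simp: p_def q_def dest: map_eq_imp_length_eq)
  ultimately obtain m where m: "p m \<notin> (\<Union>b\<in>B. {y. rep b y \<noteq> 0})"
    by (meson finite_subset image_subset_iff range_inj_infinite)
  have zero: "path_coeff (p m) b = 0" if "b \<in> B" for b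
    using rep[OF that] that m path_coeff_coset[OF p rep(1)[OF that]] by auto
  interpret AI: assoc_algebra H.AI by (rule H.assoc_algebra_quot)
  interpret c: linear_map H.AI field_algebra "path_coeff (p m)" by (rule linear_map_path_coeff[OF p])
  obtain c where "path_class (p m) = (\<Oplus>\<^bsub>H.AI\<^esub>b\<in>B. c b \<odot>\<^bsub>H.AI\<^esub> b)"
    using span[of "path_class (p m)"] good_path[OF p] by auto
  then have "path_coeff (p m) (path_class (p m)) = (\<Sum>b\<in>B. path_coeff (p m) (c b \<odot>\<^bsub>H.AI\<^esub> b))"
    using B by (subst c.sum[simplified, symmetric]) (auto simp: Pi_def)
  also have "\<dots> = 0"
    using B(2) by (intro sum.neutral) (auto simp: c.scale zero)
  finally show False
    using good_path[OF p] by (simp add: path_coeff_class p)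
qed

text \<open>Quivers consisting of isolated vertices have to be excluded: their algebra is the
  algebra of functions on a finite group and hence carries a Hopf structure, yet no cycle occurs.
  Characteristic zero separates 1 from -1 in the parity argument.\<close>

locale gentle_hopf = gentle_quiver Q I + hopf_algebra "quot_algebra (path_algebra Q) I" \<Delta> \<epsilon> S
  for Q :: "('v, 'a) pre_digraph" and I :: "('v \<times> 'a list \<Rightarrow> 'k::field_char_0) set"
    and \<Delta> \<epsilon> S +
  assumes fin_dim: "finite_dimensional (quot_algebra (path_algebra Q) I)"
    and has_arrow: "arcs Q \<noteq> {}"
begin

section \<open>Coefficient functionals and classes of vertices and arrows\<close>

abbreviation "HA \<equiv> H.AI"

notation conv (infixl \<open>\<star>\<close> 70)

definition \<chi> :: "'v \<Rightarrow> ('v \<times> 'a list \<Rightarrow> 'k) set \<Rightarrow> 'k" where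
  "\<chi> v = clip (path_coeff (v, []))"

definition \<phi> :: "'a \<Rightarrow> ('v \<times> 'a list \<Rightarrow> 'k) set \<Rightarrow> 'k" where
  "\<phi> \<alpha> = clip (path_coeff (tail Q \<alpha>, [\<alpha>]))"

definition ev :: "'v \<Rightarrow> ('v \<times> 'a list \<Rightarrow> 'k) set" where
  "ev v = path_class (v, [])"

definition ar :: "'a \<Rightarrow> ('v \<times> 'a list \<Rightarrow> 'k) set" where
  "ar \<alpha> = path_class (tail Q \<alpha>, [\<alpha>])"

lemma ev_closed [simp]: "v \<in> verts Q \<Longrightarrow> ev v \<in> carrier HA"
  and ar_closed [simp]: "\<alpha> \<in> arcs Q \<Longrightarrow> ar \<alpha> \<in> carrier HA"
  by (simp_all add: ev_def ar_def)

lemma path_coeff_dual: "x \<in> good_paths \<Longrightarrow> clip (path_coeff x) \<in> dual"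
  by (intro clip_dual linear_map_path_coeff)

lemma \<chi>_dual [simp]: "v \<in> verts Q \<Longrightarrow> \<chi> v \<in> dual"
  and \<phi>_dual [simp]: "\<alpha> \<in> arcs Q \<Longrightarrow> \<phi> \<alpha> \<in> dual"
  by (auto simp: \<chi>_def \<phi>_def intro!: path_coeff_dual)

lemma \<chi>_path_class:
  "v \<in> verts Q \<Longrightarrow> y \<in> quiver_paths Q \<Longrightarrow> \<chi> v (path_class y) = (if y = (v, []) then 1 else 0)"
  by (auto simp: \<chi>_def path_coeff_class)

lemma \<chi>_ev [simp]: "v \<in> verts Q \<Longrightarrow> w \<in> verts Q \<Longrightarrow> \<chi> v (ev w) = (if v = w then 1 else 0)"
  and \<chi>_ar [simp]: "v \<in> verts Q \<Longrightarrow> \<alpha> \<in> arcs Q \<Longrightarrow> \<chi> v (ar \<alpha>) = 0"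
  by (auto simp: ev_def ar_def \<chi>_path_class)

lemma \<phi>_ev [simp]: "\<alpha> \<in> arcs Q \<Longrightarrow> w \<in> verts Q \<Longrightarrow> \<phi> \<alpha> (ev w) = 0"
  and \<phi>_ar [simp]: "\<alpha> \<in> arcs Q \<Longrightarrow> \<beta> \<in> arcs Q \<Longrightarrow> \<phi> \<alpha> (ar \<beta>) = (if \<alpha> = \<beta> then 1 else 0)"
  by (auto simp: \<phi>_def ev_def ar_def path_coeff_class)

lemma factors_\<chi>: "v \<in> verts Q \<Longrightarrow> factors (\<chi> v) [(\<chi> v, \<chi> v)]"
  by (simp add: factors_def) (simp add: \<chi>_def path_coeff_mult)

lemma factors_\<phi>: "\<alpha> \<in> arcs Q \<Longrightarrow> factors (\<phi> \<alpha>) [(\<phi> \<alpha>, \<chi> (tail Q \<alpha>)), (\<chi> (head Q \<alpha>), \<phi> \<alpha>)]"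
  by (simp add: factors_def) (simp add: \<chi>_def \<phi>_def path_coeff_mult add.commute)

lemma factors_path2:
  assumes "composable Q \<beta> \<alpha>" "path2_elem Q \<beta> \<alpha> \<notin> I"
  shows "factors (clip (path_coeff (tail Q \<alpha>, [\<alpha>, \<beta>])))
    [(clip (path_coeff (tail Q \<alpha>, [\<alpha>, \<beta>])), \<chi> (tail Q \<alpha>)), (\<phi> \<beta>, \<phi> \<alpha>),
     (\<chi> (head Q \<beta>), clip (path_coeff (tail Q \<alpha>, [\<alpha>, \<beta>])))]"
  using assms good_path_two[OF assms]
  by (simp add: factors_def path_coeff_dual composable_def)
     (simp add: \<chi>_def \<phi>_def path_coeff_mult numeral_2_eq_2 algebra_simps)

lemma character_\<chi>: "v \<in> verts Q \<Longrightarrow> character (\<chi> v)"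
  by (simp add: character_def factors_\<chi>) (simp add: \<chi>_def path_coeff_one)

lemma dual_path_eqI:
  assumes "f \<in> dual" "g \<in> dual" "\<And>x. x \<in> quiver_paths Q \<Longrightarrow> f (path_class x) = g (path_class x)"
  shows "f = g"
  by (rule dual_eqI[OF assms(1,2)], rule linear_eqI) (use assms dual_linear in auto)

text \<open>Otherwise all powers of the loop would be good paths.\<close>

lemma loop_square:
  assumes "\<alpha> \<in> arcs Q" "tail Q \<alpha> = head Q \<alpha>"
  shows "path2_elem Q \<alpha> \<alpha> \<in> I"
  using no_infinite_good_path[OF fin_dim, of "\<lambda>_. \<alpha>"] assms by (auto simp: composable_def)

lemma ar_mult_zero:
  "composable Q \<beta> \<alpha> \<Longrightarrow> path2_elem Q \<beta> \<alpha> \<in> I \<Longrightarrow> ar \<beta> \<otimes>\<^bsub>HA\<^esub> ar \<alpha> = \<zero>\<^bsub>HA\<^esub>"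
  unfolding ar_def by (subst path_class_mult) (auto simp: composable_def path_class_zero)

lemma path_class_Cons:
  assumes "(u, \<alpha> # p) \<in> quiver_paths Q"
  shows "path_class (u, \<alpha> # p) = path_class (head Q \<alpha>, p) \<otimes>\<^bsub>HA\<^esub> ar \<alpha>"
  using assms path_class_mult[of "head Q \<alpha>" p u "[\<alpha>]"] by (auto simp: ar_def dest: quiver_paths_last)

lemma ar_ev: "\<alpha> \<in> arcs Q \<Longrightarrow> ar \<alpha> \<otimes>\<^bsub>HA\<^esub> ev (tail Q \<alpha>) = ar \<alpha>"
  and ev_ar: "\<alpha> \<in> arcs Q \<Longrightarrow> ev (head Q \<alpha>) \<otimes>\<^bsub>HA\<^esub> ar \<alpha> = ar \<alpha>"
  by (simp_all add: ar_def ev_def path_class_mult)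

lemma ev_mult: "v \<in> verts Q \<Longrightarrow> w \<in> verts Q \<Longrightarrow> ev v \<otimes>\<^bsub>HA\<^esub> ev w = (if v = w then ev v else \<zero>\<^bsub>HA\<^esub>)"
  by (simp add: ev_def path_class_mult)

text \<open>A loop has square zero and any other arrow is caught between two orthogonal idempotents,
  so a character kills all arrows and with them all nontrivial paths. On the orthogonal idempotents
  of the vertices it takes the value 1 exactly once and is 0 elsewhere.\<close>

lemma character_is_\<chi>:
  assumes "character f"
  obtains v where "v \<in> verts Q" "f = \<chi> v"
proof -
  have f: "f \<in> dual" and f1: "f \<one>\<^bsub>HA\<^esub> = 1"
    and f_mult: "\<And>x y. x \<in> carrier HA \<Longrightarrow> y \<in> carrier HA \<Longrightarrow> f (x \<otimes>\<^bsub>HA\<^esub> y) = f x * f y"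
    using assms by (auto simp: character_def factors_def)
  have f_ar: "f (ar \<alpha>) = 0" if "\<alpha> \<in> arcs Q" for \<alpha>
  proof (cases "tail Q \<alpha> = head Q \<alpha>")
    case True
    then have "f (ar \<alpha>) * f (ar \<alpha>) = f \<zero>\<^bsub>HA\<^esub>"
      using that loop_square[OF that True] ar_mult_zero[of \<alpha> \<alpha>] by (simp add: f_mult[symmetric] composable_def)
    then show ?thesis using dual_zero[OF f] by simp
  next
    case False
    have "f (ev (head Q \<alpha>)) * f (ev (tail Q \<alpha>)) = 0"
      using f_mult[of "ev (head Q \<alpha>)" "ev (tail Q \<alpha>)"] that False dual_zero[OF f] by (simp add: ev_mult)
    moreover have "f (ar \<alpha>) = f (ar \<alpha>) * f (ev (tail Q \<alpha>))" "f (ar \<alpha>) = f (ev (head Q \<alpha>)) * f (ar \<alpha>)"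
      using f_mult[of "ar \<alpha>" "ev (tail Q \<alpha>)"] f_mult[of "ev (head Q \<alpha>)" "ar \<alpha>"] that by (simp_all add: ar_ev ev_ar)
    ultimately show ?thesis by (metis mult_eq_0_iff)
  qed
  have f_cons: "f (path_class (u, \<alpha> # p)) = 0" if "(u, \<alpha> # p) \<in> quiver_paths Q" for u \<alpha> p
    using that by (simp add: path_class_Cons f_mult f_ar)
  have "\<exists>v\<in>verts Q. f (ev v) \<noteq> 0"
  proof (rule ccontr)
    assume *: "\<not> (\<exists>v\<in>verts Q. f (ev v) \<noteq> 0)"
    \<comment> \<open>The zero functional is written as a multiple of \<open>f\<close>, which puts
      it into the dual; equality with \<open>f\<close> contradicts the value 1 at the unit.\<close>
    have "f (path_class x) = (0 * f (path_class x))" if "x \<in> quiver_paths Q" for x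
      using that * f_cons by (cases x; cases "snd x") (auto simp: ev_def)
    then have "f = (\<lambda>x. 0 * f x)"
      by (intro dual_path_eqI f dual_scale)
    then have "f \<one>\<^bsub>HA\<^esub> = 0 * f \<one>\<^bsub>HA\<^esub>" by (rule fun_cong)
    with f1 show False by simp
  qed
  then obtain v where v: "v \<in> verts Q" "f (ev v) \<noteq> 0" by blast
  then have fv: "f (ev v) = 1"
    using f_mult[of "ev v" "ev v"] by (simp add: ev_mult)
  have fw: "f (ev w) = 0" if "w \<in> verts Q" "w \<noteq> v" for w
    using f_mult[of "ev v" "ev w"] that v fv dual_zero[OF f] by (simp add: ev_mult)
  have "f = \<chi> v"
  proof (rule dual_path_eqI)
    fix x assume x: "x \<in> quiver_paths Q"
    then show "f (path_class x) = \<chi> v (path_class x)"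
      using v fv fw f_cons by (cases x; cases "snd x") (auto simp: \<chi>_path_class ev_def[symmetric])
  qed (use f v in auto)
  then show ?thesis using that v(1) by blast
qed

lemma \<chi>_inject: "v \<in> verts Q \<Longrightarrow> w \<in> verts Q \<Longrightarrow> \<chi> v = \<chi> w \<Longrightarrow> v = w"
  using \<chi>_ev[of v v] \<chi>_ev[of w v] by (metis zero_neq_one)

section \<open>The group of vertices\<close>

definition vmult :: "'v \<Rightarrow> 'v \<Rightarrow> 'v" (infixl \<open>\<diamondop>\<close> 70) where
  "u \<diamondop> w = (THE v. v \<in> verts Q \<and> \<chi> u \<star> \<chi> w = \<chi> v)"

lemma vmult:
  assumes "u \<in> verts Q" "w \<in> verts Q"
  shows "u \<diamondop> w \<in> verts Q" "\<chi> u \<star> \<chi> w = \<chi> (u \<diamondop> w)"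
proof -
  obtain v where v: "v \<in> verts Q" "\<chi> u \<star> \<chi> w = \<chi> v"
    using character_is_\<chi>[OF character_conv[OF character_\<chi> character_\<chi>]] assms by metis
  then have "u \<diamondop> w = v"
    unfolding vmult_def by (intro the_equality) (auto dest: \<chi>_inject)
  with v show "u \<diamondop> w \<in> verts Q" "\<chi> u \<star> \<chi> w = \<chi> (u \<diamondop> w)" by auto
qed

definition vone :: 'v where
  "vone = (SOME v. v \<in> verts Q \<and> unit = \<chi> v)"

lemma vone: "vone \<in> verts Q" "\<chi> vone = unit"
proof -
  obtain v where v: "v \<in> verts Q" "unit = \<chi> v"
    using character_is_\<chi>[OF character_unit] .
  then have "vone \<in> verts Q \<and> unit = \<chi> vone"
    unfolding vone_def by (intro someI[of "\<lambda>v. v \<in> verts Q \<and> unit = \<chi> v" v]) simp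
  then show "vone \<in> verts Q" "\<chi> vone = unit" by simp_all
qed

definition VG :: "'v monoid" where
  "VG = \<lparr>carrier = verts Q, monoid.mult = (\<diamondop>), one = vone\<rparr>"

lemma VG_simps [simp]: "carrier VG = verts Q" "x \<otimes>\<^bsub>VG\<^esub> y = x \<diamondop> y" "\<one>\<^bsub>VG\<^esub> = vone"
  by (simp_all add: VG_def)

text \<open>The convolution inverse of a character is only known as a functional. This still makes
  right translation injective, and finiteness of the vertex set then supplies left inverses.\<close>

lemma group_VG: "group VG"
proof (rule groupI)
  fix x y z assume "x \<in> carrier VG" "y \<in> carrier VG" "z \<in> carrier VG"
  then show "x \<otimes>\<^bsub>VG\<^esub> y \<otimes>\<^bsub>VG\<^esub> z = x \<otimes>\<^bsub>VG\<^esub> (y \<otimes>\<^bsub>VG\<^esub> z)"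
    using conv_assoc[of "\<chi> x" "\<chi> y" "\<chi> z"] by (intro \<chi>_inject) (auto simp: vmult)
next
  fix x assume x: "x \<in> carrier VG"
  then show "\<one>\<^bsub>VG\<^esub> \<otimes>\<^bsub>VG\<^esub> x = x"
    using unit_conv[of "\<chi> x"] by (intro \<chi>_inject) (auto simp: vmult(1) vone vmult(2)[symmetric])
  obtain f' where f': "f' \<in> dual" "\<chi> x \<star> f' = unit"
    using character_inverse[OF character_\<chi>[of x]] x by auto
  have "inj_on (\<lambda>w. w \<diamondop> x) (verts Q)"
  proof (rule inj_onI)
    fix v w assume vw: "v \<in> verts Q" "w \<in> verts Q" "v \<diamondop> x = w \<diamondop> x"
    then have "\<chi> v \<star> \<chi> x \<star> f' = \<chi> w \<star> \<chi> x \<star> f'"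
      using x by (simp add: vmult)
    then have "\<chi> v = \<chi> w"
      using vw(1,2) x f' by (simp add: conv_assoc conv_unit)
    with vw show "v = w" by (simp add: \<chi>_inject)
  qed
  then have "(\<lambda>w. w \<diamondop> x) ` verts Q = verts Q"
    using x by (intro endo_inj_surj) (auto simp: vmult)
  then have "vone \<in> (\<lambda>w. w \<diamondop> x) ` verts Q"
    using vone(1) by simp
  then show "\<exists>y\<in>carrier VG. y \<otimes>\<^bsub>VG\<^esub> x = \<one>\<^bsub>VG\<^esub>"
    by auto
qed (auto simp: vmult vone)

sublocale VG: group VG
  by (rule group_VG)

text \<open>Skew derivations of \<open>H\<close> are the skew primitive elements of the dual.\<close>

definition der :: "'v \<Rightarrow> 'v \<Rightarrow> (('v \<times> 'a list \<Rightarrow> 'k) set \<Rightarrow> 'k) \<Rightarrow> bool" where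
  "der s t d \<longleftrightarrow> factors d [(d, \<chi> t), (\<chi> s, d)]"

lemma der_dual: "der s t d \<Longrightarrow> d \<in> dual"
  by (simp add: der_def factors_def)

lemma der_mult: "der s t d \<Longrightarrow> x \<in> carrier HA \<Longrightarrow> y \<in> carrier HA \<Longrightarrow>
    d (x \<otimes>\<^bsub>HA\<^esub> y) = d x * \<chi> t y + \<chi> s x * d y"
  using factorsD(2)[of d] by (simp add: der_def)

lemma der_\<phi>: "\<alpha> \<in> arcs Q \<Longrightarrow> der (head Q \<alpha>) (tail Q \<alpha>) (\<phi> \<alpha>)"
  by (simp add: der_def factors_\<phi>)

lemma derI:
  assumes "s \<in> verts Q" "t \<in> verts Q" "d \<in> dual"
    and "\<And>x y. x \<in> carrier HA \<Longrightarrow> y \<in> carrier HA \<Longrightarrow> d (x \<otimes>\<^bsub>HA\<^esub> y) = d x * \<chi> t y + \<chi> s x * d y"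
  shows "der s t d"
  using assms by (simp add: der_def factors_def)

lemma der_add:
  assumes "s \<in> verts Q" "t \<in> verts Q" "der s t d" "der s t d'"
  shows "der s t (\<lambda>x. d x + d' x)"
  by (rule derI)
    (simp_all add: assms dual_add der_dual[OF assms(3)] der_dual[OF assms(4)]
      der_mult[OF assms(3)] der_mult[OF assms(4)] algebra_simps)

lemma der_scale:
  assumes "s \<in> verts Q" "t \<in> verts Q" "der s t d"
  shows "der s t (\<lambda>x. c * d x)"
  by (rule derI) (simp_all add: assms dual_scale der_dual[OF assms(3)] der_mult[OF assms(3)] algebra_simps)

lemma der_conv_left:
  assumes "der s t d" "u \<in> verts Q" "s \<in> verts Q" "t \<in> verts Q"
  shows "der (u \<diamondop> s) (u \<diamondop> t) (\<chi> u \<star> d)"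
  using factors_conv[OF factors_\<chi>[OF assms(2)] assms(1)[unfolded der_def]] assms(2-)
  by (simp add: der_def vmult)

lemma der_conv_right:
  assumes "der s t d" "u \<in> verts Q" "s \<in> verts Q" "t \<in> verts Q"
  shows "der (s \<diamondop> u) (t \<diamondop> u) (d \<star> \<chi> u)"
  using factors_conv[OF assms(1)[unfolded der_def] factors_\<chi>[OF assms(2)]] assms(2-)
  by (simp add: der_def vmult)

text \<open>An arrow does not change when multiplied by the idempotent of one of its ends. At an end
  that does not match, the derivation rule applied to this product leaves nothing.\<close>

lemma der_ar_other:
  assumes "der s t d" "s \<in> verts Q" "t \<in> verts Q" "\<alpha> \<in> arcs Q" "tail Q \<alpha> \<noteq> t \<or> head Q \<alpha> \<noteq> s"
  shows "d (ar \<alpha>) = 0"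
  using der_mult[OF assms(1), of "ar \<alpha>" "ev (tail Q \<alpha>)"] der_mult[OF assms(1), of "ev (head Q \<alpha>)" "ar \<alpha>"] assms
  by (auto simp: ar_ev ev_ar split: if_splits)

lemma inner_dual [simp]: "s \<in> verts Q \<Longrightarrow> t \<in> verts Q \<Longrightarrow> (\<lambda>x. c * (\<chi> s x - \<chi> t x)) \<in> dual"
  by (rule dual_scale, rule dual_diff) simp_all

text \<open>The derivation rule at orthogonal idempotents forces \<open>d\<close> to vanish at all
  vertices except \<open>s\<close> and \<open>t\<close> and to take opposite values at these two;
  for \<open>s = t\<close> it vanishes at every vertex. Without values at arrows this leaves an
  inner derivation, whose constant is the value at \<open>s\<close>.\<close>

lemma der_trivial:
  assumes d: "der s t d" and st: "s \<in> verts Q" "t \<in> verts Q" and ar: "\<And>\<alpha>. \<alpha> \<in> arcs Q \<Longrightarrow> d (ar \<alpha>) = 0"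
  obtains c where "d = (\<lambda>x. c * (\<chi> s x - \<chi> t x))"
proof
  have ev: "d (ev v) = d (ev s) * (\<chi> s (ev v) - \<chi> t (ev v))" if v: "v \<in> verts Q" for v
  proof (cases "s = t")
    case True
    have "d (ev v) = 0"
      using der_mult[OF d, of "ev v" "ev v"] v st True by (cases "v = t") (simp_all add: ev_mult)
    then show ?thesis using True by simp
  next
    case False
    have "d (ev s) + d (ev t) = 0"
      using der_mult[OF d, of "ev s" "ev t"] st False dual_zero[OF der_dual[OF d]] by (simp add: ev_mult)
    moreover have "v \<noteq> s \<Longrightarrow> v \<noteq> t \<Longrightarrow> d (ev v) = 0"
      using der_mult[OF d, of "ev v" "ev v"] v st by (auto simp: ev_mult)
    ultimately show ?thesis
      using v st False by (auto simp: add_eq_0_iff)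
  qed
  show "d = (\<lambda>x. d (ev s) * (\<chi> s x - \<chi> t x))"
  proof (rule dual_path_eqI)
    fix x assume x: "x \<in> quiver_paths Q"
    show "d (path_class x) = d (ev s) * (\<chi> s (path_class x) - \<chi> t (path_class x))"
    proof (cases x)
      case (Pair u p)
      show ?thesis
      proof (cases p)
        case Nil
        then show ?thesis using ev[of u] x Pair by (simp add: ev_def)
      next
        case (Cons \<alpha> q)
        then show ?thesis
          using x Pair st ar[of \<alpha>] by (simp add: \<chi>_path_class) (simp add: path_class_Cons der_mult[OF d])
      qed
    qed
  qed (simp_all add: der_dual[OF d] st)
qed

section \<open>Translation of skew derivations and arrows\<close>

lemma inv_vert [simp]: "u \<in> verts Q \<Longrightarrow> inv\<^bsub>VG\<^esub> u \<in> verts Q"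
  using VG.inv_closed[of u] by simp

lemma inv_vmult:
  "u \<in> verts Q \<Longrightarrow> inv\<^bsub>VG\<^esub> u \<diamondop> u = vone" "u \<in> verts Q \<Longrightarrow> u \<diamondop> inv\<^bsub>VG\<^esub> u = vone"
  using VG.l_inv[of u] VG.r_inv[of u] by simp_all

lemma vmult_inv_cancel: "v \<in> verts Q \<Longrightarrow> w \<in> verts Q \<Longrightarrow> v \<diamondop> inv\<^bsub>VG\<^esub> w \<diamondop> w = v"
  using VG.m_assoc[of v "inv\<^bsub>VG\<^esub> w" w] VG.r_one[of v] by (simp add: inv_vmult)

lemma conv_cancel:
  assumes "u \<in> verts Q" "d \<in> dual" shows "\<chi> (inv\<^bsub>VG\<^esub> u) \<star> (\<chi> u \<star> d) = d"
proof -
  have "\<chi> (inv\<^bsub>VG\<^esub> u) \<star> (\<chi> u \<star> d) = \<chi> (inv\<^bsub>VG\<^esub> u) \<star> \<chi> u \<star> d"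
    using assms by (simp add: conv_assoc)
  also have "\<dots> = d" using assms by (simp add: vmult inv_vmult vone unit_conv)
  finally show ?thesis .
qed

text \<open>Translation by a character acts faithfully on skew derivations modulo the inner ones.\<close>

lemma der_translate_trivial:
  assumes d: "der s t d" and st: "s \<in> verts Q" "t \<in> verts Q" "u \<in> verts Q"
    and "\<And>\<beta>. \<beta> \<in> arcs Q \<Longrightarrow> tail Q \<beta> = u \<diamondop> t \<Longrightarrow> head Q \<beta> = u \<diamondop> s \<Longrightarrow> (\<chi> u \<star> d) (ar \<beta>) = 0"
    and "\<alpha> \<in> arcs Q"
  shows "d (ar \<alpha>) = 0"
proof -
  let ?d = "\<chi> u \<star> d"
  note d' = der_conv_left[OF d st(3,1,2)]
  have "?d (ar \<beta>) = 0" if "\<beta> \<in> arcs Q" for \<beta>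
    using assms(5)[OF that] der_ar_other[OF d' _ _ that] st by (auto simp: vmult)
  then obtain c where c: "?d = (\<lambda>x. c * (\<chi> (u \<diamondop> s) x - \<chi> (u \<diamondop> t) x))"
    using der_trivial[OF d'] st by (metis vmult(1))
  then have "?d = (\<lambda>x. c * ((\<chi> u \<star> \<chi> s) x - (\<chi> u \<star> \<chi> t) x))"
    using st by (simp add: vmult)
  also have "\<dots> = \<chi> u \<star> (\<lambda>x. c * (\<chi> s x - \<chi> t x))"
    using st by (simp add: conv_scale_right conv_diff_right dual_diff)
  finally have "\<chi> (inv\<^bsub>VG\<^esub> u) \<star> ?d = \<chi> (inv\<^bsub>VG\<^esub> u) \<star> (\<chi> u \<star> (\<lambda>x. c * (\<chi> s x - \<chi> t x)))"
    by simp
  then have "d = (\<lambda>x. c * (\<chi> s x - \<chi> t x))"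
    using conv_cancel[OF st(3)] der_dual[OF d] st by simp
  then show ?thesis using st assms(6) by simp
qed

text \<open>The functional \<open>\<phi> \<alpha>\<close> has the value 1 at
  \<open>\<alpha>\<close>, so it is not inner and its translate cannot vanish at all arrows between
  the translated ends.\<close>

lemma translate_arc:
  assumes "\<alpha> \<in> arcs Q" "u \<in> verts Q"
  obtains \<beta> where "\<beta> \<in> arcs Q" "tail Q \<beta> = u \<diamondop> tail Q \<alpha>" "head Q \<beta> = u \<diamondop> head Q \<alpha>" "(\<chi> u \<star> \<phi> \<alpha>) (ar \<beta>) \<noteq> 0"
proof (rule ccontr)
  note witness = that
  assume "\<not> thesis"
  then have "(\<chi> u \<star> \<phi> \<alpha>) (ar \<beta>) = 0"
    if "\<beta> \<in> arcs Q" "tail Q \<beta> = u \<diamondop> tail Q \<alpha>" "head Q \<beta> = u \<diamondop> head Q \<alpha>" for \<beta>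
    using that witness by blast
  then have "\<phi> \<alpha> (ar \<alpha>) = 0"
    using der_translate_trivial[OF der_\<phi>[OF assms(1)] _ _ assms(2) _ assms(1)] assms(1) by simp
  then show False using assms(1) by simp
qed

text \<open>If a single arrow \<open>\<beta>\<close> left the translated vertex, both translates
  would be detected by their values at \<open>\<beta>\<close> alone, and some combination of the two
  functionals would have a trivial translate without being trivial itself.\<close>

lemma out_arcs_translate:
  assumes \<alpha>: "\<alpha> \<in> arcs Q" "\<alpha>' \<in> arcs Q" "\<alpha> \<noteq> \<alpha>'" "tail Q \<alpha> = t" "tail Q \<alpha>' = t" and u: "u \<in> verts Q"
  obtains \<beta> \<beta>' where "\<beta> \<in> arcs Q" "\<beta>' \<in> arcs Q" "\<beta> \<noteq> \<beta>'" "tail Q \<beta> = u \<diamondop> t" "tail Q \<beta>' = u \<diamondop> t"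
proof -
  obtain \<beta> where \<beta>: "\<beta> \<in> arcs Q" "tail Q \<beta> = u \<diamondop> t" "head Q \<beta> = u \<diamondop> head Q \<alpha>" "(\<chi> u \<star> \<phi> \<alpha>) (ar \<beta>) \<noteq> 0"
    using translate_arc[OF \<alpha>(1) u] \<alpha> by metis
  obtain \<beta>' where \<beta>': "\<beta>' \<in> arcs Q" "tail Q \<beta>' = u \<diamondop> t" "head Q \<beta>' = u \<diamondop> head Q \<alpha>'" "(\<chi> u \<star> \<phi> \<alpha>') (ar \<beta>') \<noteq> 0"
    using translate_arc[OF \<alpha>(2) u] \<alpha> by metis
  show thesis
  proof (cases "\<exists>\<gamma>\<in>arcs Q. tail Q \<gamma> = u \<diamondop> t \<and> \<gamma> \<noteq> \<beta>")
    case True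
    then show ?thesis using that \<beta> by metis
  next
    case False
    then have eq: "\<beta>' = \<beta>" using \<beta>' by blast
    let ?s = "head Q \<alpha>"
    \<comment> \<open>Both translates are nonzero at the same arrow, so cancellation in the group
      shows the two original arrows to be parallel. Their functionals obey the same derivation rule
      and can be combined.\<close>
    have "u \<diamondop> head Q \<alpha>' = u \<diamondop> ?s"
      using \<beta>(3) \<beta>'(3) unfolding eq by (rule trans[OF sym, rotated])
    then have "head Q \<alpha>' = ?s"
      using VG.l_cancel[of u "head Q \<alpha>'" ?s] \<alpha>(1,2) u by simp
    then have der: "der ?s t (\<phi> \<alpha>)" "der ?s t (\<phi> \<alpha>')"
      using der_\<phi>[OF \<alpha>(1)] der_\<phi>[OF \<alpha>(2)] \<alpha> by auto
    define c c' where "c = (\<chi> u \<star> \<phi> \<alpha>) (ar \<beta>)" "c' = (\<chi> u \<star> \<phi> \<alpha>') (ar \<beta>)"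
    \<comment> \<open>The coefficients make the translate of \<open>d\<close> vanish at
      \<open>\<beta>\<close>, whereas \<open>d\<close> takes the nonzero value \<open>c'\<close> at
      \<open>\<alpha>\<close>.\<close>
    define d where "d = (\<lambda>x. c' * \<phi> \<alpha> x + (- c) * \<phi> \<alpha>' x)"
    have t: "t \<in> verts Q" "?s \<in> verts Q" using \<alpha> by auto
    have "der ?s t d" unfolding d_def by (intro der_add der_scale der t)
    moreover have "\<chi> u \<star> d = (\<lambda>x. c' * (\<chi> u \<star> \<phi> \<alpha>) x + (- c) * (\<chi> u \<star> \<phi> \<alpha>') x)"
      using u \<alpha> by (simp only: d_def conv_add_right conv_scale_right \<phi>_dual \<chi>_dual dual_scale)
    then have "(\<chi> u \<star> d) (ar \<gamma>) = 0" if "\<gamma> \<in> arcs Q" "tail Q \<gamma> = u \<diamondop> t" for \<gamma>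
      using False that by (auto simp: c_c'_def)
    ultimately have "d (ar \<alpha>) = 0"
      using der_translate_trivial[of ?s t d u \<alpha>] t u \<alpha> by blast
    then have "c' = 0" using \<alpha> by (simp add: d_def)
    with \<beta>' eq show ?thesis by (simp add: c_c'_def)
  qed
qed

text \<open>Otherwise two arrows leave the head of every arrow, and by \<open>after_in\<close> at
  most one of them composes to zero with it. A nonzero continuation thus exists at every stage and
  yields an infinite good walk.\<close>

lemma unique_out_arc:
  assumes "\<alpha> \<in> arcs Q" "\<alpha>' \<in> arcs Q" "tail Q \<alpha> = tail Q \<alpha>'"
  shows "\<alpha> = \<alpha>'"
proof (rule ccontr)
  assume "\<alpha> \<noteq> \<alpha>'"
  define t where "t = tail Q \<alpha>"
  have "\<exists>\<gamma>. composable Q \<gamma> \<beta> \<and> path2_elem Q \<gamma> \<beta> \<notin> I" if \<beta>: "\<beta> \<in> arcs Q" for \<beta>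
  proof -
    \<comment> \<open>Translation by \<open>u\<close> takes the vertex with two outgoing arrows to
      the head of \<open>\<beta>\<close>.\<close>
    define u where "u = head Q \<beta> \<diamondop> inv\<^bsub>VG\<^esub> t"
    have t: "t \<in> verts Q" using assms by (simp add: t_def)
    have u: "u \<in> verts Q" using \<beta> t by (simp add: u_def vmult)
    have ut: "u \<diamondop> t = head Q \<beta>"
      using \<beta> t by (simp add: u_def vmult_inv_cancel)
    obtain \<gamma> \<gamma>' where \<gamma>: "\<gamma> \<in> arcs Q" "\<gamma>' \<in> arcs Q" "\<gamma> \<noteq> \<gamma>'" "tail Q \<gamma> = head Q \<beta>" "tail Q \<gamma>' = head Q \<beta>"
      using out_arcs_translate[OF assms(1,2) \<open>\<alpha> \<noteq> \<alpha>'\<close> _ _ u, of t] assms ut by (metis t_def)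
    let ?C = "{\<gamma>. composable Q \<gamma> \<beta> \<and> path2_elem Q \<gamma> \<beta> \<in> I}"
    have "finite ?C"
      by (rule finite_subset[OF _ finite_arcs]) (auto simp: composable_def)
    with after_in[OF \<beta>] \<gamma>(3) have "\<not> {\<gamma>, \<gamma>'} \<subseteq> ?C"
      using card_mono[of ?C "{\<gamma>, \<gamma>'}"] by auto
    then show ?thesis using \<gamma> \<beta> by (auto simp: composable_def)
  qed
  then obtain nx where nx: "\<And>\<beta>. \<beta> \<in> arcs Q \<Longrightarrow> composable Q (nx \<beta>) \<beta>" "\<And>\<beta>. \<beta> \<in> arcs Q \<Longrightarrow> path2_elem Q (nx \<beta>) \<beta> \<notin> I"
    by metis
  have arc: "(nx ^^ i) \<alpha> \<in> arcs Q" for i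
    by (induction i) (use assms nx(1) in \<open>auto simp: composable_def\<close>)
  show False
    using no_infinite_good_path[OF fin_dim, of "\<lambda>i. (nx ^^ i) \<alpha>"] nx arc by simp
qed

section \<open>The unique arrow leaving each vertex\<close>

definition arc_from :: "'v \<Rightarrow> 'a" where
  "arc_from v = (THE \<alpha>. \<alpha> \<in> arcs Q \<and> tail Q \<alpha> = v)"

definition gen :: 'v where
  "gen = head Q (arc_from vone)"

text \<open>Some arrow exists, and the left translation that takes its tail to \<open>v\<close>
  produces an arrow leaving \<open>v\<close>.\<close>

lemma ex_arc_from:
  assumes v: "v \<in> verts Q" shows "\<exists>\<alpha>\<in>arcs Q. tail Q \<alpha> = v"
proof -
  obtain \<alpha> where \<alpha>: "\<alpha> \<in> arcs Q" using has_arrow by blast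
  let ?t = "tail Q \<alpha>"
  have t: "?t \<in> verts Q" using \<alpha> by simp
  have "v \<diamondop> inv\<^bsub>VG\<^esub> ?t \<diamondop> ?t = v" by (rule vmult_inv_cancel[OF v t])
  then show ?thesis
    using translate_arc[OF \<alpha>, of "v \<diamondop> inv\<^bsub>VG\<^esub> ?t"] v t by (metis vmult(1) inv_vert)
qed

lemma arc_from:
  assumes "v \<in> verts Q"
  shows "arc_from v \<in> arcs Q" "tail Q (arc_from v) = v"
proof -
  have "\<exists>!\<alpha>. \<alpha> \<in> arcs Q \<and> tail Q \<alpha> = v"
    using ex_arc_from[OF assms] unique_out_arc by blast
  from theI'[OF this] show "arc_from v \<in> arcs Q" "tail Q (arc_from v) = v"
    by (simp_all add: arc_from_def)
qed

lemma arc_from_tail: "\<alpha> \<in> arcs Q \<Longrightarrow> arc_from (tail Q \<alpha>) = \<alpha>"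
  using arc_from[of "tail Q \<alpha>"] unique_out_arc by simp

lemma translate_arc_from:
  assumes "v \<in> verts Q" "u \<in> verts Q"
  shows "head Q (arc_from (u \<diamondop> v)) = u \<diamondop> head Q (arc_from v)"
    "(\<chi> u \<star> \<phi> (arc_from v)) (ar (arc_from (u \<diamondop> v))) \<noteq> 0"
  using translate_arc[OF arc_from(1)[OF assms(1)] assms(2)] arc_from[OF assms(1)] arc_from_tail by metis+

lemma gen_vert [simp]: "gen \<in> verts Q"
  using arc_from[OF vone(1)] by (simp add: gen_def)

lemma head_arc_from: "v \<in> verts Q \<Longrightarrow> head Q (arc_from v) = v \<diamondop> gen"
  using translate_arc_from(1)[OF vone(1), of v] VG.r_one[of v] by (simp add: gen_def)

lemma composable_iff: "v \<in> verts Q \<Longrightarrow> composable Q \<beta> (arc_from v) \<longleftrightarrow> \<beta> = arc_from (v \<diamondop> gen)"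
  using arc_from[of v] head_arc_from[of v] arc_from[of "v \<diamondop> gen"] arc_from_tail[of \<beta>] vmult(1)[of v gen]
  by (auto simp: composable_def)

text \<open>Some product of consecutive arrows vanishes, since the walk along the powers of
  \<open>gen\<close> cannot be good throughout. If another product did not vanish, its coefficient
  functional could be translated to the vanishing one. There its expansion leaves only a product of
  two translated arrow functionals, neither of which is zero.\<close>

lemma all_squares_zero:
  assumes "composable Q \<beta> \<alpha>"
  shows "path2_elem Q \<beta> \<alpha> \<in> I"
proof (rule ccontr)
  assume nz: "path2_elem Q \<beta> \<alpha> \<notin> I"
  define s where "s i = arc_from (gen [^]\<^bsub>VG\<^esub> (i::nat))" for i
  have gi: "gen [^]\<^bsub>VG\<^esub> (i::nat) \<in> verts Q" for i
    using VG.nat_pow_closed[of gen i] by simp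
  have "composable Q (s (Suc i)) (s i)" for i
    using gi[of i] by (simp add: s_def composable_iff)
  then obtain i where i: "path2_elem Q (s (Suc i)) (s i) \<in> I"
    using no_infinite_good_path[OF fin_dim, of s] by blast
  define v where "v = gen [^]\<^bsub>VG\<^esub> i"
  have v: "v \<in> verts Q" using gi by (simp add: v_def)
  have z: "path2_elem Q (arc_from (v \<diamondop> gen)) (arc_from v) \<in> I"
    using i by (simp add: s_def v_def)
  define w where "w = tail Q \<alpha>"
  have \<alpha>: "\<alpha> = arc_from w" "w \<in> verts Q"
    using assms arc_from_tail by (auto simp: w_def composable_def)
  have \<beta>: "\<beta> = arc_from (w \<diamondop> gen)" using assms \<alpha> composable_iff by simp
  \<comment> \<open>This \<open>u\<close> moves the nonzero product, which starts at
    \<open>w\<close>, onto the vanishing one, which starts at \<open>v\<close>.\<close>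
  define u where "u = v \<diamondop> inv\<^bsub>VG\<^esub> w"
  have u: "u \<in> verts Q" using v \<alpha> by (simp add: u_def vmult)
  have uw: "u \<diamondop> w = v"
    using v \<alpha> by (simp add: u_def vmult_inv_cancel)
  have uwg: "u \<diamondop> (w \<diamondop> gen) = v \<diamondop> gen"
    using u \<alpha> VG.m_assoc[of u w gen] uw by simp
  define \<psi> where "\<psi> = clip (path_coeff (tail Q \<alpha>, [\<alpha>, \<beta>]))"
  have "factors (\<chi> u \<star> \<psi>) [(\<chi> u \<star> \<psi>, \<chi> u \<star> \<chi> (tail Q \<alpha>)), (\<chi> u \<star> \<phi> \<beta>, \<chi> u \<star> \<phi> \<alpha>), (\<chi> u \<star> \<chi> (head Q \<beta>), \<chi> u \<star> \<psi>)]"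
    using factors_conv[OF factors_\<chi>[OF u] factors_path2[OF assms nz]] by (simp add: \<psi>_def)
  then have mult: "(\<chi> u \<star> \<psi>) (x \<otimes>\<^bsub>HA\<^esub> y) = (\<chi> u \<star> \<psi>) x * (\<chi> u \<star> \<chi> (tail Q \<alpha>)) y + (\<chi> u \<star> \<phi> \<beta>) x * (\<chi> u \<star> \<phi> \<alpha>) y
      + (\<chi> u \<star> \<chi> (head Q \<beta>)) x * (\<chi> u \<star> \<psi>) y" if "x \<in> carrier HA" "y \<in> carrier HA" for x y
    using factorsD(2) that by fastforce
  have \<psi>: "\<chi> u \<star> \<psi> \<in> dual"
    using u path_coeff_dual[OF good_path_two[OF assms nz]] by (simp add: \<psi>_def)
  let ?x = "ar (arc_from (v \<diamondop> gen))" and ?y = "ar (arc_from v)"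
  have xy: "?x \<in> carrier HA" "?y \<in> carrier HA" "?x \<otimes>\<^bsub>HA\<^esub> ?y = \<zero>\<^bsub>HA\<^esub>"
    using v z arc_from[of v] arc_from[of "v \<diamondop> gen"] by (auto simp: vmult composable_iff intro!: ar_mult_zero)
  \<comment> \<open>The two outer terms of the expansion drop out because characters are zero at
    arrows.\<close>
  have "(\<chi> u \<star> \<phi> \<beta>) ?x * (\<chi> u \<star> \<phi> \<alpha>) ?y = 0"
    using mult[OF xy(1,2)] xy(3) dual_zero[OF \<psi>] assms u v arc_from[of v] arc_from[of "v \<diamondop> gen"]
    by (simp add: vmult composable_def)
  moreover have "(\<chi> u \<star> \<phi> \<beta>) ?x \<noteq> 0" "(\<chi> u \<star> \<phi> \<alpha>) ?y \<noteq> 0"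
    using translate_arc_from(2)[of "w \<diamondop> gen" u] translate_arc_from(2)[of w u] u \<alpha> \<beta> uw uwg by (simp_all add: vmult)
  ultimately show False by simp
qed

text \<open>
  Modulo inner derivations, \<open>F\<close> anticommutes with the character \<open>\<chi> gen\<close> of order \<open>ord gen\<close>.
  This is read off from \<open>F \<star> F\<close> at a product of two consecutive arrows, which is zero.
\<close>

lemma even_ord_gen: "even (VG.ord gen)"
proof -
  define F where "F = \<phi> (arc_from vone)"
  define z where "z m = gen [^]\<^bsub>VG\<^esub> (m::nat)" for m
  have z [simp]: "z m \<in> verts Q" for m
    using VG.nat_pow_closed[of gen m] by (simp add: z_def)
  have z0: "z 0 = vone" by (simp add: z_def)
  have z_Suc: "z m \<diamondop> gen = z (Suc m)" "gen \<diamondop> z m = z (Suc m)" for m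
    using VG.nat_pow_Suc2[of gen m] by (simp_all add: z_def)
  have z1: "z 1 = gen" using VG.l_one[of gen] by (simp add: z_def)
  have F [simp]: "F \<in> dual" using arc_from[OF vone(1)] by (simp add: F_def)
  have derF: "der gen vone F"
    using der_\<phi>[of "arc_from vone"] arc_from[OF vone(1)] by (simp add: F_def gen_def)
  have prod0: "ar (arc_from gen) \<otimes>\<^bsub>HA\<^esub> ar (arc_from vone) = \<zero>\<^bsub>HA\<^esub>"
    using composable_iff[OF vone(1)] VG.l_one[of gen] all_squares_zero by (intro ar_mult_zero) auto
  have arcs: "arc_from gen \<in> arcs Q" "arc_from vone \<in> arcs Q"
    by (auto intro: arc_from vone)
  have FF: "factors (F \<star> F) [(F \<star> F, \<chi> vone \<star> \<chi> vone), (F \<star> \<chi> gen, \<chi> vone \<star> F),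
      (\<chi> gen \<star> F, F \<star> \<chi> vone), (\<chi> gen \<star> \<chi> gen, F \<star> F)]"
    using factors_conv[OF derF[unfolded der_def] derF[unfolded der_def]] by simp
  have "(F \<star> F) (ar (arc_from gen) \<otimes>\<^bsub>HA\<^esub> ar (arc_from vone)) = 0"
    using prod0 dual_zero[of "F \<star> F"] by simp
  moreover have unit_y: "unit (ar (arc_from vone)) = 0"
    using \<chi>_ar[OF vone(1) arcs(2)] by (simp add: vone(2))
  moreover have F_y: "F (ar (arc_from vone)) = 1"
    using arcs by (simp add: F_def)
  ultimately have anti: "(F \<star> \<chi> gen) (ar (arc_from gen)) + (\<chi> gen \<star> F) (ar (arc_from gen)) = 0"
    using factorsD(2)[OF FF, of "ar (arc_from gen)" "ar (arc_from vone)"] arcs vone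
    by (simp add: vone(2) vmult unit_conv unit_dual conv_unit unit_y F_y)
  \<comment> \<open>The anticommutator is a skew derivation whose ends only admit an arrow leaving
    \<open>gen\<close>. That arrow is unique, so \<open>anti\<close> already gives vanishing at all
    arrows, and the anticommutator is inner.\<close>
  obtain c where c: "(\<lambda>x. (F \<star> \<chi> gen) x + (\<chi> gen \<star> F) x) = (\<lambda>x. c * (\<chi> (z 2) x - \<chi> (z 1) x))"
  proof (rule der_trivial)
    have v: "gen \<diamondop> gen = z 2" "vone \<diamondop> gen = z 1" "gen \<diamondop> vone = z 1"
      using z_Suc(1)[of 1] z1 VG.l_one[of gen] VG.r_one[of gen] by (simp_all add: numeral_2_eq_2)
    show der: "der (z 2) (z 1) (\<lambda>x. (F \<star> \<chi> gen) x + (\<chi> gen \<star> F) x)"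
      using der_conv_right[OF derF, of gen] der_conv_left[OF derF, of gen] vone v by (intro der_add) auto
    show "(F \<star> \<chi> gen) (ar \<alpha>) + (\<chi> gen \<star> F) (ar \<alpha>) = 0" if "\<alpha> \<in> arcs Q" for \<alpha>
    proof (cases "tail Q \<alpha> = gen")
      case True
      then have "\<alpha> = arc_from gen" using arc_from_tail[OF that] by simp
      with anti show ?thesis by simp
    next
      case False
      then show ?thesis using der_ar_other[OF der _ _ that] z1 by simp
    qed
  qed auto
  have step: "F \<star> \<chi> gen = (\<lambda>x. - (\<chi> gen \<star> F) x + c * (\<chi> (z 2) x - \<chi> (z 1) x))"
    using c by (simp add: fun_eq_iff eq_diff_eq algebra_simps)
  \<comment> \<open>Each passage of \<open>F\<close> past a further factor \<open>\<chi> gen\<close>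
    contributes a sign and an inner term; the inner terms collect in \<open>b\<close>.\<close>
  have "\<exists>b. F \<star> \<chi> (z m) = (\<lambda>x. (- 1) ^ m * (\<chi> (z m) \<star> F) x + b * (\<chi> (z (Suc m)) x - \<chi> (z m) x))" for m
  proof (induction m)
    case 0
    show ?case by (rule exI[of _ 0]) (simp add: z0 vone unit_conv conv_unit)
  next
    case (Suc m)
    then obtain b where b: "F \<star> \<chi> (z m) = (\<lambda>x. (- 1) ^ m * (\<chi> (z m) \<star> F) x + b * (\<chi> (z (Suc m)) x - \<chi> (z m) x))"
      by blast
    have zz: "\<chi> (z k) \<star> \<chi> gen = \<chi> (z (Suc k))" "\<chi> (z k) \<star> \<chi> (z l) = \<chi> (z (k + l))" for k l
      using VG.nat_pow_mult[of gen k l] by (simp_all add: vmult z_Suc) (simp add: z_def)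
    have mid: "\<chi> (z m) \<star> F \<star> \<chi> gen = (\<lambda>x. - (\<chi> (z (Suc m)) \<star> F) x + c * (\<chi> (z (Suc (Suc m))) x - \<chi> (z (Suc m)) x))"
    proof -
      have "\<chi> (z m) \<star> F \<star> \<chi> gen = \<chi> (z m) \<star> (\<lambda>x. (- 1) * (\<chi> gen \<star> F) x + c * (\<chi> (z 2) x - \<chi> (z 1) x))"
        by (simp add: conv_assoc step)
      also have "\<dots> = (\<lambda>x. (- 1) * (\<chi> (z m) \<star> (\<chi> gen \<star> F)) x + c * ((\<chi> (z m) \<star> \<chi> (z 2)) x - (\<chi> (z m) \<star> \<chi> (z 1)) x))"
        by (simp only: conv_add_right conv_scale_right conv_diff_right dual_scale dual_diff conv_dual \<chi>_dual F gen_vert z)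
      finally show ?thesis
        by (simp add: conv_assoc[symmetric] zz)
    qed
    have "F \<star> \<chi> (z (Suc m)) = (F \<star> \<chi> (z m)) \<star> \<chi> gen"
      by (simp add: conv_assoc zz)
    also have "\<dots> = (\<lambda>x. (- 1) ^ m * (\<chi> (z m) \<star> F \<star> \<chi> gen) x + b * ((\<chi> (z (Suc m)) \<star> \<chi> gen) x - (\<chi> (z m) \<star> \<chi> gen) x))"
      by (simp only: b conv_add_left conv_scale_left conv_diff_left dual_scale dual_diff conv_dual \<chi>_dual F gen_vert z)
    also have "\<dots> = (\<lambda>x. (- 1) ^ Suc m * (\<chi> (z (Suc m)) \<star> F) x + (b + (- 1) ^ m * c) * (\<chi> (z (Suc (Suc m))) x - \<chi> (z (Suc m)) x))"
      by (simp add: mid zz algebra_simps)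
    finally show ?case by blast
  qed
  then obtain b where b: "F \<star> \<chi> (z (VG.ord gen)) =
      (\<lambda>x. (- 1) ^ VG.ord gen * (\<chi> (z (VG.ord gen)) \<star> F) x + b * (\<chi> (z (Suc (VG.ord gen))) x - \<chi> (z (VG.ord gen)) x))"
    by blast
  have zn: "z (VG.ord gen) = vone"
    using VG.pow_ord_eq_1[of gen] by (simp add: z_def)
  have "F = (\<lambda>x. (- 1) ^ VG.ord gen * F x + b * (\<chi> (z (Suc (VG.ord gen))) x - \<chi> vone x))"
    using b[unfolded zn] by (simp add: vone unit_conv conv_unit)
  then have "F (ar (arc_from vone)) = (- 1) ^ VG.ord gen * F (ar (arc_from vone)) +
      b * (\<chi> (z (Suc (VG.ord gen))) (ar (arc_from vone)) - \<chi> vone (ar (arc_from vone)))"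
    by (rule fun_cong)
  \<comment> \<open>Characters vanish at the arrow leaving the identity, so only the two values of
    \<open>F\<close> remain to be compared.\<close>
  then have "(1 :: 'k) = (- 1) ^ VG.ord gen"
    using arcs vone(1) by (simp add: F_def)
  then show ?thesis
    by (cases "even (VG.ord gen)") auto
qed

end


section \<open>Disjoint unions of basic cycles\<close>

text \<open>The labels come from the orbits of \<open>c\<close>, which all have \<open>n\<close>
  elements. A vertex is coded by the number of its orbit and by the exponent of \<open>c\<close>
  that reaches it from a chosen point of the orbit, an arrow by the code of its tail.\<close>

lemma (in wf_digraph) union_of_basic_cyclesI:
  assumes fin: "finite (verts G)" and ne: "verts G \<noteq> {}" and n: "n \<ge> 1"
    and out: "\<And>v. v \<in> verts G \<Longrightarrow> \<exists>!\<alpha>. \<alpha> \<in> arcs G \<and> tail G \<alpha> = v"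
    and c: "\<And>\<alpha>. \<alpha> \<in> arcs G \<Longrightarrow> head G \<alpha> = c (tail G \<alpha>)"
    and period: "\<And>v. v \<in> verts G \<Longrightarrow> (c ^^ n) v = v"
      "\<And>v i. v \<in> verts G \<Longrightarrow> 0 < i \<Longrightarrow> i < n \<Longrightarrow> (c ^^ i) v \<noteq> v"
  shows "union_of_basic_cycles n G"
proof -
  have c_closed: "c v \<in> verts G" if "v \<in> verts G" for v
    using out[OF that] c by (metis head_in_verts)
  have ci: "(c ^^ i) v \<in> verts G" if "v \<in> verts G" for i v
    using that by (induction i) (auto intro: c_closed)
  have inj: "i = j" if "v \<in> verts G" "i < n" "j < n" "(c ^^ i) v = (c ^^ j) v" for v i j
  proof -
    have False if ij: "i < j" "j < n" "(c ^^ i) v = (c ^^ j) v" for i j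
    proof -
      \<comment> \<open>Applying \<open>c\<close> another \<open>n - j\<close> times turns a
        coincidence into a period shorter than \<open>n\<close>.\<close>
      have "(c ^^ (n - j + i)) v = (c ^^ (n - j + j)) v"
        using ij(3) by (simp add: funpow_add)
      then have "(c ^^ (n - j + i)) v = v"
        using ij period(1)[OF \<open>v \<in> _\<close>] by simp
      moreover have "0 < n - j + i" "n - j + i < n" using ij by auto
      ultimately show False using period(2)[OF \<open>v \<in> _\<close>, of "n - j + i"] by simp
    qed
    from this[of i j] this[of j i] that show ?thesis
      by (cases i j rule: linorder_cases) simp_all
  qed
  define orb where "orb v = (\<lambda>i. (c ^^ i) v) ` {..<n}" for v
  have c_orb: "orb (c v) = orb v" if v: "v \<in> verts G" for v
  proof -
    have "(c ^^ i) (c v) = (c ^^ (Suc i mod n)) v" if "i < n" for i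
    proof (cases "Suc i < n")
      case False
      then have "Suc i = n" using that by simp
      moreover have "(c ^^ i) (c v) = (c ^^ Suc i) v" by (simp only: funpow_Suc_right o_apply)
      ultimately show ?thesis using period(1)[OF v] by simp
    qed (simp add: funpow_swap1)
    then have "orb (c v) = (\<lambda>i. (c ^^ i) v) ` (\<lambda>i. Suc i mod n) ` {..<n}"
      by (auto simp: orb_def image_image)
    also have "(\<lambda>i. Suc i mod n) ` {..<n} = {..<n}"
    proof (rule endo_inj_surj)
      show "inj_on (\<lambda>i. Suc i mod n) {..<n}"
        by (rule inj_onI) (auto simp: mod_Suc split: if_splits)
    qed (use n in auto)
    finally show ?thesis by (simp add: orb_def)
  qed
  have ci_orb: "orb ((c ^^ i) v) = orb v" if "v \<in> verts G" for i v
    by (induction i) (use that ci c_orb in auto)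
  have self: "v \<in> orb v" for v
    unfolding orb_def using n by (intro image_eqI[of _ _ 0]) auto
  \<comment> \<open>The point is chosen from the orbit as a set, hence is the same for all vertices
    of that orbit.\<close>
  define r where "r v = (SOME w. w \<in> orb v)" for v
  have r_orb: "r v \<in> orb v" for v
    unfolding r_def using self by (rule someI)
  have r_vert: "r v \<in> verts G" if "v \<in> verts G" for v
    using r_orb[of v] that ci by (auto simp: orb_def)
  have orb_r: "orb (r v) = orb v" if "v \<in> verts G" for v
  proof -
    obtain i where "r v = (c ^^ i) v" using r_orb[of v] by (auto simp: orb_def)
    then show ?thesis using ci_orb[OF that] by simp
  qed
  have r_r: "r (r v) = r v" if "v \<in> verts G" for v
    using orb_r[OF that] by (simp add: r_def)
  have r_ci: "r ((c ^^ i) v) = r v" if "v \<in> verts G" for v i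
    using ci_orb[OF that] by (simp add: r_def)
  define pos where "pos v = (THE i. i < n \<and> v = (c ^^ i) (r v))" for v
  have pos_eq: "pos v = i" if "v \<in> verts G" "i < n" "v = (c ^^ i) (r v)" for v i
    unfolding pos_def using that inj[OF r_vert[OF that(1)]] by (intro the_equality) auto
  have pos: "pos v < n" "v = (c ^^ pos v) (r v)" if v: "v \<in> verts G" for v
  proof -
    have "v \<in> orb (r v)" using orb_r[OF v] self by simp
    then obtain i where "i < n" "v = (c ^^ i) (r v)" by (auto simp: orb_def)
    with pos_eq[OF v this] show "pos v < n" "v = (c ^^ pos v) (r v)" by auto
  qed
  obtain h where h: "bij_betw h (r ` verts G) {0..<card (r ` verts G)}"
    using ex_bij_betw_finite_nat fin by blast
  let ?S = "{0..<card (r ` verts G)}"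
  define f where "f v = (h (r v), pos v)" for v
  have f_inj: "inj_on f (verts G)"
  proof (rule inj_onI)
    fix v w assume vw: "v \<in> verts G" "w \<in> verts G" "f v = f w"
    then have "r v = r w"
      using h by (auto simp: f_def bij_betw_def dest: inj_onD)
    then show "v = w" using pos(2)[OF vw(1)] pos(2)[OF vw(2)] vw(3) by (simp add: f_def)
  qed
  have f_img: "f ` verts G = ?S \<times> {..<n}"
  proof (intro equalityI subsetI)
    fix x assume "x \<in> f ` verts G"
    then show "x \<in> ?S \<times> {..<n}" using h pos(1) by (auto simp: f_def bij_betw_def)
  next
    fix x assume "x \<in> ?S \<times> {..<n}"
    moreover obtain j i where x: "x = (j, i)" by (cases x)
    ultimately have j: "j \<in> ?S" and i: "i < n" by auto
    have "j \<in> h ` r ` verts G"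
      using h j by (simp add: bij_betw_def)
    then obtain u where u: "u \<in> verts G" "j = h (r u)"
      by blast
    let ?v = "(c ^^ i) (r u)"
    have v: "?v \<in> verts G" using ci r_vert u by simp
    have "r ?v = r u" using r_ci[OF r_vert[OF u(1)]] r_r[OF u(1)] by simp
    then have "f ?v = x" using pos_eq[OF v i] u x by (simp add: f_def)
    with v show "x \<in> f ` verts G" by blast
  qed
  have f_c: "f (c v) = (fst (f v), Suc (snd (f v)) mod n)" if v: "v \<in> verts G" for v
  proof -
    have r: "r (c v) = r v" using r_ci[OF v, of 1] by simp
    have cv: "c v = (c ^^ Suc (pos v)) (r v)" using pos(2)[OF v] by simp
    have "c v = (c ^^ (Suc (pos v) mod n)) (r v)"
    proof (cases "Suc (pos v) < n")
      case False
      then have "Suc (pos v) = n" using pos(1)[OF v] by simp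
      then show ?thesis using cv period(1)[OF r_vert[OF v]] by simp
    qed (use cv in simp)
    then have "pos (c v) = Suc (pos v) mod n"
      using n r by (intro pos_eq c_closed v) auto
    then show ?thesis by (simp add: f_def r)
  qed
  \<comment> \<open>The image digraph takes its tail and head maps from the isomorphism, so the maps
    of the disjoint union are put in here.\<close>
  define iso where "iso = \<lparr>iso_verts = f, iso_arcs = (\<lambda>\<alpha>. f (tail G \<alpha>)),
    iso_head = (\<lambda>(i, e). (i, Suc e mod n)), iso_tail = (\<lambda>x. x)\<rparr>"
  have tail_inj: "inj_on (tail G) (arcs G)"
    by (rule inj_onI) (use out tail_in_verts in blast)
  have tail_img: "tail G ` arcs G = verts G"
    using out by (auto simp: image_iff) blast
  have "digraph_isomorphism iso"
    unfolding digraph_isomorphism_def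
  proof (intro conjI ballI)
    show "inj_on (iso_arcs iso) (arcs G)"
      using comp_inj_on[OF tail_inj] f_inj tail_img by (simp add: iso_def o_def)
  qed (use f_inj c f_c in \<open>auto simp: iso_def wf_digraph case_prod_beta\<close>)
  moreover have "disjoint_union ?S (\<lambda>_. basic_cycle n) = app_iso iso G"
  proof -
    have "(\<lambda>\<alpha>. f (tail G \<alpha>)) ` arcs G = ?S \<times> {..<n}"
      using f_img tail_img by (metis image_image)
    then show ?thesis
      using f_img by (auto simp: disjoint_union_def basic_cycle_def app_iso_def iso_def)
  qed
  ultimately have "digraph_iso G (disjoint_union ?S (\<lambda>_. basic_cycle n))"
    unfolding digraph_iso_def by blast
  moreover have "?S \<noteq> {}"
    using ne fin by (simp add: card_gt_0_iff)
  ultimately show ?thesis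
    unfolding union_of_basic_cycles_def using n by (metis finite_atLeastLessThan)
qed

text \<open>The index set of the cycles is renumbered to an initial segment, so that labels can be
  matched with pairs of residues. Tails and heads are read off from the equation between the two
  records.\<close>

lemma union_of_basic_cyclesE:
  assumes "union_of_basic_cycles n Q"
  obtains d f g where "n \<ge> 1" "d \<ge> (1 :: nat)"
    "bij_betw f (verts Q) ({..<d} \<times> {..<n})" "bij_betw g (arcs Q) ({..<d} \<times> {..<n})"
    "\<And>\<alpha>. \<alpha> \<in> arcs Q \<Longrightarrow> f (tail Q \<alpha>) = g \<alpha>"
    "\<And>\<alpha>. \<alpha> \<in> arcs Q \<Longrightarrow> f (head Q \<alpha>) = (fst (g \<alpha>), Suc (snd (g \<alpha>)) mod n)"
proof -
  obtain S :: "nat set" and h where n: "n \<ge> 1" and S: "finite S" "S \<noteq> {}"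
    and h: "pre_digraph.digraph_isomorphism Q h" and eq: "disjoint_union S (\<lambda>_. basic_cycle n) = app_iso h Q"
    using assms by (auto simp: union_of_basic_cycles_def digraph_iso_def)
  obtain b where b: "bij_betw b S {0..<card S}"
    using ex_bij_betw_finite_nat S by blast
  let ?p = "map_prod b id :: nat \<times> nat \<Rightarrow> _"
  have p: "bij_betw ?p (S \<times> {..<n}) ({..<card S} \<times> {..<n})"
    using b by (intro bij_betw_map_prod) (auto simp: lessThan_atLeast0)
  have V: "bij_betw (iso_verts h) (verts Q) (S \<times> {..<n})"
    using h arg_cong[OF eq, of verts]
    by (auto simp: bij_betw_def pre_digraph.digraph_isomorphism_def disjoint_union_def basic_cycle_def)
  have A: "bij_betw (iso_arcs h) (arcs Q) (S \<times> {..<n})"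
    using h arg_cong[OF eq, of arcs]
    by (auto simp: bij_betw_def pre_digraph.digraph_isomorphism_def disjoint_union_def basic_cycle_def)
  have t: "iso_tail h = (\<lambda>x. x)"
    using arg_cong[OF eq, of tail] by (auto simp: disjoint_union_def basic_cycle_def)
  have hd: "iso_head h = (\<lambda>(i, e). (i, Suc e mod n))"
    using arg_cong[OF eq, of head] by (auto simp: disjoint_union_def basic_cycle_def)
  have arc: "iso_verts h (tail Q \<alpha>) = iso_arcs h \<alpha>"
    "iso_verts h (head Q \<alpha>) = (fst (iso_arcs h \<alpha>), Suc (snd (iso_arcs h \<alpha>)) mod n)" if "\<alpha> \<in> arcs Q" for \<alpha>
    using h that by (auto simp: pre_digraph.digraph_isomorphism_def t hd case_prod_beta)
  show ?thesis
  proof (rule that[of "card S" "?p \<circ> iso_verts h" "?p \<circ> iso_arcs h"])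
    show "card S \<ge> 1" using S by (simp add: Suc_le_eq card_gt_0_iff)
  qed (use n arc bij_betw_trans[OF V p] bij_betw_trans[OF A p] in auto)
qed


section \<open>The square of the arrow ideal\<close>

context gentle_quiver
begin

lemma arrow_elem_closed: "arrow_elem Q ` arcs Q \<subseteq> carrier PQ"
  by (auto simp: arrow_elem_def)

lemma ideal_arrow_ideal: "ideal (arrow_ideal Q) PQ"
  unfolding arrow_ideal_def by (rule P.genideal_ideal[OF arrow_elem_closed])

lemma arrow_elem_in: "\<alpha> \<in> arcs Q \<Longrightarrow> (arrow_elem Q \<alpha> :: 'v \<times> 'a list \<Rightarrow> 'k) \<in> arrow_ideal Q"
  unfolding arrow_ideal_def using P.genideal_self[OF arrow_elem_closed] by blast

lemma path2_in_square:
  assumes "composable Q \<beta> \<alpha>"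
  shows "path2_elem Q \<beta> \<alpha> \<in> arrow_ideal Q \<cdot>\<^bsub>PQ\<^esub> arrow_ideal Q"
proof -
  have "path2_elem Q \<beta> \<alpha> = arrow_elem Q \<beta> \<otimes>\<^bsub>PQ\<^esub> arrow_elem Q \<alpha>"
    using assms by (simp add: path2_elem_def arrow_elem_def path_algebra_delta_mult composable_def)
  then show ?thesis
    using assms by (auto simp: composable_def intro: ideal_prod.prod arrow_elem_in)
qed

text \<open>Vanishing at all trivial paths defines an ideal, and this ideal contains the
  arrows.\<close>

lemma arrow_ideal_vertex:
  fixes f :: "'v \<times> 'a list \<Rightarrow> 'k"
  assumes "f \<in> arrow_ideal Q" "u \<in> verts Q" shows "f (u, []) = 0"
proof -
  define N :: "('v \<times> 'a list \<Rightarrow> 'k) set"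
    where "N = {f \<in> carrier PQ. \<forall>x\<in>(\<lambda>u. (u, [])) ` verts Q. f x = 0}"
  have "ideal N PQ"
    unfolding N_def by (rule ideal_vanishing) auto
  moreover have "arrow_elem Q ` arcs Q \<subseteq> N"
    using arrow_elem_closed by (auto simp: N_def) (auto simp: arrow_elem_def delta_def)
  ultimately have "arrow_ideal Q \<subseteq> N"
    unfolding arrow_ideal_def by (rule P.genideal_minimal)
  with assms show ?thesis by (auto simp: N_def)
qed

text \<open>Generators of \<open>I\<close> are products of two arrows, which gives one inclusion.
  For the other, an element of the square has no coefficients at paths of length at most one, since
  each cut of such a path leaves a trivial part, and every longer path begins with a word from
  \<open>I\<close>.\<close>

lemma ideal_eq_square:
  assumes all: "\<And>\<beta> \<alpha>. composable Q \<beta> \<alpha> \<Longrightarrow> path2_elem Q \<beta> \<alpha> \<in> I"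
  shows "I = arrow_ideal Q \<cdot>\<^bsub>PQ\<^esub> arrow_ideal Q"
proof
  have "Idl\<^bsub>PQ\<^esub> ((\<lambda>(\<beta>, \<alpha>). path2_elem Q \<beta> \<alpha>) ` relations) \<subseteq> arrow_ideal Q \<cdot>\<^bsub>PQ\<^esub> arrow_ideal Q"
    by (rule P.genideal_minimal[OF P.ideal_prod_is_ideal[OF ideal_arrow_ideal ideal_arrow_ideal]])
      (use relations(1) path2_in_square in auto)
  then show "I \<subseteq> arrow_ideal Q \<cdot>\<^bsub>PQ\<^esub> arrow_ideal Q"
    by (subst relations(2))
next
  show "arrow_ideal Q \<cdot>\<^bsub>PQ\<^esub> arrow_ideal Q \<subseteq> I"
  proof
    fix f assume f: "f \<in> arrow_ideal Q \<cdot>\<^bsub>PQ\<^esub> arrow_ideal Q"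
    have J: "f \<in> carrier PQ" if "f \<in> arrow_ideal Q" for f :: "'v \<times> 'a list \<Rightarrow> 'k"
      using ideal.Icarr[OF ideal_arrow_ideal that] .
    have J0: "f (u, []) = 0" if "f \<in> arrow_ideal Q" for f :: "'v \<times> 'a list \<Rightarrow> 'k" and u
      using arrow_ideal_vertex[OF that, of u] J[OF that] by (cases "u \<in> verts Q") (auto simp: FP.carrier_eq finsupp_def)
    have "f \<in> carrier PQ \<and> (\<forall>u p. length p \<le> 1 \<longrightarrow> f (u, p) = 0)"
      using f
    proof (induction f rule: ideal_prod.induct)
      case (prod i j)
      have "(i \<otimes>\<^bsub>PQ\<^esub> j) (u, p) = 0" if "length p \<le> 1" for u p
        unfolding path_algebra_mult
      proof (rule sum.neutral, rule ballI)
        fix k assume "k \<in> {..length p}"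
        then have "drop k p = [] \<or> take k p = []" using that by (cases k) auto
        then show "i (awlast u (take k p), drop k p) * j (u, take k p) = 0"
          using J0 prod by auto
      qed
      then show ?case using prod J by (simp add: P.m_closed)
    next
      case (sum s1 s2)
      then show ?case using P.a_closed by (simp add: FP.add_eq)
    qed
    then have "f \<in> finsupp {x \<in> quiver_paths Q. length (snd x) \<ge> 2}"
      by (force simp: FP.carrier_eq finsupp_def not_less_eq_eq)
    then show "f \<in> I"
    proof (induction f rule: finsupp_induct)
      case zero
      then show ?case using H.zero_closed by (simp add: FP.zero_eq)
    next
      case (add f c s)
      then obtain u \<alpha> \<beta> p where s: "s = (u, \<alpha> # \<beta> # p)"
        by (cases s; cases "snd s"; cases "tl (snd s)") (auto simp: numeral_2_eq_2)
      then have comp: "composable Q \<beta> \<alpha>" and path: "(head Q \<beta>, p) \<in> quiver_paths Q"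
        using add(2) by (auto simp: composable_def)
      \<comment> \<open>The path is traversed starting with \<open>\<alpha>\<close>, so the word
        \<open>\<beta>\<alpha>\<close> is its right factor.\<close>
      have "delta s = delta (head Q \<beta>, p) \<otimes>\<^bsub>PQ\<^esub> (path2_elem Q \<beta> \<alpha> :: 'v \<times> 'a list \<Rightarrow> 'k)"
        using s add(2) by (auto simp: path2_elem_def path_algebra_delta_mult)
      then have "delta s \<in> I"
        using H.I_l_closed[OF all[OF comp]] path by simp
      then have "f \<oplus>\<^bsub>PQ\<^esub> c \<odot>\<^bsub>PQ\<^esub> delta s \<in> I"
        using add(3) H.ideal_smult by (intro H.a_closed)
      then show ?case by (simp add: FP.add_eq FP.smult_eq)
    qed
  qed
qed

end


section \<open>Hopf structures from a dual basis\<close>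

lemma alg_homI:
  assumes "linear_map A B f"
    and "\<And>x y. x \<in> carrier A \<Longrightarrow> y \<in> carrier A \<Longrightarrow> f (x \<otimes>\<^bsub>A\<^esub> y) = f x \<otimes>\<^bsub>B\<^esub> f y"
    and "f \<one>\<^bsub>A\<^esub> = \<one>\<^bsub>B\<^esub>"
  shows "f \<in> alg_hom A B"
proof -
  interpret f: linear_map A B f by fact
  show ?thesis
    by (simp add: alg_hom_def f.in_lin_map) (rule ring_hom_memI, simp_all only: f.closed f.add assms)
qed

text \<open>The quiver is abstracted to a basis indexed by the vertices (\<open>False\<close>) and
  the arrows leaving them (\<open>True\<close>), where \<open>z\<close> steps along an arrow. The
  two product rules make the vertex functionals group-like and the arrow functionals skew primitive.
  The character \<open>\<sigma>\<close> twists the product to be put on the dual, and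
  \<open>\<sigma>_z\<close> makes that product compatible with these rules.\<close>

locale skew_dual_basis = algebra_dual H + G: comm_group G
  for H :: "('k::field, 'h) module" (structure) and G :: "'g monoid" +
  fixes b :: "'g \<times> bool \<Rightarrow> 'h" and f :: "'g \<times> bool \<Rightarrow> 'h \<Rightarrow> 'k" and z :: 'g and \<sigma> :: "'g \<Rightarrow> 'k"
  assumes finite_G: "finite (carrier G)"
    and z_closed [simp]: "z \<in> carrier G"
    and \<sigma>_mult: "u \<in> carrier G \<Longrightarrow> v \<in> carrier G \<Longrightarrow> \<sigma> (u \<otimes>\<^bsub>G\<^esub> v) = \<sigma> u * \<sigma> v"
    and \<sigma>_square: "u \<in> carrier G \<Longrightarrow> \<sigma> u * \<sigma> u = 1"
    and \<sigma>_z: "\<sigma> z = - 1"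
    and b_closed [simp]: "fst i \<in> carrier G \<Longrightarrow> b i \<in> carrier H"
    and f_dual [simp]: "fst i \<in> carrier G \<Longrightarrow> f i \<in> dual"
    and f_b: "fst i \<in> carrier G \<Longrightarrow> fst j \<in> carrier G \<Longrightarrow> f i (b j) = (if i = j then 1 else 0)"
    and expand: "x \<in> carrier H \<Longrightarrow> x = (\<Oplus>i\<in>carrier G \<times> UNIV. f i x \<odot> b i)"
    and f_mult_False: "u \<in> carrier G \<Longrightarrow> x \<in> carrier H \<Longrightarrow> y \<in> carrier H \<Longrightarrow>
      f (u, False) (x \<otimes> y) = f (u, False) x * f (u, False) y"
    and f_mult_True: "u \<in> carrier G \<Longrightarrow> x \<in> carrier H \<Longrightarrow> y \<in> carrier H \<Longrightarrow>
      f (u, True) (x \<otimes> y) = f (u, True) x * f (u, False) y + f (z \<otimes>\<^bsub>G\<^esub> u, False) x * f (u, True) y"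
    and f_one: "fst i \<in> carrier G \<Longrightarrow> f i \<one> = (if snd i then 0 else 1)"
begin

abbreviation J :: "('g \<times> bool) set" where
  "J \<equiv> carrier G \<times> UNIV"

text \<open>
  The convolution product prescribed on the dual basis: \<open>f i * f j = \<kappa> i j * f (i \<bullet> j)\<close>.
\<close>

definition \<kappa> :: "'g \<times> bool \<Rightarrow> 'g \<times> bool \<Rightarrow> 'k" where
  "\<kappa> i j = (if snd i \<and> snd j then 0 else if snd j then \<sigma> (fst i) else 1)"

definition jmult :: "'g \<times> bool \<Rightarrow> 'g \<times> bool \<Rightarrow> 'g \<times> bool" (infixl \<open>\<bullet>\<close> 70) where
  "i \<bullet> j = (fst i \<otimes>\<^bsub>G\<^esub> fst j, snd i \<or> snd j)"

text \<open>Meant to be the image of the coproduct of \<open>x\<close> under \<open>f i\<close>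
  tensor the identity, given by its coordinates.\<close>

definition comult_part :: "'g \<times> bool \<Rightarrow> 'h \<Rightarrow> 'h" where
  "comult_part i x = (\<Oplus>j\<in>J. (\<kappa> i j * f (i \<bullet> j) x) \<odot> b j)"

definition comult :: "'h \<Rightarrow> ('h \<times> 'h \<Rightarrow> 'k) set" where
  "comult x = (\<Oplus>\<^bsub>H2\<^esub>i\<in>J. pure_tensor H H (b i) (comult_part i x))"

text \<open>Dually, \<open>f (u, False)\<close> goes to its inverse and \<open>f (u, True)\<close>
  to \<open>\<sigma> u\<close> times the arrow functional at the inverse of \<open>z u\<close>; the
  latter is obtained by solving the antipode equation for a skew primitive element.\<close>

definition antipode :: "'h \<Rightarrow> 'h" where
  "antipode x = (\<Oplus>j\<in>J. ((if snd j then \<sigma> (fst j) else 1) *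
     f (inv\<^bsub>G\<^esub> (if snd j then z \<otimes>\<^bsub>G\<^esub> fst j else fst j), snd j) x) \<odot> b j)"

abbreviation counit :: "'h \<Rightarrow> 'k" where
  "counit \<equiv> f (\<one>\<^bsub>G\<^esub>, False)"

section \<open>Coordinates of the structure maps\<close>

lemma finite_J: "finite J"
  using finite_G by simp

lemma jmult_closed [simp]: "fst i \<in> carrier G \<Longrightarrow> fst j \<in> carrier G \<Longrightarrow> fst (i \<bullet> j) \<in> carrier G"
  by (simp add: jmult_def)

lemma \<sigma>_one: "\<sigma> \<one>\<^bsub>G\<^esub> = 1"
  using \<sigma>_mult[of "\<one>\<^bsub>G\<^esub>" "\<one>\<^bsub>G\<^esub>"] \<sigma>_square[of "\<one>\<^bsub>G\<^esub>"] by simp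

lemma \<sigma>_inv: "u \<in> carrier G \<Longrightarrow> \<sigma> (inv\<^bsub>G\<^esub> u) = \<sigma> u"
proof -
  assume u: "u \<in> carrier G"
  then have "\<sigma> (inv\<^bsub>G\<^esub> u) * \<sigma> u = \<sigma> u * \<sigma> u" and "\<sigma> u \<noteq> 0"
    using \<sigma>_mult[of "inv\<^bsub>G\<^esub> u" u] \<sigma>_one \<sigma>_square[OF u] by auto
  then show ?thesis by simp
qed

lemma f_combination:
  assumes "fst i \<in> carrier G"
  shows "f i (\<Oplus>j\<in>J. c j \<odot> b j) = c i"
proof -
  interpret f: linear_map H field_algebra "f i" by (rule dual_linear) (use assms in simp)
  have "f i (\<Oplus>j\<in>J. c j \<odot> b j) = (\<Sum>j\<in>J. f i (c j \<odot> b j))"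
    using finite_J by (subst f.sum) auto
  also have "\<dots> = (\<Sum>j\<in>J. if j = i then c i else 0)"
    by (rule sum.cong) (use assms in \<open>auto simp: f.scale f_b\<close>)
  also have "\<dots> = c i"
    using finite_J assms by (auto simp: mem_Times_iff)
  finally show ?thesis .
qed

lemma f_separates:
  assumes "x \<in> carrier H" "y \<in> carrier H" "\<And>i. fst i \<in> carrier G \<Longrightarrow> f i x = f i y"
  shows "x = y"
proof -
  have "(\<Oplus>i\<in>J. f i x \<odot> b i) = (\<Oplus>i\<in>J. f i y \<odot> b i)"
    by (rule finsum_cong') (use assms in auto)
  then show ?thesis using expand[OF assms(1)] expand[OF assms(2)] by simp
qed

lemma linear_combination:
  assumes "\<And>j. j \<in> J \<Longrightarrow> g j \<in> dual"
  shows "linear_map H H (\<lambda>x. \<Oplus>j\<in>J. (c j * g j x) \<odot> b j)"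
proof (rule linear_map_finsum[OF alg alg finite_J])
  fix j assume j: "j \<in> J"
  show "linear_map H H (\<lambda>x. (c j * g j x) \<odot> b j)"
    by (rule linear_map_comp[OF dual_linear[OF dual_scale[OF assms[OF j]]] linear_map_scalar]) (use j in auto)
qed

lemma linear_comult_part: "fst i \<in> carrier G \<Longrightarrow> linear_map H H (comult_part i)"
  unfolding comult_part_def by (rule linear_combination) auto

lemma linear_antipode: "linear_map H H antipode"
  unfolding antipode_def by (rule linear_combination) auto

lemma comult_part_closed [simp]: "fst i \<in> carrier G \<Longrightarrow> x \<in> carrier H \<Longrightarrow> comult_part i x \<in> carrier H"
  by (rule linear_map.closed[OF linear_comult_part])

lemma antipode_closed [simp]: "x \<in> carrier H \<Longrightarrow> antipode x \<in> carrier H"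
  by (rule linear_map.closed[OF linear_antipode])

lemma f_comult_part: "fst i \<in> carrier G \<Longrightarrow> fst j \<in> carrier G \<Longrightarrow> f j (comult_part i x) = \<kappa> i j * f (i \<bullet> j) x"
  unfolding comult_part_def by (rule f_combination)

lemma f_antipode:
  "u \<in> carrier G \<Longrightarrow> f (u, False) (antipode x) = f (inv\<^bsub>G\<^esub> u, False) x"
  "u \<in> carrier G \<Longrightarrow> f (u, True) (antipode x) = \<sigma> u * f (inv\<^bsub>G\<^esub> (z \<otimes>\<^bsub>G\<^esub> u), True) x"
  unfolding antipode_def by (simp_all add: f_combination)

lemma linear_comult: "linear_map H H2 comult"
  unfolding comult_def
proof (rule linear_map_finsum[OF alg H2.alg finite_J])
  fix i assume "i \<in> J"
  then show "linear_map H H2 (\<lambda>x. pure_tensor H H (b i) (comult_part i x))"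
    by (intro linear_map_comp[OF linear_comult_part bilinear_map_right[OF HH.bilinear_pure]]) auto
qed

lemma comult_closed [simp]: "x \<in> carrier H \<Longrightarrow> comult x \<in> carrier H2"
  by (rule linear_map.closed[OF linear_comult])

lemma pairing_comult:
  assumes "fst i \<in> carrier G" "fst j \<in> carrier G" "x \<in> carrier H"
  shows "pairing (f i) (f j) (comult x) = \<kappa> i j * f (i \<bullet> j) x"
proof -
  interpret p: linear_map H2 field_algebra "pairing (f i) (f j)" by (rule linear_pairing) (use assms in simp_all)
  have "pairing (f i) (f j) (comult x) = (\<Sum>k\<in>J. pairing (f i) (f j) (pure_tensor H H (b k) (comult_part k x)))"
    unfolding comult_def using finite_J assms by (subst p.sum) (auto simp: HH.pure_closed)
  also have "\<dots> = (\<Sum>k\<in>J. if k = i then f j (comult_part i x) else 0)"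
    by (rule sum.cong) (use assms in \<open>auto simp: pairing_pure f_b\<close>)
  also have "\<dots> = f j (comult_part i x)"
    using finite_J assms by (auto simp: mem_Times_iff)
  finally show ?thesis using f_comult_part assms by simp
qed

text \<open>The second factor \<open>B\<close> stays arbitrary in order to serve both the tensor
  square and the triple tensor product.\<close>

lemma
  fixes B :: "('k, 'c) module"
  assumes B: "assoc_algebra B" and i: "fst i \<in> carrier G"
  shows linear_slice: "linear_map (tensor_algebra H B) B (tensor_lift B (\<lambda>x y. f i x \<odot>\<^bsub>B\<^esub> y))"
    and slice_pure: "x \<in> carrier H \<Longrightarrow> y \<in> carrier B \<Longrightarrow>
      tensor_lift B (\<lambda>x y. f i x \<odot>\<^bsub>B\<^esub> y) (pure_tensor H B x y) = f i x \<odot>\<^bsub>B\<^esub> y"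
proof -
  interpret B: assoc_algebra B by fact
  interpret HB: tensor H B by unfold_locales
  note bil = bilinear_map_scalar(1)[OF dual_linear[OF f_dual[OF i]] B]
  show "linear_map (tensor_algebra H B) B (tensor_lift B (\<lambda>x y. f i x \<odot>\<^bsub>B\<^esub> y))"
    by (rule HB.linear_tensor_lift[OF bil B])
  show "x \<in> carrier H \<Longrightarrow> y \<in> carrier B \<Longrightarrow>
      tensor_lift B (\<lambda>x y. f i x \<odot>\<^bsub>B\<^esub> y) (pure_tensor H B x y) = f i x \<odot>\<^bsub>B\<^esub> y"
    by (rule HB.tensor_lift_pure[OF bil B])
qed

text \<open>A tensor is recovered from its slices by tensoring them with the basis \<open>b\<close>;
  on pure tensors this is the expansion of the first factor.\<close>

lemma tensor_separates:
  fixes B :: "('k, 'c) module"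
  assumes B: "assoc_algebra B" and t: "t \<in> carrier (tensor_algebra H B)" "t' \<in> carrier (tensor_algebra H B)"
    and eq: "\<And>i. fst i \<in> carrier G \<Longrightarrow>
      tensor_lift B (\<lambda>x y. f i x \<odot>\<^bsub>B\<^esub> y) t = tensor_lift B (\<lambda>x y. f i x \<odot>\<^bsub>B\<^esub> y) t'"
  shows "t = t'"
proof -
  let ?T = "tensor_algebra H B"
  interpret B: assoc_algebra B by fact
  interpret HB: tensor H B by unfold_locales
  define L where "L i = tensor_lift B (\<lambda>x y. f i x \<odot>\<^bsub>B\<^esub> y)" for i
  have L: "linear_map ?T B (L i)" if "fst i \<in> carrier G" for i
    unfolding L_def by (rule linear_slice[OF B that])
  have L_pure: "L i (pure_tensor H B x y) = f i x \<odot>\<^bsub>B\<^esub> y"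
    if "fst i \<in> carrier G" "x \<in> carrier H" "y \<in> carrier B" for i x y
    unfolding L_def by (rule slice_pure[OF B that])
  interpret HB2: assoc_algebra ?T by (rule HB.assoc_algebra_tensor)
  note left = bilinear_map_left[OF HB.bilinear_pure] and right = bilinear_map_right[OF HB.bilinear_pure]
  have lin: "linear_map ?T ?T
      (\<lambda>t. \<Oplus>\<^bsub>?T\<^esub>i\<in>J. pure_tensor H B (b i) (L i t))"
  proof (rule linear_map_finsum[OF HB2.alg HB2.alg finite_J])
    show "linear_map ?T ?T (\<lambda>t. pure_tensor H B (b i) (L i t))" if "i \<in> J" for i
      by (rule linear_map_comp[OF L right]) (use that in auto)
  qed
  have rec: "s = (\<Oplus>\<^bsub>?T\<^esub>i\<in>J. pure_tensor H B (b i) (L i s))" if "s \<in> carrier ?T" for s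
  proof (rule HB.tensor_linear_eqI[OF HB2.linear_map_id lin _ that])
    fix x y assume x: "x \<in> carrier H" and y: "y \<in> carrier B"
    interpret p: linear_map H ?T "\<lambda>x. pure_tensor H B x y" by (rule left[OF y])
    have "pure_tensor H B x y = pure_tensor H B (\<Oplus>i\<in>J. f i x \<odot> b i) y"
      using expand[OF x] by simp
    also have "\<dots> = (\<Oplus>\<^bsub>?T\<^esub>i\<in>J. pure_tensor H B (f i x \<odot> b i) y)"
      using finite_J by (subst p.sum) auto
    also have "\<dots> = (\<Oplus>\<^bsub>?T\<^esub>i\<in>J. pure_tensor H B (b i) (L i (pure_tensor H B x y)))"
      by (rule HB2.finsum_cong')
        (use x y in \<open>auto simp: L_pure p.scale linear_map.scale[OF right] HB.pure_closed\<close>)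
    finally show "pure_tensor H B x y = \<dots>" .
  qed
  have "(\<Oplus>\<^bsub>?T\<^esub>i\<in>J. pure_tensor H B (b i) (L i t)) =
      (\<Oplus>\<^bsub>?T\<^esub>i\<in>J. pure_tensor H B (b i) (L i t'))"
    by (rule HB2.finsum_cong') (use eq t linear_map.closed[OF L] in \<open>auto simp: L_def[symmetric] HB.pure_closed\<close>)
  then show ?thesis using rec[OF t(1)] rec[OF t(2)] by simp
qed

lemma pairing_separates:
  assumes t: "t \<in> carrier H2" "t' \<in> carrier H2"
    and eq: "\<And>i j. fst i \<in> carrier G \<Longrightarrow> fst j \<in> carrier G \<Longrightarrow> pairing (f i) (f j) t = pairing (f i) (f j) t'"
  shows "t = t'"
proof (rule tensor_separates[OF alg t])
  fix i :: "'g \<times> bool" assume i: "fst i \<in> carrier G"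
  note lin = linear_slice[OF alg i]
  have *: "f j (tensor_lift H (\<lambda>x y. f i x \<odot> y) s) = pairing (f i) (f j) s" if "s \<in> carrier H2" "fst j \<in> carrier G" for j s
  proof -
    interpret f: linear_map H field_algebra "f j" by (rule dual_linear) (use that in simp)
    show ?thesis
      by (rule pairing_eqI[OF _ _ linear_map_comp[OF lin f.linear_map_axioms] that(1)])
        (use that i in \<open>simp_all add: slice_pure[OF alg] f.scale\<close>)
  qed
  show "tensor_lift H (\<lambda>x y. f i x \<odot> y) t = tensor_lift H (\<lambda>x y. f i x \<odot> y) t'"
    by (rule f_separates) (use t linear_map.closed[OF lin] * eq i in simp_all)
qed

text \<open>Slicing off the first factor leaves elements of \<open>H2\<close>, to which
  \<open>pairing_separates\<close> applies.\<close>

lemma triple_separates: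
  assumes t: "t \<in> carrier (tensor_algebra H H2)" "t' \<in> carrier (tensor_algebra H H2)"
    and eq: "\<And>i j k. fst i \<in> carrier G \<Longrightarrow> fst j \<in> carrier G \<Longrightarrow> fst k \<in> carrier G \<Longrightarrow>
      triple (f i) (f j) (f k) t = triple (f i) (f j) (f k) t'"
  shows "t = t'"
proof (rule tensor_separates[OF H2.alg t])
  fix i :: "'g \<times> bool" assume i: "fst i \<in> carrier G"
  note lin = linear_slice[OF H2.alg i]
  have *: "pairing (f j) (f k) (tensor_lift H2 (\<lambda>x y. f i x \<odot>\<^bsub>H2\<^esub> y) s) = triple (f i) (f j) (f k) s"
    if "s \<in> carrier (tensor_algebra H H2)" "fst j \<in> carrier G" "fst k \<in> carrier G" for j k s
  proof -
    interpret p: linear_map H2 field_algebra "pairing (f j) (f k)" by (rule linear_pairing) (use that in simp_all)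
    show ?thesis
      by (rule R3.tensor_linear_eqI[OF linear_map_comp[OF lin p.linear_map_axioms] linear_triple _ that(1)])
        (use that i in \<open>simp_all add: slice_pure[OF H2.alg] p.scale triple_pure\<close>)
  qed
  show "tensor_lift H2 (\<lambda>x y. f i x \<odot>\<^bsub>H2\<^esub> y) t = tensor_lift H2 (\<lambda>x y. f i x \<odot>\<^bsub>H2\<^esub> y) t'"
    by (rule pairing_separates) (use t linear_map.closed[OF lin] * eq i in simp_all)
qed

section \<open>Bialgebra axioms for the constructed coproduct\<close>

lemma factors_False: "u \<in> carrier G \<Longrightarrow> factors (f (u, False)) [(f (u, False), f (u, False))]"
  by (simp add: factors_def f_mult_False)

lemma factors_True: "u \<in> carrier G \<Longrightarrow> factors (f (u, True))
    [(f (u, True), f (u, False)), (f (z \<otimes>\<^bsub>G\<^esub> u, False), f (u, True))]"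
  by (simp add: factors_def f_mult_True)

text \<open>Tested on pairs of dual basis elements, the decisive case is that of two arrow
  functionals. Their prescribed product is zero, and the two mixed terms of the expansion cancel
  because \<open>\<sigma> z = - 1\<close> and \<open>G\<close> is commutative.\<close>

lemma comult_mult:
  assumes "x \<in> carrier H" "y \<in> carrier H"
  shows "comult (x \<otimes> y) = comult x \<otimes>\<^bsub>H2\<^esub> comult y"
proof (rule pairing_separates)
  fix i j :: "'g \<times> bool"
  assume "fst i \<in> carrier G" "fst j \<in> carrier G"
  moreover obtain u p v q where ij: "i = (u, p)" "j = (v, q)" by (cases i; cases j)
  ultimately have uv: "u \<in> carrier G" "v \<in> carrier G" by auto
  have zuv: "z \<otimes>\<^bsub>G\<^esub> u \<otimes>\<^bsub>G\<^esub> v = z \<otimes>\<^bsub>G\<^esub> (u \<otimes>\<^bsub>G\<^esub> v)" "u \<otimes>\<^bsub>G\<^esub> (z \<otimes>\<^bsub>G\<^esub> v) = z \<otimes>\<^bsub>G\<^esub> (u \<otimes>\<^bsub>G\<^esub> v)"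
    using uv by (simp_all add: G.m_ac)
  note simps = pairing_comult uv zuv assms \<kappa>_def jmult_def f_mult_False f_mult_True \<sigma>_mult \<sigma>_z
  note fac = factors_False[OF uv(1)] factors_False[OF uv(2)] factors_True[OF uv(1)] factors_True[OF uv(2)]
  show "pairing (f i) (f j) (comult (x \<otimes> y)) = pairing (f i) (f j) (comult x \<otimes>\<^bsub>H2\<^esub> comult y)"
    using assms pairing_mult[OF fac(1) fac(2), of "comult x" "comult y"]
      pairing_mult[OF fac(1) fac(4), of "comult x" "comult y"]
      pairing_mult[OF fac(3) fac(2), of "comult x" "comult y"]
      pairing_mult[OF fac(3) fac(4), of "comult x" "comult y"]
    by (cases p; cases q) (simp_all add: ij simps algebra_simps)
qed (use assms in simp_all)

lemma comult_one: "comult \<one> = \<one>\<^bsub>H2\<^esub>"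
proof (rule pairing_separates)
  fix i j :: "'g \<times> bool"
  assume ij: "fst i \<in> carrier G" "fst j \<in> carrier G"
  then show "pairing (f i) (f j) (comult \<one>) = pairing (f i) (f j) \<one>\<^bsub>H2\<^esub>"
    by (simp add: pairing_comult HH.pure_one pairing_pure f_one \<kappa>_def) (simp add: jmult_def)
qed simp_all

lemma jmult_assoc:
  "fst i \<in> carrier G \<Longrightarrow> fst j \<in> carrier G \<Longrightarrow> fst k \<in> carrier G \<Longrightarrow> (i \<bullet> j) \<bullet> k = i \<bullet> (j \<bullet> k)"
  by (simp add: jmult_def G.m_assoc)

text \<open>The cocycle identity behind associativity of the prescribed product; it amounts to
  multiplicativity of \<open>\<sigma>\<close>.\<close>

lemma \<kappa>_assoc:
  "fst i \<in> carrier G \<Longrightarrow> fst j \<in> carrier G \<Longrightarrow> fst k \<in> carrier G \<Longrightarrow> \<kappa> i j * \<kappa> (i \<bullet> j) k = \<kappa> j k * \<kappa> i (j \<bullet> k)"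
  by (auto simp: \<kappa>_def jmult_def \<sigma>_mult)

lemma clip_comult:
  assumes "fst i \<in> carrier G" "fst j \<in> carrier G"
  shows "clip (\<lambda>x. pairing (f i) (f j) (comult x)) = (\<lambda>x. \<kappa> i j * f (i \<bullet> j) x)"
  by (rule ext) (use assms dual_zero_outside[OF f_dual, of "i \<bullet> j"] in \<open>auto simp: clip_def pairing_comult\<close>)

lemma coassoc:
  assumes x: "x \<in> carrier H"
  shows "tensor_assoc H H H (tensor_map H2 H comult id (comult x)) = tensor_map H H2 id comult (comult x)"
proof (rule triple_separates)
  note lin = linear_map_comp[OF linear_tensor_map_left[OF linear_comult] linear_tensor_assoc]
    linear_tensor_map_right[OF linear_comult]
  show "tensor_assoc H H H (tensor_map H2 H comult id (comult x)) \<in> carrier (tensor_algebra H H2)"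
    "tensor_map H H2 id comult (comult x) \<in> carrier (tensor_algebra H H2)"
    using linear_map.closed[OF lin(1)] linear_map.closed[OF lin(2)] x by simp_all
  fix i j k :: "'g \<times> bool"
  assume ijk: "fst i \<in> carrier G" "fst j \<in> carrier G" "fst k \<in> carrier G"
  have "triple (f i) (f j) (f k) (tensor_assoc H H H (tensor_map H2 H comult id (comult x))) =
      \<kappa> i j * \<kappa> (i \<bullet> j) k * f ((i \<bullet> j) \<bullet> k) x"
    using ijk x by (simp add: triple_left linear_comult clip_comult pairing_scale pairing_comult)
  also have "\<dots> = \<kappa> j k * \<kappa> i (j \<bullet> k) * f (i \<bullet> (j \<bullet> k)) x"
    using ijk by (simp add: \<kappa>_assoc jmult_assoc)
  also have "\<dots> = triple (f i) (f j) (f k) (tensor_map H H2 id comult (comult x))"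
    using ijk x by (simp add: triple_right linear_comult clip_comult pairing_scale pairing_comult)
  finally show "triple (f i) (f j) (f k) (tensor_assoc H H H (tensor_map H2 H comult id (comult x))) =
    triple (f i) (f j) (f k) (tensor_map H H2 id comult (comult x))" .
qed

text \<open>
  The counit and antipode axioms compare elements of \<open>H\<close>, hence can be tested on the dual basis,
  where they become identities for the convolution product.
\<close>

lemma f_lift:
  assumes "bilinear_map H H H \<beta>" "fst i \<in> carrier G" "x \<in> carrier H" "linear_map H2 field_algebra L"
    and "\<And>a b. a \<in> carrier H \<Longrightarrow> b \<in> carrier H \<Longrightarrow> f i (\<beta> a b) = L (pure_tensor H H a b)"
  shows "f i (tensor_lift H \<beta> (comult x)) = L (comult x)"
  by (rule HH.tensor_linear_eqI[OF linear_map_comp[OF HH.linear_tensor_lift[OF assms(1) alg] dual_linear] assms(4)])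
    (use assms in \<open>auto simp: HH.tensor_lift_pure[OF assms(1) alg]\<close>)

lemma linear_two_pairings:
  assumes "g \<in> dual" "h \<in> dual" "g' \<in> dual" "h' \<in> dual"
  shows "linear_map H2 field_algebra (\<lambda>t. c * pairing g h t + c' * pairing g' h' t)"
  using linear_map_add[OF linear_map_scale[OF linear_pairing[OF assms(1,2)], of c]
      linear_map_scale[OF linear_pairing[OF assms(3,4)], of c']] by simp

lemma lift_closed: "bilinear_map H H H \<beta> \<Longrightarrow> x \<in> carrier H \<Longrightarrow> tensor_lift H \<beta> (comult x) \<in> carrier H"
  using linear_map.closed[OF HH.linear_tensor_lift[OF _ alg]] by simp

lemma counit_dual: "counit \<in> dual"
  by simp

lemma counit_axioms:
  assumes x: "x \<in> carrier H"
  shows "tensor_lift H (\<lambda>a b. counit a \<odot> b) (comult x) = x" "tensor_lift H (\<lambda>a b. counit b \<odot> a) (comult x) = x"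
proof -
  note bl = bilinear_map_scalar(1)[OF dual_linear[OF counit_dual] alg]
    and br = bilinear_map_scalar(2)[OF dual_linear[OF counit_dual] alg]
  show "tensor_lift H (\<lambda>a b. counit a \<odot> b) (comult x) = x"
  proof (rule f_separates[OF lift_closed[OF bl x] x])
    fix i :: "'g \<times> bool" assume i: "fst i \<in> carrier G"
    interpret f: linear_map H field_algebra "f i" by (rule dual_linear) (use i in simp)
    have "f i (tensor_lift H (\<lambda>a b. counit a \<odot> b) (comult x)) = pairing counit (f i) (comult x)"
      by (rule f_lift[OF bl i x linear_pairing]) (use i in \<open>simp_all add: f.scale pairing_pure\<close>)
    also have "\<dots> = f i x"
      using i x by (simp add: pairing_comult \<kappa>_def jmult_def \<sigma>_one)
    finally show "f i (tensor_lift H (\<lambda>a b. counit a \<odot> b) (comult x)) = f i x" .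
  qed
  show "tensor_lift H (\<lambda>a b. counit b \<odot> a) (comult x) = x"
  proof (rule f_separates[OF lift_closed[OF br x] x])
    fix i :: "'g \<times> bool" assume i: "fst i \<in> carrier G"
    interpret f: linear_map H field_algebra "f i" by (rule dual_linear) (use i in simp)
    have "f i (tensor_lift H (\<lambda>a b. counit b \<odot> a) (comult x)) = pairing (f i) counit (comult x)"
      by (rule f_lift[OF br i x linear_pairing]) (use i in \<open>simp_all add: f.scale pairing_pure\<close>)
    also have "\<dots> = f i x"
      using i x by (simp add: pairing_comult \<kappa>_def jmult_def)
    finally show "f i (tensor_lift H (\<lambda>a b. counit b \<odot> a) (comult x)) = f i x" .
  qed
qed

text \<open>On an arrow functional each identity has two terms. They cancel because
  \<open>\<sigma>\<close> changes sign from \<open>u\<close> to \<open>z u\<close> and is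
  insensitive to inversion.\<close>

lemma antipode_axioms:
  assumes x: "x \<in> carrier H"
  shows "tensor_lift H (\<lambda>a b. antipode a \<otimes> b) (comult x) = counit x \<odot> \<one>"
    "tensor_lift H (\<lambda>a b. a \<otimes> antipode b) (comult x) = counit x \<odot> \<one>"
proof -
  note bl = bilinear_map_comp[OF bilinear_map_mult linear_antipode linear_map_id]
    and br = bilinear_map_comp[OF bilinear_map_mult linear_map_id linear_antipode]
  have one: "f i (counit x \<odot> \<one>) = (if snd i then 0 else counit x)" if "fst i \<in> carrier G" for i
    using linear_map.scale[OF dual_linear[OF f_dual[OF that]], of \<one> "counit x"] that by (simp add: f_one)
  show "tensor_lift H (\<lambda>a b. antipode a \<otimes> b) (comult x) = counit x \<odot> \<one>"
  proof (rule f_separates[OF lift_closed[OF bl x]])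
    fix i :: "'g \<times> bool" assume i: "fst i \<in> carrier G"
    obtain u p where up: "i = (u, p)" by (cases i)
    with i have u: "u \<in> carrier G" by simp
    let ?v = "inv\<^bsub>G\<^esub> (z \<otimes>\<^bsub>G\<^esub> u)"
    have vu: "inv\<^bsub>G\<^esub> u \<otimes>\<^bsub>G\<^esub> u = \<one>\<^bsub>G\<^esub>" "\<sigma> ?v = - \<sigma> u"
      using u by (simp_all add: \<sigma>_inv \<sigma>_mult \<sigma>_z)
    show "f i (tensor_lift H (\<lambda>a b. antipode a \<otimes> b) (comult x)) = f i (counit x \<odot> \<one>)"
    proof (cases p)
      case False
      have "f i (tensor_lift H (\<lambda>a b. antipode a \<otimes> b) (comult x)) =
          pairing (f (inv\<^bsub>G\<^esub> u, False)) (f (u, False)) (comult x)"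
        by (rule f_lift[OF bl i x linear_pairing])
          (use u up False in \<open>simp_all add: f_mult_False f_antipode pairing_pure\<close>)
      then show ?thesis
        using u x i up False vu by (simp add: pairing_comult one \<kappa>_def jmult_def)
    next
      case True
      have "f i (tensor_lift H (\<lambda>a b. antipode a \<otimes> b) (comult x)) =
          \<sigma> u * pairing (f (?v, True)) (f (u, False)) (comult x) + 1 * pairing (f (?v, False)) (f (u, True)) (comult x)"
        by (rule f_lift[OF bl i x linear_two_pairings])
          (use u up True in \<open>simp_all add: f_mult_True f_antipode pairing_pure\<close>)
      then show ?thesis
        using u x i up True vu by (simp add: pairing_comult one \<kappa>_def jmult_def)
    qed
  qed (use x in simp)
  show "tensor_lift H (\<lambda>a b. a \<otimes> antipode b) (comult x) = counit x \<odot> \<one>"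
  proof (rule f_separates[OF lift_closed[OF br x]])
    fix i :: "'g \<times> bool" assume i: "fst i \<in> carrier G"
    obtain u p where up: "i = (u, p)" by (cases i)
    with i have u: "u \<in> carrier G" by simp
    let ?v = "inv\<^bsub>G\<^esub> (z \<otimes>\<^bsub>G\<^esub> u)"
    have vu: "u \<otimes>\<^bsub>G\<^esub> inv\<^bsub>G\<^esub> u = \<one>\<^bsub>G\<^esub>" "z \<otimes>\<^bsub>G\<^esub> u \<otimes>\<^bsub>G\<^esub> ?v = \<one>\<^bsub>G\<^esub>" "\<sigma> u * (\<sigma> (z \<otimes>\<^bsub>G\<^esub> u) * c) = - c" for c
      using u G.r_inv[of "z \<otimes>\<^bsub>G\<^esub> u"] \<sigma>_square[OF u]
      by (simp_all add: \<sigma>_mult \<sigma>_z mult.assoc[symmetric])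
    show "f i (tensor_lift H (\<lambda>a b. a \<otimes> antipode b) (comult x)) = f i (counit x \<odot> \<one>)"
    proof (cases p)
      case False
      have "f i (tensor_lift H (\<lambda>a b. a \<otimes> antipode b) (comult x)) =
          pairing (f (u, False)) (f (inv\<^bsub>G\<^esub> u, False)) (comult x)"
        by (rule f_lift[OF br i x linear_pairing])
          (use u up False in \<open>simp_all add: f_mult_False f_antipode pairing_pure\<close>)
      then show ?thesis
        using u x i up False vu by (simp add: pairing_comult one \<kappa>_def jmult_def)
    next
      case True
      have "f i (tensor_lift H (\<lambda>a b. a \<otimes> antipode b) (comult x)) =
          1 * pairing (f (u, True)) (f (inv\<^bsub>G\<^esub> u, False)) (comult x) +
          \<sigma> u * pairing (f (z \<otimes>\<^bsub>G\<^esub> u, False)) (f (?v, True)) (comult x)"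
        by (rule f_lift[OF br i x linear_two_pairings])
          (use u up True in \<open>simp_all add: f_mult_True f_antipode pairing_pure\<close>)
      then show ?thesis
        using u x i up True vu by (simp add: pairing_comult one \<kappa>_def jmult_def)
    qed
  qed (use x in simp)
qed

lemma hopf_algebra_comult: "hopf_algebra H comult counit antipode"
proof (unfold_locales)
  show "comult \<in> alg_hom H H2"
    by (rule alg_homI[OF linear_comult comult_mult comult_one])
  show "counit \<in> alg_hom H field_algebra"
    by (rule alg_homI[OF dual_linear[OF counit_dual]]) (simp_all add: f_mult_False f_one)
  show "antipode \<in> lin_map H H"
    using linear_antipode by (simp add: linear_map_def linear_map_axioms_def)
qed (simp_all add: coassoc counit_axioms antipode_axioms)

end


section \<open>Cycles with vanishing squares admit a Hopf structure\<close>

lemma (in gentle_quiver) admits_hopf_structure_cycles: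
  assumes n: "even n" and cyc: "union_of_basic_cycles n Q"
    and sq: "\<And>\<beta> \<alpha>. composable Q \<beta> \<alpha> \<Longrightarrow> path2_elem Q \<beta> \<alpha> \<in> I"
  shows "admits_hopf_structure H.AI"
proof -
  obtain d f g where n1: "n \<ge> 1" and d: "d \<ge> (1 :: nat)"
    and f: "bij_betw f (verts Q) ({..<d} \<times> {..<n})" and g: "bij_betw g (arcs Q) ({..<d} \<times> {..<n})"
    and f_tail: "\<And>\<alpha>. \<alpha> \<in> arcs Q \<Longrightarrow> f (tail Q \<alpha>) = g \<alpha>"
    and f_head: "\<And>\<alpha>. \<alpha> \<in> arcs Q \<Longrightarrow> f (head Q \<alpha>) = (fst (g \<alpha>), Suc (snd (g \<alpha>)) mod n)"
    using union_of_basic_cyclesE[OF cyc] by metis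
  define G where "G = integer_mod_group d \<times>\<times> integer_mod_group n"
  have carrier_G: "carrier G = {0..<int d} \<times> {0..<int n}"
    using n1 d by (simp add: G_def carrier_integer_mod_group)
  have mult_G: "x \<otimes>\<^bsub>G\<^esub> y = ((fst x + fst y) mod int d, (snd x + snd y) mod int n)" for x y
    by (cases x; cases y) (simp add: G_def)
  have "group G" by (simp add: G_def DirProd_group)
  then have "comm_group G"
    by (rule group.group_comm_groupI) (simp add: mult_G add.commute)
  \<comment> \<open>The residues in \<open>integer_mod_group\<close> are integers, whereas the
    cycles are labelled by natural numbers.\<close>
  define nn where "nn = map_prod nat nat"
  have nn: "bij_betw nn (carrier G) ({..<d} \<times> {..<n})"
    unfolding nn_def carrier_G
    by (rule bij_betw_byWitness[of _ "map_prod int int"]) auto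
  define vv where "vv u = the_inv_into (verts Q) f (nn u)" for u
  define aa where "aa u = the_inv_into (arcs Q) g (nn u)" for u
  have vv: "bij_betw vv (carrier G) (verts Q)"
    using bij_betw_trans[OF nn bij_betw_the_inv_into[OF f]] by (simp add: vv_def[abs_def] o_def)
  have aa: "bij_betw aa (carrier G) (arcs Q)"
    using bij_betw_trans[OF nn bij_betw_the_inv_into[OF g]] by (simp add: aa_def[abs_def] o_def)
  have f_vv: "f (vv u) = nn u" and g_aa: "g (aa u) = nn u" if "u \<in> carrier G" for u
    using f_the_inv_into_f_bij_betw[OF f] f_the_inv_into_f_bij_betw[OF g] bij_betwE[OF nn] that
    by (simp_all add: vv_def aa_def)
  have vv_in [simp]: "vv u \<in> verts Q" and aa_in [simp]: "aa u \<in> arcs Q" if "u \<in> carrier G" for u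
    using that vv aa by (auto simp: bij_betw_def)
  have vv_inj: "vv u = vv w \<longleftrightarrow> u = w" and aa_inj: "aa u = aa w \<longleftrightarrow> u = w"
    if "u \<in> carrier G" "w \<in> carrier G" for u w
    using that vv aa by (auto simp: bij_betw_def dest: inj_onD)
  have f_inj: "x = y" if "f x = f y" "x \<in> verts Q" "y \<in> verts Q" for x y
    using that f by (auto simp: bij_betw_def dest: inj_onD)
  define z :: "int \<times> int" where "z = (0, 1)"
  \<comment> \<open>For \<open>n = 1\<close> the pair \<open>(0, 1)\<close> would not consist of
    reduced residues; evenness rules this out.\<close>
  have n2: "n \<ge> 2" using n n1 by (auto elim!: evenE)
  have z: "z \<in> carrier G" using n2 d by (simp add: z_def carrier_G)
  have tail_aa: "tail Q (aa u) = vv u" if u: "u \<in> carrier G" for u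
    by (rule f_inj) (use u f_tail f_vv g_aa in simp_all)
  have head_aa: "head Q (aa u) = vv (z \<otimes>\<^bsub>G\<^esub> u)" if u: "u \<in> carrier G" for u
  proof (rule f_inj)
    have zu: "z \<otimes>\<^bsub>G\<^esub> u \<in> carrier G"
      using z u \<open>group G\<close> by (simp add: group.is_monoid monoid.m_closed)
    have "nat ((1 + snd u) mod int n) = Suc (nat (snd u)) mod n"
      using u by (auto simp: carrier_G nat_mod_distrib Suc_nat_eq_nat_zadd1)
    then show "f (head Q (aa u)) = f (vv (z \<otimes>\<^bsub>G\<^esub> u))"
      using u zu f_head f_vv g_aa by (auto simp: mult_G z_def nn_def carrier_G)
    show "vv (z \<otimes>\<^bsub>G\<^esub> u) \<in> verts Q" using zu by simp
  qed (use u in simp)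
  txt \<open>\<open>G\<close> labels vertices by cycle and position; \<open>z\<close> moves along the arrow, \<open>\<sigma>\<close> is the parity of the position.\<close>
  define \<sigma> :: "int \<times> int \<Rightarrow> 'k" where "\<sigma> u = (if even (snd u) then 1 else - 1)" for u
  interpret D: algebra_dual H.AI
    unfolding algebra_dual_def by (rule H.assoc_algebra_quot)
  define pp where "pp i = (vv (fst i), if snd i then [aa (fst i)] else [])" for i
  define b where "b i = path_class (pp i)" for i
  define \<xi> where "\<xi> i = D.clip (path_coeff (pp i))" for i
  have good: "pp i \<in> good_paths" and path: "pp i \<in> quiver_paths Q" if "fst i \<in> carrier G" for i
    using that good_path by (auto simp: pp_def tail_aa)
  have pp_inj: "pp i = pp j \<longleftrightarrow> i = j" if "fst i \<in> carrier G" "fst j \<in> carrier G" for i j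
    using that vv_inj by (cases i; cases j) (auto simp: pp_def)
  have \<xi>_dual: "\<xi> i \<in> D.dual" if "fst i \<in> carrier G" for i
    unfolding \<xi>_def by (intro D.clip_dual linear_map_path_coeff good that)
  have \<xi>_b: "\<xi> i (b j) = (if i = j then 1 else 0)" if "fst i \<in> carrier G" "fst j \<in> carrier G" for i j
    using that path by (simp add: \<xi>_def b_def path_coeff_class good pp_inj)
  have fin: "finite (carrier G)" by (simp add: carrier_G)
  have "skew_dual_basis H.AI G b \<xi> z \<sigma>"
    unfolding skew_dual_basis_def skew_dual_basis_axioms_def
  proof (intro conjI allI impI D.algebra_dual_axioms \<open>comm_group G\<close> fin z \<xi>_dual \<xi>_b)
    fix u v assume uv: "u \<in> carrier G" "v \<in> carrier G"
    \<comment> \<open>Parity survives reduction modulo \<open>n\<close> because \<open>n\<close> is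
      even, which makes \<open>\<sigma>\<close> a character.\<close>
    have "even ((snd u + snd v) mod int n) \<longleftrightarrow> even (snd u + snd v)"
      using n by (simp add: dvd_mod_iff)
    then show "\<sigma> (u \<otimes>\<^bsub>G\<^esub> v) = \<sigma> u * \<sigma> v"
      by (simp add: \<sigma>_def mult_G)
  next
    show "\<sigma> u * \<sigma> u = 1" for u by (simp add: \<sigma>_def)
    show "\<sigma> z = - 1" by (simp add: \<sigma>_def z_def)
  next
    fix i :: "(int \<times> int) \<times> bool" assume i: "fst i \<in> carrier G"
    show "b i \<in> carrier H.AI" using path[OF i] by (simp add: b_def)
    show "\<xi> i \<one>\<^bsub>H.AI\<^esub> = (if snd i then 0 else 1)"
      using good[OF i] by (simp add: \<xi>_def pp_def path_coeff_one)
  next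
    fix x u assume x: "u \<in> carrier G" "x \<in> carrier H.AI"
    fix y assume y: "y \<in> carrier H.AI"
    have zu: "z \<otimes>\<^bsub>G\<^esub> u \<in> carrier G"
      using z x \<open>group G\<close> by (simp add: group.is_monoid monoid.m_closed)
    show "\<xi> (u, False) (x \<otimes>\<^bsub>H.AI\<^esub> y) = \<xi> (u, False) x * \<xi> (u, False) y"
      using x y good[of "(u, False)"] by (simp add: \<xi>_def pp_def path_coeff_mult)
    show "\<xi> (u, True) (x \<otimes>\<^bsub>H.AI\<^esub> y) = \<xi> (u, True) x * \<xi> (u, False) y + \<xi> (z \<otimes>\<^bsub>G\<^esub> u, False) x * \<xi> (u, True) y"
      using x y zu good[of "(u, True)"] by (simp add: \<xi>_def pp_def path_coeff_mult head_aa)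
  next
    fix x assume x: "x \<in> carrier H.AI"
    let ?J = "carrier G \<times> (UNIV :: bool set)"
    have finJ: "finite ?J" using fin by simp
    have term_lin: "linear_map H.AI H.AI (\<lambda>x. \<xi> i x \<odot>\<^bsub>H.AI\<^esub> b i)" if "i \<in> ?J" for i
      by (rule linear_map_comp[OF D.dual_linear[OF \<xi>_dual] D.linear_map_scalar])
        (use that path in \<open>auto simp: b_def\<close>)
    have lin: "linear_map H.AI H.AI (\<lambda>x. \<Oplus>\<^bsub>H.AI\<^esub>i\<in>?J. \<xi> i x \<odot>\<^bsub>H.AI\<^esub> b i)"
      by (rule linear_map_finsum[OF D.alg D.alg finJ term_lin])
    show "x = (\<Oplus>\<^bsub>H.AI\<^esub>i\<in>?J. \<xi> i x \<odot>\<^bsub>H.AI\<^esub> b i)"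
    \<comment> \<open>It suffices to expand path classes: a vertex or an arrow reproduces itself,
      and any longer path starts with a vanishing product of two arrows and is zero.\<close>
    proof (rule linear_eqI[OF D.linear_map_id lin _ x])
      fix y assume y: "y \<in> quiver_paths Q"
      show "path_class y = (\<Oplus>\<^bsub>H.AI\<^esub>i\<in>?J. \<xi> i (path_class y) \<odot>\<^bsub>H.AI\<^esub> b i)"
      proof (cases "\<exists>j\<in>?J. y = pp j")
        case True
        then obtain j where j: "j \<in> ?J" "y = pp j" by blast
        have bc: "b i \<in> carrier H.AI" if "i \<in> ?J" for i using path[of i] that by (auto simp: b_def)
        have "(\<Oplus>\<^bsub>H.AI\<^esub>i\<in>?J. \<xi> i (path_class y) \<odot>\<^bsub>H.AI\<^esub> b i) =
            (\<Oplus>\<^bsub>H.AI\<^esub>i\<in>?J. if j = i then b i else \<zero>\<^bsub>H.AI\<^esub>)"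
        proof (rule D.finsum_cong'[OF refl])
          show "(\<lambda>i. if j = i then b i else \<zero>\<^bsub>H.AI\<^esub>) \<in> ?J \<rightarrow> carrier H.AI"
            using bc by simp
          fix i assume i: "i \<in> ?J"
          then have "\<xi> i (path_class y) = (if j = i then 1 else 0)"
            using \<xi>_b[of i j] j by (auto simp: b_def mem_Times_iff)
          then show "\<xi> i (path_class y) \<odot>\<^bsub>H.AI\<^esub> b i = (if j = i then b i else \<zero>\<^bsub>H.AI\<^esub>)"
            using bc[OF i] by simp
        qed
        also have "\<dots> = b j"
          by (rule D.finsum_singleton[OF j(1) finJ]) (use bc in auto)
        finally show ?thesis by (simp add: b_def j)
      next
        case False
        have "path_class y = \<zero>\<^bsub>H.AI\<^esub>"
        proof -
          obtain u p where up: "y = (u, p)" by (cases y)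
          show ?thesis
          proof (cases "length p \<le> 1")
            case True
            have "u \<in> verts Q" using y quiver_paths_append[of u "[]" p] by (simp add: up)
            then obtain w where w: "w \<in> carrier G" "u = vv w"
              using bij_betw_imp_surj_on[OF vv] by blast
            have "\<exists>j\<in>?J. y = pp j"
            proof (cases p)
              case Nil
              then show ?thesis using w by (intro bexI[of _ "(w, False)"]) (auto simp: pp_def up)
            next
              case (Cons \<alpha> q)
              then have q: "q = []" "\<alpha> \<in> arcs Q" "tail Q \<alpha> = u" using True y up by auto
              then obtain w' where w': "w' \<in> carrier G" "\<alpha> = aa w'"
                using bij_betw_imp_surj_on[OF aa] by blast
              then have "w' = w" using q w tail_aa vv_inj by auto
              then show ?thesis using w w' q Cons by (intro bexI[of _ "(w, True)"]) (auto simp: pp_def up)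
            qed
            with False show ?thesis by blast
          next
            case False
            then obtain \<alpha> \<beta> q where p: "p = \<alpha> # \<beta> # q"
              by (cases p; cases "tl p") auto
            then have comp: "composable Q \<beta> \<alpha>" and q: "(head Q \<beta>, q) \<in> quiver_paths Q" and u: "u = tail Q \<alpha>"
              using y up by (auto simp: composable_def)
            have "path_class y = path_class (head Q \<beta>, q) \<otimes>\<^bsub>H.AI\<^esub> path_class (tail Q \<alpha>, [\<alpha>, \<beta>])"
              using path_class_mult[OF q composable_path[OF comp]] by (simp add: up p u)
            also have "\<dots> = \<zero>\<^bsub>H.AI\<^esub>"
              using path_class_zero[OF comp sq[OF comp]] q by simp
            finally show ?thesis .
          qed
        qed
        then show ?thesis using linear_map.zero[OF lin] by simp
      qed
    qed
  qed
  then interpret skew_dual_basis H.AI G b \<xi> z \<sigma> .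
  show ?thesis
    unfolding admits_hopf_structure_def using hopf_algebra_comult by blast
qed

text \<open>Following an arrow is right multiplication by \<open>gen\<close>, so the cycles are the
  left cosets of the subgroup generated by \<open>gen\<close>, all of the same size.\<close>

lemma (in gentle_hopf) union_of_basic_cycles_ord_gen: "union_of_basic_cycles (VG.ord gen) Q"
proof (rule union_of_basic_cyclesI[where c = "\<lambda>v. v \<diamondop> gen"])
  show "finite (verts Q)" by simp
  show "verts Q \<noteq> {}" using vone by auto
  show "VG.ord gen \<ge> 1" by (rule VG.ord_ge_1) simp_all
  show "\<exists>!\<alpha>. \<alpha> \<in> arcs Q \<and> tail Q \<alpha> = v" if "v \<in> verts Q" for v
    using ex_arc_from[OF that] unique_out_arc by blast
  show "head Q \<alpha> = tail Q \<alpha> \<diamondop> gen" if "\<alpha> \<in> arcs Q" for \<alpha>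
    using head_arc_from[of "tail Q \<alpha>"] arc_from_tail[OF that] that by simp
  have gi: "gen [^]\<^bsub>VG\<^esub> (i::nat) \<in> verts Q" for i
    using VG.nat_pow_closed[of gen i] by simp
  have pow: "((\<lambda>v. v \<diamondop> gen) ^^ i) v = v \<diamondop> gen [^]\<^bsub>VG\<^esub> i" if "v \<in> verts Q" for v i
  proof (induction i)
    case 0
    then show ?case using VG.r_one[of v] that by simp
  next
    case (Suc i)
    then show ?case using VG.m_assoc[of v "gen [^]\<^bsub>VG\<^esub> i" gen] that gi by simp
  qed
  show "((\<lambda>v. v \<diamondop> gen) ^^ VG.ord gen) v = v" if "v \<in> verts Q" for v
    using pow[OF that] VG.pow_ord_eq_1[of gen] VG.r_one[of v] that by simp
  show "((\<lambda>v. v \<diamondop> gen) ^^ i) v \<noteq> v" if v: "v \<in> verts Q" and i: "0 < i" "i < VG.ord gen" for v i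
  proof
    assume "((\<lambda>v. v \<diamondop> gen) ^^ i) v = v"
    then have "gen [^]\<^bsub>VG\<^esub> i = vone"
      using pow[OF v] VG.l_cancel_one[of v "gen [^]\<^bsub>VG\<^esub> i"] v gi by simp
    then have "VG.ord gen dvd i" using VG.pow_eq_id[of gen i] by simp
    then show False using i by (auto dest: dvd_imp_le)
  qed
qed

theorem corollary3p7:
  fixes Q :: "('v, 'a) pre_digraph"
    and I :: "('v \<times> 'a list \<Rightarrow> 'k::{alg_closed_field, field_char_0}) set"
  assumes gentle: "gentle_quiver Q I"
    and fin_dim: "finite_dimensional (quot_algebra (path_algebra Q) I)"
    and has_arrow: "arcs Q \<noteq> {}"
  shows "admits_hopf_structure (quot_algebra (path_algebra Q) I) \<longleftrightarrow>
    (\<exists>n. even n \<and> union_of_basic_cycles n Q \<and>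
         I = arrow_ideal Q \<cdot>\<^bsub>path_algebra Q\<^esub> arrow_ideal Q)"
proof
  assume "admits_hopf_structure (quot_algebra (path_algebra Q) I)"
  then obtain \<Delta> \<epsilon> S where "hopf_algebra (quot_algebra (path_algebra Q) I) \<Delta> \<epsilon> S"
    by (auto simp: admits_hopf_structure_def)
  then interpret gentle_hopf Q I \<Delta> \<epsilon> S
    using assms by (intro gentle_hopf.intro gentle_hopf_axioms.intro)
  show "\<exists>n. even n \<and> union_of_basic_cycles n Q \<and> I = arrow_ideal Q \<cdot>\<^bsub>path_algebra Q\<^esub> arrow_ideal Q"
    using even_ord_gen union_of_basic_cycles_ord_gen ideal_eq_square[OF all_squares_zero] by blast
next
  interpret gentle_quiver Q I by (rule gentle)
  assume "\<exists>n. even n \<and> union_of_basic_cycles n Q \<and> I = arrow_ideal Q \<cdot>\<^bsub>path_algebra Q\<^esub> arrow_ideal Q"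
  then obtain n where n: "even n" "union_of_basic_cycles n Q" "I = arrow_ideal Q \<cdot>\<^bsub>path_algebra Q\<^esub> arrow_ideal Q"
    by blast
  have "path2_elem Q \<beta> \<alpha> \<in> I" if "composable Q \<beta> \<alpha>" for \<beta> \<alpha>
    by (subst n(3)) (rule path2_in_square[OF that])
  then show "admits_hopf_structure (quot_algebra (path_algebra Q) I)"
    by (rule admits_hopf_structure_cycles[OF n(1,2)])
qed

end
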